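(* Each simple right $\mathcal{O}_{\mathbf{q}}(\mathbb{K}^n)$-module $N$ on which every variable $x_1,\dots,x_n$ acts non-trivially (i.e. $Nx_j\ne 0$ for all $j$) has the form $M(\underline{\alpha})$ for some $\underline{\alpha}\in(\mathbb{K}^* )^n$, i.e. is isomorphic to the restriction of $M(\underline{\alpha})$ to $\mathcal{O}_{\mathbf{q}}(\mathbb{K}^n)$. Furthermore, there is a surjective map from $(\mathbb{K}^* )^n$ onto the set of all (isomorphism classes of) such simple $\mathcal{O}_{\mathbf{q}}(\mathbb{K}^n)$-modules.
   Context: $\mathbb{K}$ is an algebraically closed field, $\mathbb{K}^*=\mathbb{K}\setminus\{0\}$, and "module" means right module. $\mathbf{q}=(q_{ij})$ is an $n\times n$ multiplicatively antisymmetric matrix over $\mathbb{K}^*$ (that is, $q_{ii}=1$ and $q_{ji}=q_{ij}^{-1}$), and the subgroup of $\mathbb{K}^*$ generated by the $q_{ij}$ is assumed torsion, hence finite cyclic; let $m$ be its order and $q$ a generator. $\mathcal{O}_{\mathbf{q}}(\mathbb{K}^n)$ is the $\mathbb{K}$-algebra generated by $x_1,\dots,x_n$ with relations $x_ix_j=q_{ij}x_jx_i$ for all $i,j$. The quantum torus $\mathbb{A}_{\mathbf{q}}\supseteq\mathcal{O}_{\mathbf{q}}(\mathbb{K}^n)$ is its localization at the Ore set generated by $x_1,\dots,x_n$. Normal form (standing convention): $\mathbb{A}_{\mathbf{q}}$ is assumed to be in the form $$\mathbb{A}_{\mathbf{q}}\cong \mathbb{A}_{q^{h_1}}\otimes\mathbb{A}_{q^{h_2}}\otimes\cdots\otimes\mathbb{A}_{q^{h_s}}\otimes\mathbb{K}[\mathbb{Z}^{n-2s}],$$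 where $2s\le n$, $h_1=1$, each $h_i$ is a positive divisor of $m$ with $h_i<m$, $h_2\mid h_3\mid\cdots\mid h_s$, and $\mathbb{A}_{q^{h_i}}$ is the rank-2 quantum torus generated by $X_i^{\pm1},X_{i+s}^{\pm1}$ with $X_iX_{i+s}=q^{h_i}X_{i+s}X_i$; the group algebra $\mathbb{K}[\mathbb{Z}^{n-2s}]$ is generated by $X_{2s+1}^{\pm1},\dots,X_n^{\pm1}$. Thus, via a fixed isomorphism, $\mathbb{A}_{\mathbf{q}}$ is the $\mathbb{K}$-algebra generated by $X_1^{\pm1},\dots,X_n^{\pm1}$ with defining relations $X_iX_{i+s}=q^{h_i}X_{i+s}X_i$ for $1\le i\le s$, all other pairs of the $X_k$ commuting; the $X_k$ are monomials in the $x_j^{\pm1}$. Put $k_i:=m/h_i$ for $1\le i\le s$. For $\underline{\alpha}=(\alpha_1,\dots,\alpha_n)\in(\mathbb{K}^* )^n$, $M(\underline{\alpha})$ is the right $\mathbb{A}_{\mathbf{q}}$-module with $\mathbb{K}$-basis $e(a_1,\dots,a_s)$, $0\le a_i\le k_i-1$, and action $e(a_1,\dots,a_s)X_i=\alpha_i\,e(a_1,\dots,a_i+_i1,\dots,a_s)$ for $1\le i\le s$; $e(a_1,\dots,a_s)X_{i+s}=\alpha_i^{-1}\alpha_{i+s}(q^{h_i})^{a_i-1}e(a_1,\dots,a_i+_i(-1),\dots,a_s)$ for $1\le i\le s$; $e(a_1,\dots,a_s)X_{2s+j}=\alpha_{2s+j}\,e(a_1,\dots,a_s)$ for $1\le j\le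 n-2s$; where $+_i$ is addition in $\mathbb{Z}/k_i\mathbb{Z}$. It is regarded as an $\mathcal{O}_{\mathbf{q}}(\mathbb{K}^n)$-module by restriction. *)

theory Defs
  imports "HOL-Algebra.Algebraic_Closure_Type"
begin

section \<open>Right modules over a (non-commutative) ring\<close>

text \<open>The module record of HOL-Algebra is tied to commutative rings, so right modules get their
  own record. As there, the fields \<open>mult\<close> and \<open>one\<close> inherited from \<open>ring\<close> carry no meaning.\<close>

record ('r, 'm) rmodule = "'m ring" +
  ract :: "'m \<Rightarrow> 'r \<Rightarrow> 'm"  (infixl \<open>\<cdot>\<index>\<close> 70)

locale right_module = R: ring A + M: abelian_group M
  for A :: "('r, 'x) ring_scheme" (structure)
    and M :: "('r, 'm, 'y) rmodule_scheme" (structure) +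
  assumes ract_closed: "\<lbrakk>v \<in> carrier M; r \<in> carrier A\<rbrakk> \<Longrightarrow> v \<cdot>\<^bsub>M\<^esub> r \<in> carrier M"
    and ract_add_left: "\<lbrakk>v \<in> carrier M; w \<in> carrier M; r \<in> carrier A\<rbrakk>
          \<Longrightarrow> (v \<oplus>\<^bsub>M\<^esub> w) \<cdot>\<^bsub>M\<^esub> r = v \<cdot>\<^bsub>M\<^esub> r \<oplus>\<^bsub>M\<^esub> w \<cdot>\<^bsub>M\<^esub> r"
    and ract_add_right: "\<lbrakk>v \<in> carrier M; r \<in> carrier A; t \<in> carrier A\<rbrakk>
          \<Longrightarrow> v \<cdot>\<^bsub>M\<^esub> (r \<oplus>\<^bsub>A\<^esub> t) = v \<cdot>\<^bsub>M\<^esub> r \<oplus>\<^bsub>M\<^esub> v \<cdot>\<^bsub>M\<^esub> t"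
    and ract_mult: "\<lbrakk>v \<in> carrier M; r \<in> carrier A; t \<in> carrier A\<rbrakk>
          \<Longrightarrow> v \<cdot>\<^bsub>M\<^esub> (r \<otimes>\<^bsub>A\<^esub> t) = (v \<cdot>\<^bsub>M\<^esub> r) \<cdot>\<^bsub>M\<^esub> t"
    and ract_one: "v \<in> carrier M \<Longrightarrow> v \<cdot>\<^bsub>M\<^esub> \<one>\<^bsub>A\<^esub> = v"

definition right_submodule ::
    "'m set \<Rightarrow> ('r, 'x) ring_scheme \<Rightarrow> ('r, 'm, 'y) rmodule_scheme \<Rightarrow> bool" where
  "right_submodule U A M \<longleftrightarrow>
     additive_subgroup U M \<and> (\<forall>v\<in>U. \<forall>r\<in>carrier A. v \<cdot>\<^bsub>M\<^esub> r \<in> U)"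

definition simple_right_module ::
    "('r, 'x) ring_scheme \<Rightarrow> ('r, 'm, 'y) rmodule_scheme \<Rightarrow> bool" where
  "simple_right_module A M \<longleftrightarrow> right_module A M \<and> carrier M \<noteq> {\<zero>\<^bsub>M\<^esub>} \<and>
     (\<forall>U. right_submodule U A M \<longrightarrow> U = {\<zero>\<^bsub>M\<^esub>} \<or> U = carrier M)"

definition rmodule_iso :: "('r, 'x) ring_scheme \<Rightarrow> ('r, 'm, 'y) rmodule_scheme
    \<Rightarrow> ('r, 'l, 'z) rmodule_scheme \<Rightarrow> ('m \<Rightarrow> 'l) set" where
  "rmodule_iso A M N = {f. bij_betw f (carrier M) (carrier N) \<and>
     (\<forall>v\<in>carrier M. \<forall>w\<in>carrier M. f (v \<oplus>\<^bsub>M\<^esub> w) = f v \<oplus>\<^bsub>N\<^esub> f w) \<and>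
     (\<forall>v\<in>carrier M. \<forall>r\<in>carrier A. f (v \<cdot>\<^bsub>M\<^esub> r) = f v \<cdot>\<^bsub>N\<^esub> r)}"

definition rmodule_isomorphic :: "('r, 'x) ring_scheme \<Rightarrow> ('r, 'm, 'y) rmodule_scheme
    \<Rightarrow> ('r, 'l, 'z) rmodule_scheme \<Rightarrow> bool" where
  "rmodule_isomorphic A M N \<longleftrightarrow> rmodule_iso A M N \<noteq> {}"

definition restrict_along :: "('r \<Rightarrow> 't) \<Rightarrow> ('t, 'm) rmodule \<Rightarrow> ('r, 'm) rmodule" where
  "restrict_along f M = \<lparr>carrier = carrier M, monoid.mult = monoid.mult M, one = \<one>\<^bsub>M\<^esub>,
     zero = \<zero>\<^bsub>M\<^esub>, add = add M, ract = (\<lambda>v r. v \<cdot>\<^bsub>M\<^esub> f r)\<rparr>"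

section \<open>Algebras given by generators and relations\<close>

text \<open>Elements of the free algebra over a field on the set \<open>L\<close> of letters are the finitely
  supported functions on words over \<open>L\<close>; the product is convolution along concatenation.\<close>

definition free_algebra :: "'l set \<Rightarrow> ('l list \<Rightarrow> 'k::field) ring" where
  "free_algebra L = \<lparr>
     carrier = {f. finite {w. f w \<noteq> 0} \<and> (\<forall>w. f w \<noteq> 0 \<longrightarrow> set w \<subseteq> L)},
     monoid.mult = (\<lambda>f g w. \<Sum>i\<le>length w. f (take i w) * g (drop i w)),
     one = (\<lambda>w. if w = [] then 1 else 0),
     zero = (\<lambda>w. 0),
     add = (\<lambda>f g w. f w + g w)\<rparr>"

definition fmonom :: "'k::field \<Rightarrow> 'l list \<Rightarrow> ('l list \<Rightarrow> 'k)" where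
  "fmonom c u = (\<lambda>w. if w = u then c else 0)"

definition presented_algebra ::
    "'l set \<Rightarrow> ('l list \<Rightarrow> 'k::field) set \<Rightarrow> ('l list \<Rightarrow> 'k) set ring" where
  "presented_algebra L R = free_algebra L Quot genideal (free_algebra L) R"

definition pa_class ::
    "'l set \<Rightarrow> ('l list \<Rightarrow> 'k::field) set \<Rightarrow> ('l list \<Rightarrow> 'k) \<Rightarrow> ('l list \<Rightarrow> 'k) set" where
  "pa_class L R f = genideal (free_algebra L) R +>\<^bsub>free_algebra L\<^esub> f"

section \<open>The algebra \<open>O\<^sub>q(K\<^sup>n)\<close>\<close>

definition mult_antisym :: "nat \<Rightarrow> (nat \<Rightarrow> nat \<Rightarrow> 'k::field) \<Rightarrow> bool" where
  "mult_antisym n Q \<longleftrightarrow> (\<forall>i\<in>{1..n}. Q i i = 1) \<and>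
     (\<forall>i\<in>{1..n}. \<forall>j\<in>{1..n}. Q i j \<noteq> 0 \<and> Q j i = inverse (Q i j))"

abbreviation Kmult :: "'k::field monoid" where
  "Kmult \<equiv> units_of ring_of_type_algebra"

definition param_group :: "nat \<Rightarrow> (nat \<Rightarrow> nat \<Rightarrow> 'k::field) \<Rightarrow> 'k set" where
  "param_group n Q = generate Kmult {Q i j | i j. i \<in> {1..n} \<and> j \<in> {1..n}}"

definition Oq_rels :: "nat \<Rightarrow> (nat \<Rightarrow> nat \<Rightarrow> 'k::field) \<Rightarrow> (nat list \<Rightarrow> 'k) set" where
  "Oq_rels n Q = {fmonom 1 [i, j] \<ominus>\<^bsub>free_algebra {1..n}\<^esub> fmonom (Q i j) [j, i] | i j.
     i \<in> {1..n} \<and> j \<in> {1..n}}"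

definition Oq :: "nat \<Rightarrow> (nat \<Rightarrow> nat \<Rightarrow> 'k::field) \<Rightarrow> (nat list \<Rightarrow> 'k) set ring" where
  "Oq n Q = presented_algebra {1..n} (Oq_rels n Q)"

definition Oq_var :: "nat \<Rightarrow> (nat \<Rightarrow> nat \<Rightarrow> 'k::field) \<Rightarrow> nat \<Rightarrow> (nat list \<Rightarrow> 'k) set" where
  "Oq_var n Q j = pa_class {1..n} (Oq_rels n Q) (fmonom 1 [j])"

definition Oq_scalar :: "nat \<Rightarrow> (nat \<Rightarrow> nat \<Rightarrow> 'k::field) \<Rightarrow> 'k \<Rightarrow> (nat list \<Rightarrow> 'k) set" where
  "Oq_scalar n Q c = pa_class {1..n} (Oq_rels n Q) (fmonom c [])"

section \<open>Localization\<close>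

inductive_set mult_closure :: "('r, 'x) ring_scheme \<Rightarrow> 'r set \<Rightarrow> 'r set"
  for R :: "('r, 'x) ring_scheme" and G :: "'r set" where
  one: "\<one>\<^bsub>R\<^esub> \<in> mult_closure R G"
| mult: "\<lbrakk>t \<in> mult_closure R G; g \<in> G\<rbrakk> \<Longrightarrow> t \<otimes>\<^bsub>R\<^esub> g \<in> mult_closure R G"

text \<open>\<open>(A, \<iota>)\<close> is a right ring of fractions of \<open>R\<close> with respect to \<open>S\<close>. It is unique up to
  isomorphism over \<open>R\<close>, and it exists if and only if \<open>S\<close> is a right Ore set of \<open>R\<close> satisfying
  the usual reversibility condition.\<close>

definition is_localization ::
    "('r, 'x) ring_scheme \<Rightarrow> 'r set \<Rightarrow> ('a, 'y) ring_scheme \<Rightarrow> ('r \<Rightarrow> 'a) \<Rightarrow> bool" where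
  "is_localization R S A \<iota> \<longleftrightarrow> ring A \<and> \<iota> \<in> ring_hom R A \<and>
     (\<forall>t\<in>S. \<iota> t \<in> Units A) \<and>
     (\<forall>a\<in>carrier A. \<exists>r\<in>carrier R. \<exists>t\<in>S. a = \<iota> r \<otimes>\<^bsub>A\<^esub> inv\<^bsub>A\<^esub> (\<iota> t)) \<and>
     (\<forall>r\<in>carrier R. \<iota> r = \<zero>\<^bsub>A\<^esub> \<longleftrightarrow> (\<exists>t\<in>S. r \<otimes>\<^bsub>R\<^esub> t = \<zero>\<^bsub>R\<^esub>))"

definition is_quantum_torus ::
    "nat \<Rightarrow> (nat \<Rightarrow> nat \<Rightarrow> 'k::field) \<Rightarrow> 'a ring \<Rightarrow> ((nat list \<Rightarrow> 'k) set \<Rightarrow> 'a) \<Rightarrow> bool" where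
  "is_quantum_torus n Q A \<iota> \<longleftrightarrow>
     is_localization (Oq n Q) (mult_closure (Oq n Q) (Oq_var n Q ` {1..n})) A \<iota>"

text \<open>The monomials \<open>c x\<^sub>1\<^bsup>a\<^sub>1\<^esup> \<dots> x\<^sub>n\<^bsup>a\<^sub>n\<^esup>\<close> with \<open>c \<noteq> 0\<close> and integer exponents: as the \<open>x\<^sub>j\<close> commute
  up to scalars, these are the products of nonzero scalars and of the \<open>x\<^sub>j\<close> and their inverses.\<close>

definition torus_monomials ::
    "nat \<Rightarrow> (nat \<Rightarrow> nat \<Rightarrow> 'k::field) \<Rightarrow> 'a ring \<Rightarrow> ((nat list \<Rightarrow> 'k) set \<Rightarrow> 'a) \<Rightarrow> 'a set" where
  "torus_monomials n Q A \<iota> = generate (units_of A)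
     ({\<iota> (Oq_scalar n Q c) | c. c \<noteq> 0} \<union> {\<iota> (Oq_var n Q j) | j. j \<in> {1..n}})"

section \<open>The algebra in normal form\<close>

text \<open>\<open>Tgen k\<close> and \<open>Tinv k\<close> stand for \<open>X\<^sub>k\<close> and its inverse. \<open>nf_torus\<close> is the tensor product of the
  rank-2 quantum tori on \<open>X\<^sub>i, X\<^sub>i\<^sub>+\<^sub>s\<close> with parameter \<open>q\<^bsup>h\<^sub>i\<^esup>\<close> and of the Laurent polynomials in the
  remaining \<open>X\<^sub>k\<close>.\<close>

datatype torus_letter = Tgen nat | Tinv nat

definition nf_letters :: "nat \<Rightarrow> torus_letter set" where
  "nf_letters n = Tgen ` {1..n} \<union> Tinv ` {1..n}"

definition nf_rels ::
    "nat \<Rightarrow> nat \<Rightarrow> (nat \<Rightarrow> nat) \<Rightarrow> 'k::field \<Rightarrow> (torus_letter list \<Rightarrow> 'k) set" where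
  "nf_rels n s h q = (let F = free_algebra (nf_letters n) in
     {fmonom 1 [Tgen k, Tinv k] \<ominus>\<^bsub>F\<^esub> \<one>\<^bsub>F\<^esub> | k. k \<in> {1..n}} \<union>
     {fmonom 1 [Tinv k, Tgen k] \<ominus>\<^bsub>F\<^esub> \<one>\<^bsub>F\<^esub> | k. k \<in> {1..n}} \<union>
     {fmonom 1 [Tgen i, Tgen (i + s)] \<ominus>\<^bsub>F\<^esub> fmonom (q ^ h i) [Tgen (i + s), Tgen i] | i. i \<in> {1..s}} \<union>
     {fmonom 1 [Tgen k, Tgen l] \<ominus>\<^bsub>F\<^esub> fmonom 1 [Tgen l, Tgen k] | k l. k \<in> {1..n} \<and> l \<in> {1..n} \<and>
        (\<forall>i\<in>{1..s}. {k, l} \<noteq> {i, i + s})})"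

definition nf_torus :: "nat \<Rightarrow> nat \<Rightarrow> (nat \<Rightarrow> nat) \<Rightarrow> 'k::field
    \<Rightarrow> (torus_letter list \<Rightarrow> 'k) set ring" where
  "nf_torus n s h q = presented_algebra (nf_letters n) (nf_rels n s h q)"

definition nf_gen :: "nat \<Rightarrow> nat \<Rightarrow> (nat \<Rightarrow> nat) \<Rightarrow> 'k::field \<Rightarrow> nat
    \<Rightarrow> (torus_letter list \<Rightarrow> 'k) set" where
  "nf_gen n s h q k = pa_class (nf_letters n) (nf_rels n s h q) (fmonom 1 [Tgen k])"

definition nf_scalar :: "nat \<Rightarrow> nat \<Rightarrow> (nat \<Rightarrow> nat) \<Rightarrow> 'k::field \<Rightarrow> 'k
    \<Rightarrow> (torus_letter list \<Rightarrow> 'k) set" where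
  "nf_scalar n s h q c = pa_class (nf_letters n) (nf_rels n s h q) (fmonom c [])"

definition nf_exponents :: "nat \<Rightarrow> nat \<Rightarrow> nat \<Rightarrow> (nat \<Rightarrow> nat) \<Rightarrow> bool" where
  "nf_exponents n s m h \<longleftrightarrow> 2 * s \<le> n \<and> (s \<ge> 1 \<longrightarrow> h 1 = 1) \<and>
     (\<forall>i\<in>{1..s}. 0 < h i \<and> h i dvd m \<and> h i < m) \<and>
     (\<forall>i\<in>{1..<s}. h i dvd h (Suc i))"

text \<open>The fixed isomorphism is one of \<open>K\<close>-algebras, and the \<open>X\<^sub>k\<close> correspond to monomials in the
  \<open>x\<^sub>j\<close> and their inverses.\<close>

definition nf_isomorphism :: "nat \<Rightarrow> (nat \<Rightarrow> nat \<Rightarrow> 'k::field) \<Rightarrow> 'a ring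
    \<Rightarrow> ((nat list \<Rightarrow> 'k) set \<Rightarrow> 'a) \<Rightarrow> nat \<Rightarrow> (nat \<Rightarrow> nat) \<Rightarrow> 'k
    \<Rightarrow> ('a \<Rightarrow> (torus_letter list \<Rightarrow> 'k) set) \<Rightarrow> bool" where
  "nf_isomorphism n Q A \<iota> s h q \<psi> \<longleftrightarrow>
     \<psi> \<in> ring_iso A (nf_torus n s h q) \<and>
     (\<forall>c. \<psi> (\<iota> (Oq_scalar n Q c)) = nf_scalar n s h q c) \<and>
     (\<forall>k\<in>{1..n}. nf_gen n s h q k \<in> \<psi> ` torus_monomials n Q A \<iota>)"

section \<open>The modules \<open>M(\<alpha>)\<close>\<close>

definition Kstar :: "nat \<Rightarrow> (nat \<Rightarrow> 'k::field) set" where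
  "Kstar n = {1..n} \<rightarrow>\<^sub>E (- {0})"

definition M_index :: "nat \<Rightarrow> nat \<Rightarrow> (nat \<Rightarrow> nat) \<Rightarrow> (nat \<Rightarrow> nat) set" where
  "M_index s m h = (\<Pi>\<^sub>E i\<in>{1..s}. {..<m div h i})"

text \<open>The tuple with \<open>a\<^sub>i\<close> replaced by \<open>a\<^sub>i + z\<close> in \<open>\<int>/k\<^sub>i\<int>\<close>, where \<open>k\<^sub>i = m / h\<^sub>i\<close>.\<close>

definition M_shift :: "nat \<Rightarrow> (nat \<Rightarrow> nat) \<Rightarrow> nat \<Rightarrow> int \<Rightarrow> (nat \<Rightarrow> nat) \<Rightarrow> (nat \<Rightarrow> nat)" where
  "M_shift m h i z a = a(i := nat ((int (a i) + z) mod int (m div h i)))"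

definition M_basis :: "(nat \<Rightarrow> nat) \<Rightarrow> ((nat \<Rightarrow> nat) \<Rightarrow> 'k::field)" where
  "M_basis a = (\<lambda>b. if b = a then 1 else 0)"

definition M_space :: "nat \<Rightarrow> nat \<Rightarrow> (nat \<Rightarrow> nat) \<Rightarrow> ((nat \<Rightarrow> nat) \<Rightarrow> 'k::field) set" where
  "M_space s m h = {v. \<forall>a. a \<notin> M_index s m h \<longrightarrow> v a = 0}"

text \<open>The value of \<open>e(a) X\<^sub>k\<close>; in the second case \<open>k = i + s\<close> with \<open>1 \<le> i \<le> s\<close>.\<close>

definition M_gen_act :: "nat \<Rightarrow> nat \<Rightarrow> (nat \<Rightarrow> nat) \<Rightarrow> 'k::field \<Rightarrow> (nat \<Rightarrow> 'k) \<Rightarrow> nat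
    \<Rightarrow> (nat \<Rightarrow> nat) \<Rightarrow> ((nat \<Rightarrow> nat) \<Rightarrow> 'k)" where
  "M_gen_act s m h q \<alpha> k a =
     (if k \<le> s then (\<lambda>b. \<alpha> k * M_basis (M_shift m h k 1 a) b)
      else if k \<le> 2 * s then
        (let i = k - s in
          (\<lambda>b. inverse (\<alpha> i) * \<alpha> (i + s) * (q ^ h i) powi (int (a i) - 1)
                 * M_basis (M_shift m h i (- 1) a) b))
      else (\<lambda>b. \<alpha> k * M_basis a b))"

definition M_op :: "nat \<Rightarrow> nat \<Rightarrow> (nat \<Rightarrow> nat) \<Rightarrow> 'k::field \<Rightarrow> (nat \<Rightarrow> 'k) \<Rightarrow> nat
    \<Rightarrow> ((nat \<Rightarrow> nat) \<Rightarrow> 'k) \<Rightarrow> ((nat \<Rightarrow> nat) \<Rightarrow> 'k)" where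
  "M_op s m h q \<alpha> k v = (\<lambda>b. \<Sum>a\<in>M_index s m h. v a * M_gen_act s m h q \<alpha> k a b)"

text \<open>The action of the inverse of \<open>X\<^sub>k\<close> is forced: it is the inverse of the bijection by which \<open>X\<^sub>k\<close>
  acts (for \<open>\<alpha>\<close> with nonzero entries).\<close>

fun M_letter_op :: "nat \<Rightarrow> nat \<Rightarrow> (nat \<Rightarrow> nat) \<Rightarrow> 'k::field \<Rightarrow> (nat \<Rightarrow> 'k) \<Rightarrow> torus_letter
    \<Rightarrow> ((nat \<Rightarrow> nat) \<Rightarrow> 'k) \<Rightarrow> ((nat \<Rightarrow> nat) \<Rightarrow> 'k)" where
  "M_letter_op s m h q \<alpha> (Tgen k) v = M_op s m h q \<alpha> k v"
| "M_letter_op s m h q \<alpha> (Tinv k) v = inv_into (M_space s m h) (M_op s m h q \<alpha> k) v"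

text \<open>As this is a right action, the first letter of a word acts first.\<close>

definition M_free_act :: "nat \<Rightarrow> nat \<Rightarrow> (nat \<Rightarrow> nat) \<Rightarrow> 'k::field \<Rightarrow> (nat \<Rightarrow> 'k)
    \<Rightarrow> ((nat \<Rightarrow> nat) \<Rightarrow> 'k) \<Rightarrow> (torus_letter list \<Rightarrow> 'k) \<Rightarrow> ((nat \<Rightarrow> nat) \<Rightarrow> 'k)" where
  "M_free_act s m h q \<alpha> v f =
     (\<lambda>b. \<Sum>w | f w \<noteq> 0. f w * fold (M_letter_op s m h q \<alpha>) w v b)"

text \<open>\<open>M(\<alpha>)\<close> as a right module over the algebra in normal form: a coset acts through any of its
  representatives.\<close>

definition M_mod :: "nat \<Rightarrow> nat \<Rightarrow> (nat \<Rightarrow> nat) \<Rightarrow> 'k::field \<Rightarrow> (nat \<Rightarrow> 'k)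
    \<Rightarrow> ((torus_letter list \<Rightarrow> 'k) set, (nat \<Rightarrow> nat) \<Rightarrow> 'k) rmodule" where
  "M_mod s m h q \<alpha> = \<lparr>
     carrier = M_space s m h, monoid.mult = undefined, one = undefined,
     zero = (\<lambda>a. 0), add = (\<lambda>v w a. v a + w a),
     ract = (\<lambda>v C. M_free_act s m h q \<alpha> v (SOME f. f \<in> C))\<rparr>"

section \<open>The simple modules in question and their isomorphism classes\<close>

definition nontrivial_simple :: "nat \<Rightarrow> (nat \<Rightarrow> nat \<Rightarrow> 'k::field)
    \<Rightarrow> ((nat list \<Rightarrow> 'k) set, 'v) rmodule \<Rightarrow> bool" where
  "nontrivial_simple n Q N \<longleftrightarrow> simple_right_module (Oq n Q) N \<and>
     (\<forall>j\<in>{1..n}. \<exists>v\<in>carrier N. v \<cdot>\<^bsub>N\<^esub> Oq_var n Q j \<noteq> \<zero>\<^bsub>N\<^esub>)"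

definition simple_iso_rel :: "nat \<Rightarrow> (nat \<Rightarrow> nat \<Rightarrow> 'k::field)
    \<Rightarrow> ((nat list \<Rightarrow> 'k) set, 'v) rmodule rel" where
  "simple_iso_rel n Q = {(N, N'). nontrivial_simple n Q N \<and> nontrivial_simple n Q N' \<and>
     rmodule_isomorphic (Oq n Q) N N'}"

definition simple_iso_classes :: "nat \<Rightarrow> (nat \<Rightarrow> nat \<Rightarrow> 'k::field)
    \<Rightarrow> ((nat list \<Rightarrow> 'k) set, 'v) rmodule set set" where
  "simple_iso_classes n Q = {N. nontrivial_simple n Q N} // simple_iso_rel n Q"

end

theory Submission
  imports Defs "HOL-Library.Poly_Mapping"
begin

text \<open>
  Over the torus every \<open>X\<^sub>k\<^sup>m\<close> is central, so a simple module \<open>N\<close> is finitely generated over the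
  polynomials in finitely many central elements. The polynomials killing \<open>N\<close> form a prime ideal; by
  the Nullstellensatz, here in the form of an extension theorem for homomorphisms into \<open>K\<close>, there is
  a \<open>K\<close>-point of its zero set, and Nakayama's lemma shows that the central elements act by the values
  at this point. Hence \<open>X\<^sub>i\<^bsup>k\<^sub>i\<^esup>\<close> and \<open>X\<^sub>2\<^sub>s\<^sub>+\<^sub>j\<close> act by scalars, and the commuting operators
  \<open>X\<^sub>iX\<^sub>i\<^sub>+\<^sub>s\<close> have a common eigenvector, whose translates under the \<open>X\<^sub>i\<close> with \<open>i \<le> s\<close> are the
  basis of some \<open>M(\<alpha>)\<close>.

  A simple \<open>O\<^sub>q\<close>-module on which all \<open>x\<^sub>j\<close> act nontrivially is a torus module, because the \<open>x\<^sub>j\<close> are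
  normal and thus act bijectively. Conversely the central elements \<open>x\<^sub>j\<^sup>m\<close> act on \<open>M(\<alpha>)\<close> by nonzero
  scalars, so that every \<open>O\<^sub>q\<close>-submodule is stable under the inverses of the \<open>x\<^sub>j\<close>.
\<close>

section \<open>Free and presented algebras\<close>

text \<open>The obstacle is that \<open>N\<close> is not known to be finite-dimensional and that the
  field may be countable, so neither an eigenvalue argument nor a cardinality argument shows
  directly that a central element acts by a scalar: Schur's lemma only places it in a division ring,
  where it could be transcendental over the field. Finite generation over finitely many central
  elements excludes this, and as any further central element may be added to them, the whole centre
  of the torus acts by scalars.

  The parameters are then forced up to choices: \<open>\<alpha>\<^sub>i\<close> is a root of order
  \<open>k\<^sub>i\<close> of the scalar of \<open>X\<^sub>i^k\<^sub>i\<close>,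
  \<open>\<alpha>\<close> at \<open>i + s\<close> is an eigenvalue of
  \<open>X\<^sub>i X\<^sub>i\<^sub>+\<^sub>s\<close>, and the last ones are scalars of central
  generators. The choice of roots and eigenvalues is why only surjectivity is asserted. The same
  products also give simplicity of \<open>M(\<alpha>)\<close>: they act diagonally and separate all
  basis vectors.

  Between the two algebras, general Ore calculus is avoided: every product of the
  \<open>x\<^sub>j\<close> divides a central one, so all fractions can be given central
  denominators.\<close>

definition conv :: "('l list \<Rightarrow> 'k::field) \<Rightarrow> ('l list \<Rightarrow> 'k) \<Rightarrow> 'l list \<Rightarrow> 'k" where
  "conv f g w = (\<Sum>i\<le>length w. f (take i w) * g (drop i w))"

lemma conv_Nil: "conv f g [] = f [] * g []"
  by (simp add: conv_def)

text \<open>Splitting off the empty prefix leaves a convolution with the shifted function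
  \<open>\<lambda>u. f (a # u)\<close>; this turns statements about all splittings of a word into
  inductions on the word.\<close>

lemma conv_Cons: "conv f g (a # w) = f [] * g (a # w) + conv (\<lambda>u. f (a # u)) g w"
  by (simp only: conv_def list.size add_Suc_right add_0_right sum.atMost_Suc_shift take_Suc_Cons drop_Suc_Cons
      take_0 drop_0)

lemma conv_add_left: "conv (\<lambda>u. f u + f' u) g w = conv f g w + conv f' g w"
  by (simp add: conv_def distrib_right sum.distrib)

lemma conv_add_right: "conv f (\<lambda>u. g u + g' u) w = conv f g w + conv f g' w"
  by (simp add: conv_def distrib_left sum.distrib)

lemma conv_scale_left: "conv (\<lambda>u. c * f u) g w = c * conv f g w"
  by (simp add: conv_def sum_distrib_left mult.assoc)

text \<open>Induction on the word with \<open>f\<close> arbitrary: shifting \<open>conv f g\<close>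
  by a letter gives a multiple of the shifted \<open>g\<close> plus a convolution with the shifted
  \<open>f\<close>, to which the hypothesis applies. No double sum has to be reindexed.\<close>

lemma conv_assoc: "conv (conv f g) h w = conv f (conv g h) w"
proof (induction w arbitrary: f)
  case (Cons a w)
  have "conv (conv f g) h (a # w) = conv f g [] * h (a # w) + conv (\<lambda>u. conv f g (a # u)) h w"
    by (rule conv_Cons)
  also have "(\<lambda>u. conv f g (a # u)) = (\<lambda>u. f [] * g (a # u) + conv (\<lambda>u. f (a # u)) g u)"
    by (rule ext) (rule conv_Cons)
  also have "conv \<dots> h w = f [] * conv (\<lambda>u. g (a # u)) h w + conv (\<lambda>u. f (a # u)) (conv g h) w"
    by (simp only: conv_add_left conv_scale_left Cons.IH)
  also have "conv f g [] * h (a # w) + \<dots> = f [] * conv g h (a # w) + conv (\<lambda>u. f (a # u)) (conv g h) w"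
    by (simp only: conv_Nil conv_Cons[of g h] algebra_simps)
  also have "\<dots> = conv f (conv g h) (a # w)"
    by (rule conv_Cons[symmetric])
  finally show ?case .
qed (simp add: conv_Nil)

text \<open>Of all splittings of \<open>u @ v\<close> only the one at \<open>length u\<close>
  contributes.\<close>

lemma conv_fmonom: "conv (fmonom c u) (fmonom d v) = fmonom (c * d) (u @ v)"
proof
  fix w
  show "conv (fmonom c u) (fmonom d v) w = fmonom (c * d) (u @ v) w"
  proof (cases "w = u @ v")
    case True
    have "conv (fmonom c u) (fmonom d v) w = (\<Sum>i\<le>length w. if i = length u then c * d else 0)"
      unfolding conv_def
    proof (rule sum.cong[OF refl])
      fix i assume "i \<in> {..length w}"
      then have "take i w = u \<Longrightarrow> i = length u"
        by auto
      then show "fmonom c u (take i w) * fmonom d v (drop i w) = (if i = length u then c * d else 0)"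
        by (auto simp: fmonom_def True)
    qed
    then show ?thesis by (simp add: True fmonom_def)
  next
    case False
    then have *: "fmonom c u (take i w) * fmonom d v (drop i w) = 0" for i
      by (metis append_take_drop_id fmonom_def mult_eq_0_iff)
    have "conv (fmonom c u) (fmonom d v) w = 0"
      unfolding conv_def by (rule sum.neutral) (simp only: *, blast)
    then show ?thesis using False by (simp add: fmonom_def)
  qed
qed

lemma conv_nonzero_split:
  assumes "conv f g w \<noteq> 0"
  shows "\<exists>u v. w = u @ v \<and> f u \<noteq> 0 \<and> g v \<noteq> 0"
proof -
  obtain i where "f (take i w) * g (drop i w) \<noteq> 0"
    using assms unfolding conv_def by (rule sum.not_neutral_contains_not_neutral)
  then show ?thesis
    by (intro exI[of _ "take i w"] exI[of _ "drop i w"]) auto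
qed

section \<open>The free algebra as a ring\<close>

lemma fa_simps [simp]:
  "\<zero>\<^bsub>free_algebra L\<^esub> = (\<lambda>w. 0)"
  "\<one>\<^bsub>free_algebra L\<^esub> = fmonom 1 []"
  "f \<oplus>\<^bsub>free_algebra L\<^esub> g = (\<lambda>w. f w + g w)"
  "f \<otimes>\<^bsub>free_algebra L\<^esub> g = conv f g"
  by (auto simp: free_algebra_def fmonom_def conv_def)

lemma fa_carrier: "f \<in> carrier (free_algebra L) \<longleftrightarrow> finite {w. f w \<noteq> 0} \<and> (\<forall>w. f w \<noteq> 0 \<longrightarrow> set w \<subseteq> L)"
  by (simp add: free_algebra_def)

lemma fmonom_carrier: "set w \<subseteq> L \<Longrightarrow> fmonom c w \<in> carrier (free_algebra L)"
  by (auto simp: fa_carrier fmonom_def intro: finite_subset[of _ "{w}"])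

lemma fa_zero_carrier: "(\<lambda>w. 0) \<in> carrier (free_algebra L)"
  by (simp add: fa_carrier)

lemma fa_add_carrier:
  assumes "f \<in> carrier (free_algebra L)" "g \<in> carrier (free_algebra L)"
  shows "(\<lambda>w. f w + g w) \<in> carrier (free_algebra L)"
  unfolding fa_carrier
proof
  show "finite {w. f w + g w \<noteq> 0}"
    by (rule finite_subset[of _ "{w. f w \<noteq> 0} \<union> {w. g w \<noteq> 0}"]) (use assms in \<open>auto simp: fa_carrier\<close>)
qed (use assms in \<open>auto simp: fa_carrier\<close>, metis add_0 in_mono)

lemma fa_scale_carrier:
  assumes "f \<in> carrier (free_algebra L)"
  shows "(\<lambda>w. c * f w) \<in> carrier (free_algebra L)"
  unfolding fa_carrier
proof
  show "finite {w. c * f w \<noteq> 0}"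
    by (rule finite_subset[of _ "{w. f w \<noteq> 0}"]) (use assms in \<open>auto simp: fa_carrier\<close>)
qed (use assms in \<open>auto simp: fa_carrier\<close>)

lemma fa_conv_carrier:
  assumes "f \<in> carrier (free_algebra L)" "g \<in> carrier (free_algebra L)"
  shows "conv f g \<in> carrier (free_algebra L)"
  unfolding fa_carrier
proof (intro conjI allI impI)
  have "{w. conv f g w \<noteq> 0} \<subseteq> (\<lambda>(u, v). u @ v) ` ({w. f w \<noteq> 0} \<times> {w. g w \<noteq> 0})"
    using conv_nonzero_split[of f g] by fastforce
  then show "finite {w. conv f g w \<noteq> 0}"
    by (rule finite_subset) (use assms in \<open>auto simp: fa_carrier\<close>)
  fix w assume "conv f g w \<noteq> 0"
  then obtain u v where "w = u @ v" "f u \<noteq> 0" "g v \<noteq> 0"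
    using conv_nonzero_split by blast
  then show "set w \<subseteq> L"
    using assms by (auto simp: fa_carrier)
qed

lemma conv_one_left: "conv (fmonom 1 []) f = f"
proof
  fix w
  have "conv (fmonom 1 []) f w = (\<Sum>i\<le>length w. if i = 0 then f w else 0)"
    unfolding conv_def by (rule sum.cong[OF refl]) (auto simp: fmonom_def)
  then show "conv (fmonom 1 []) f w = f w" by simp
qed

lemma conv_one_right: "conv f (fmonom 1 []) = f"
proof
  fix w
  have "conv f (fmonom 1 []) w = (\<Sum>i\<le>length w. if i = length w then f w else 0)"
    unfolding conv_def by (rule sum.cong[OF refl]) (auto simp: fmonom_def)
  then show "conv f (fmonom 1 []) w = f w" by simp
qed

lemma free_algebra_ring: "ring (free_algebra L :: ('l list \<Rightarrow> 'k::field) ring)"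
proof (rule ringI)
  show "abelian_group (free_algebra L :: ('l list \<Rightarrow> 'k) ring)"
  proof (rule abelian_groupI)
    fix f :: "'l list \<Rightarrow> 'k" assume "f \<in> carrier (free_algebra L)"
    then show "\<exists>g\<in>carrier (free_algebra L). g \<oplus>\<^bsub>free_algebra L\<^esub> f = \<zero>\<^bsub>free_algebra L\<^esub>"
      by (intro bexI[of _ "\<lambda>w. - 1 * f w"] fa_scale_carrier) auto
  qed (auto simp: fa_add_carrier fa_zero_carrier add_ac)
  show "Group.monoid (free_algebra L :: ('l list \<Rightarrow> 'k) ring)"
    by (rule monoidI)
       (auto simp: fa_conv_carrier fmonom_carrier conv_one_left conv_one_right conv_assoc[abs_def])
qed (auto simp: conv_add_left[abs_def] conv_add_right[abs_def])

text \<open>One word at a time is peeled off a finite set containing the support. Later arguments on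
  the free algebra use this instead of sums, so they only treat multiples of words and
  additivity.\<close>

lemma fa_induct [consumes 1, case_names monom add]:
  assumes f: "f \<in> carrier (free_algebra L)"
    and monom: "\<And>c u. set u \<subseteq> L \<Longrightarrow> S (fmonom c u)"
    and add: "\<And>f g. f \<in> carrier (free_algebra L) \<Longrightarrow> g \<in> carrier (free_algebra L) \<Longrightarrow> S f \<Longrightarrow> S g
      \<Longrightarrow> S (\<lambda>w. f w + g w)"
  shows "S f"
proof -
  have "finite W \<Longrightarrow> f \<in> carrier (free_algebra L) \<Longrightarrow> {w. f w \<noteq> 0} \<subseteq> W \<Longrightarrow> S f" for W
  proof (induction W arbitrary: f rule: finite_induct)
    case empty
    then have "f = fmonom 0 []" by (auto simp: fmonom_def)
    then show ?case using monom[of "[]" 0] by simp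
  next
    case (insert u W)
    define g where "g w = (if w = u then 0 else f w)" for w
    have sub: "{w. g w \<noteq> 0} \<subseteq> {w. f w \<noteq> 0}" by (auto simp: g_def)
    have g: "g \<in> carrier (free_algebra L)"
      using insert.prems(1) sub finite_subset[OF sub] by (auto simp: fa_carrier)
    have Sg: "S g"
      by (rule insert.IH[OF g]) (use insert.prems in \<open>auto simp: g_def\<close>)
    have f_eq: "f = (\<lambda>w. g w + fmonom (f u) u w)"
      by (auto simp: g_def fmonom_def)
    show ?case
    \<comment> \<open>A word with coefficient 0 need not be a word over \<open>L\<close>, so
      \<open>monom\<close> would not apply to it.\<close>
    proof (cases "f u = 0")
      case True
      then have "f = g" by (auto simp: g_def)
      then show ?thesis using Sg by simp
    next
      case False
      then have "set u \<subseteq> L" using insert.prems by (auto simp: fa_carrier)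
      then have "S (\<lambda>w. g w + fmonom (f u) u w)"
        by (intro add g Sg monom fmonom_carrier)
      then show ?thesis using f_eq by simp
    qed
  qed
  then show ?thesis using f by (auto simp: fa_carrier)
qed

text \<open>Common frame for \<open>Oq\<close> and the torus. \<open>gen_induct\<close> expresses
  that the letters generate the algebra: elements are reached from scalars by sums and by
  multiplying with a letter on the right, the side that fits a right action, where
  \<open>v (x l) = (v x) l\<close>.\<close>

locale scalar_algebra = ring T for T :: "('t, 'x) ring_scheme" (structure) +
  fixes sc :: "'k::field \<Rightarrow> 't" and L :: "'l set" and gen :: "'l \<Rightarrow> 't"
  assumes sc_closed [simp, intro]: "sc c \<in> carrier T"
    and sc_add: "sc (c + d) = sc c \<oplus> sc d"
    and sc_mult: "sc (c * d) = sc c \<otimes> sc d"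
    and sc_one: "sc 1 = \<one>"
    and sc_comm: "x \<in> carrier T \<Longrightarrow> sc c \<otimes> x = x \<otimes> sc c"
    and gen_closed [simp, intro]: "l \<in> L \<Longrightarrow> gen l \<in> carrier T"
    and gen_induct: "\<lbrakk>x \<in> carrier T; \<And>c. S (sc c);
       \<And>x l. \<lbrakk>x \<in> carrier T; l \<in> L; S x\<rbrakk> \<Longrightarrow> S (x \<otimes> gen l);
       \<And>x y. \<lbrakk>x \<in> carrier T; y \<in> carrier T; S x; S y\<rbrakk> \<Longrightarrow> S (x \<oplus> y)\<rbrakk> \<Longrightarrow> S x"
begin

lemmas gen_induct_on = gen_induct [consumes 1, case_names scalar letter plus]

lemma sc_zero: "sc 0 = \<zero>"
  using sc_add[of 0 0] by (metis add.r_cancel_one add_0 sc_closed)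

definition central :: "'t \<Rightarrow> bool" where
  "central z \<longleftrightarrow> z \<in> carrier T \<and> (\<forall>x\<in>carrier T. z \<otimes> x = x \<otimes> z)"

lemma centralD: "central z \<Longrightarrow> z \<in> carrier T" "central z \<Longrightarrow> x \<in> carrier T \<Longrightarrow> z \<otimes> x = x \<otimes> z"
  by (auto simp: central_def)

text \<open>The elements commuting with \<open>z\<close> are closed under sums and products, so the
  generators suffice.\<close>

lemma central_if_commutes_gen:
  assumes z: "z \<in> carrier T" and gens: "\<And>l. l \<in> L \<Longrightarrow> z \<otimes> gen l = gen l \<otimes> z"
  shows "central z"
  unfolding central_def
proof (intro conjI ballI z)
  fix x assume "x \<in> carrier T"
  then show "z \<otimes> x = x \<otimes> z"
  proof (induction x rule: gen_induct_on)
    case (scalar c) then show ?case using sc_comm z by simp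
  next
    case (letter x l) then show ?case using z gens by (metis m_assoc gen_closed)
  next
    case (plus x y) then show ?case using z by (simp add: l_distr r_distr)
  qed
qed

lemma central_one: "central \<one>"
  by (simp add: central_def)

lemma central_sc: "central (sc c)"
  by (simp add: central_def sc_comm)

lemma central_mult: "central a \<Longrightarrow> central b \<Longrightarrow> central (a \<otimes> b)"
  unfolding central_def by (metis m_assoc m_closed)

lemma central_add: "central a \<Longrightarrow> central b \<Longrightarrow> central (a \<oplus> b)"
  unfolding central_def by (simp add: l_distr r_distr)

lemma submodule_if_closed_gen:
  assumes "right_module T N" "additive_subgroup U N"
    and "\<And>v c. v \<in> U \<Longrightarrow> v \<cdot>\<^bsub>N\<^esub> sc c \<in> U" "\<And>v l. v \<in> U \<Longrightarrow> l \<in> L \<Longrightarrow> v \<cdot>\<^bsub>N\<^esub> gen l \<in> U"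
  shows "right_submodule U T N"
  unfolding right_submodule_def
proof (intro conjI ballI assms)
  interpret N: right_module T N by fact
  interpret U: additive_subgroup U N by fact
  fix v x assume v: "v \<in> U" and "x \<in> carrier T"
  from this(2) show "v \<cdot>\<^bsub>N\<^esub> x \<in> U"
  proof (induction x rule: gen_induct_on)
    case (scalar c) then show ?case using assms v by blast
  next
    case (letter x l) then show ?case using assms(4) v by (simp add: N.ract_mult U.a_Hcarr)
  next
    case (plus x y) then show ?case using v by (simp add: N.ract_add_right U.a_Hcarr)
  qed
qed

text \<open>The elements whose action \<open>f\<close> respects are closed under sums and under
  right multiplication by letters; linearity then has to be verified on scalars and letters
  only.\<close>

lemma hom_if_gen:
  assumes "right_module T M" "right_module T N"
    and f: "\<And>v. v \<in> carrier M \<Longrightarrow> f v \<in> carrier N"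
    and add: "\<And>v w. v \<in> carrier M \<Longrightarrow> w \<in> carrier M \<Longrightarrow> f (v \<oplus>\<^bsub>M\<^esub> w) = f v \<oplus>\<^bsub>N\<^esub> f w"
    and sc: "\<And>v c. v \<in> carrier M \<Longrightarrow> f (v \<cdot>\<^bsub>M\<^esub> sc c) = f v \<cdot>\<^bsub>N\<^esub> sc c"
    and gen: "\<And>v l. v \<in> carrier M \<Longrightarrow> l \<in> L \<Longrightarrow> f (v \<cdot>\<^bsub>M\<^esub> gen l) = f v \<cdot>\<^bsub>N\<^esub> gen l"
    and v: "v \<in> carrier M" and x: "x \<in> carrier T"
  shows "f (v \<cdot>\<^bsub>M\<^esub> x) = f v \<cdot>\<^bsub>N\<^esub> x"
proof -
  interpret M: right_module T M by fact
  interpret N: right_module T N by fact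
  from x show ?thesis
  proof (induction x rule: gen_induct_on)
    case (scalar c) then show ?case using sc v by blast
  next
    case (letter x l) then show ?case using v by (simp add: M.ract_mult N.ract_mult f gen M.ract_closed)
  next
    case (plus x y) then show ?case using v by (simp add: M.ract_add_right N.ract_add_right f add M.ract_closed)
  qed
qed

end

section \<open>Quotients of the free algebra by relations\<close>

locale presentation =
  fixes L :: "'l set" and Rel :: "('l list \<Rightarrow> 'k::field) set"
  assumes Rel_carrier: "Rel \<subseteq> carrier (free_algebra L)"
begin

abbreviation "F \<equiv> free_algebra L :: ('l list \<Rightarrow> 'k) ring"
abbreviation "I \<equiv> genideal F Rel"
abbreviation "A \<equiv> presented_algebra L Rel"
abbreviation "cls \<equiv> pa_class L Rel"

sublocale F: ring F by (rule free_algebra_ring)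

sublocale I: ideal I F by (rule F.genideal_ideal[OF Rel_carrier])

lemma cls_eq: "cls f = I +>\<^bsub>F\<^esub> f"
  by (simp add: pa_class_def)

lemma ring_A: "ring A"
  unfolding presented_algebra_def by (rule I.quotient_is_ring)

lemma cls_hom: "cls \<in> ring_hom F A"
  unfolding presented_algebra_def pa_class_def[abs_def] by (rule I.rcos_ring_hom)

lemma cls_surj: "x \<in> carrier A \<Longrightarrow> \<exists>f\<in>carrier F. x = cls f"
  by (auto simp: presented_algebra_def FactRing_def A_RCOSETS_defs cls_eq a_r_coset_def)

lemma cls_Rel: "f \<in> Rel \<Longrightarrow> cls f = \<zero>\<^bsub>A\<^esub>"
  using F.genideal_self[OF Rel_carrier] I.a_rcos_const[of f]
  by (auto simp: presented_algebra_def FactRing_def A_RCOSETS_defs cls_eq a_r_coset_def)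

lemma cls_eq_iff: "f \<in> carrier F \<Longrightarrow> g \<in> cls f \<Longrightarrow> \<exists>i\<in>I. g = (\<lambda>w. i w + f w)"
  by (auto simp: cls_eq a_r_coset_def r_coset_def)

lemma cls_add: "f \<in> carrier F \<Longrightarrow> g \<in> carrier F \<Longrightarrow> cls (\<lambda>w. f w + g w) = cls f \<oplus>\<^bsub>A\<^esub> cls g"
  using ring_hom_add[OF cls_hom, of f g] by simp

lemma cls_monom_mult: "set u \<subseteq> L \<Longrightarrow> set v \<subseteq> L \<Longrightarrow>
    cls (fmonom c u) \<otimes>\<^bsub>A\<^esub> cls (fmonom d v) = cls (fmonom (c * d) (u @ v))"
  using ring_hom_mult[OF cls_hom, of "fmonom c u" "fmonom d v"]
  by (simp add: fmonom_carrier conv_fmonom)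

text \<open>This is how a defining relation, stored as a difference in the free algebra, becomes an
  equation between monomials of the quotient.\<close>

lemma cls_minus:
  assumes "f \<in> carrier F" "g \<in> carrier F" "f \<ominus>\<^bsub>F\<^esub> g \<in> Rel"
  shows "cls f = cls g"
proof -
  interpret A: ring A by (rule ring_A)
  have c: "cls f \<in> carrier A" "cls g \<in> carrier A"
    using ring_hom_closed[OF cls_hom assms(1)] ring_hom_closed[OF cls_hom assms(2)] .
  have "f = (f \<ominus>\<^bsub>F\<^esub> g) \<oplus>\<^bsub>F\<^esub> g"
    using assms by algebra
  then have "cls f = cls ((f \<ominus>\<^bsub>F\<^esub> g) \<oplus>\<^bsub>F\<^esub> g)"
    by (rule arg_cong)
  also have "\<dots> = cls (f \<ominus>\<^bsub>F\<^esub> g) \<oplus>\<^bsub>A\<^esub> cls g"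
    by (rule ring_hom_add[OF cls_hom F.minus_closed[OF assms(1,2)] assms(2)])
  finally show ?thesis using cls_Rel[OF assms(3)] c by simp
qed

text \<open>The classes of multiples of words generate the quotient additively, and a word is built
  by appending letters on the right; together this is the required induction principle.\<close>

sublocale A: scalar_algebra A "\<lambda>c. cls (fmonom c [])" L "\<lambda>l. cls (fmonom 1 [l])"
proof (intro scalar_algebra.intro scalar_algebra_axioms.intro ring_A)
  have closed: "cls (fmonom c u) \<in> carrier A" if "set u \<subseteq> L" for c u
    using ring_hom_closed[OF cls_hom fmonom_carrier] that by auto
  show "cls (fmonom c []) \<in> carrier A" for c
    by (simp add: closed)
  show "cls (fmonom 1 [l]) \<in> carrier A" if "l \<in> L" for l
    by (simp add: closed that)
  have fm: "fmonom (c + d) [] = (\<lambda>w. fmonom c [] w + fmonom d [] w)" for c d :: 'k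
    by (auto simp: fmonom_def)
  show "cls (fmonom (c + d) []) = cls (fmonom c []) \<oplus>\<^bsub>A\<^esub> cls (fmonom d [])" for c d
    unfolding fm by (rule cls_add) (simp_all add: fmonom_carrier)
  show "cls (fmonom (c * d) []) = cls (fmonom c []) \<otimes>\<^bsub>A\<^esub> cls (fmonom d [])" for c d
    by (simp add: cls_monom_mult)
  show "cls (fmonom 1 []) = \<one>\<^bsub>A\<^esub>"
    using ring_hom_one[OF cls_hom] by simp
  interpret A: ring A by (rule ring_A)
  have ind [consumes 1, case_names monom add]: "S x" if x: "x \<in> carrier A" and monom: "\<And>c u. set u \<subseteq> L \<Longrightarrow> S (cls (fmonom c u))"
    and add: "\<And>x y. \<lbrakk>x \<in> carrier A; y \<in> carrier A; S x; S y\<rbrakk> \<Longrightarrow> S (x \<oplus>\<^bsub>A\<^esub> y)" for x S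
  proof -
    obtain f where f: "f \<in> carrier F" "x = cls f"
      using cls_surj[OF x] by blast
    from f(1) have "S (cls f)"
    proof (induction f rule: fa_induct)
      case (add f g)
      then show ?case
        using that(3)[of "cls f" "cls g"] ring_hom_closed[OF cls_hom] by (simp add: cls_add)
    qed (rule monom)
    then show ?thesis using f by simp
  qed
  show "cls (fmonom c []) \<otimes>\<^bsub>A\<^esub> x = x \<otimes>\<^bsub>A\<^esub> cls (fmonom c [])" if "x \<in> carrier A" for x c
    using that
  proof (induction x rule: ind)
    case (monom d u) then show ?case by (simp add: cls_monom_mult mult.commute)
  next
    case (add x y) then show ?case by (simp add: A.l_distr A.r_distr closed)
  qed
  show "S x" if x: "x \<in> carrier A" and sc: "\<And>c. S (cls (fmonom c []))"
    and gen: "\<And>x l. \<lbrakk>x \<in> carrier A; l \<in> L; S x\<rbrakk> \<Longrightarrow> S (x \<otimes>\<^bsub>A\<^esub> cls (fmonom 1 [l]))"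
    and add: "\<And>x y. \<lbrakk>x \<in> carrier A; y \<in> carrier A; S x; S y\<rbrakk> \<Longrightarrow> S (x \<oplus>\<^bsub>A\<^esub> y)" for x S
    using x
  proof (induction x rule: ind)
    case (monom c u)
    then show ?case
    proof (induction u rule: rev_induct)
      case Nil then show ?case using sc by simp
    next
      case (snoc l u)
      then have "S (cls (fmonom c u) \<otimes>\<^bsub>A\<^esub> cls (fmonom 1 [l]))"
        by (intro gen) (auto simp: closed)
      then show ?case using snoc.prems by (simp add: cls_monom_mult)
    qed
  next
    case (add x y) then show ?case using that(4) by blast
  qed
qed

end

section \<open>Extending homomorphisms to an algebraically closed field\<close>

text \<open>Stands for the domain \<open>R / (R \<inter> P)\<close> inside the quotient of the
  ambient ring by the prime ideal \<open>P\<close>. Keeping \<open>P\<close> instead of dividing by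
  it avoids quotient rings and fraction fields: being zero is replaced throughout by lying in
  \<open>P\<close>.\<close>

locale prime_subring =
  fixes P :: "'r::comm_ring_1 set" and R :: "'r set"
  assumes P_zero: "0 \<in> P" and P_add: "\<And>x y. x \<in> P \<Longrightarrow> y \<in> P \<Longrightarrow> x + y \<in> P"
    and P_mult: "\<And>x y. x \<in> P \<Longrightarrow> x * y \<in> P" and P_one: "1 \<notin> P"
    and P_prime: "\<And>x y. x * y \<in> P \<Longrightarrow> x \<in> P \<or> y \<in> P"
    and R_one: "1 \<in> R" and R_diff: "\<And>x y. x \<in> R \<Longrightarrow> y \<in> R \<Longrightarrow> x - y \<in> R"
    and R_mult: "\<And>x y. x \<in> R \<Longrightarrow> y \<in> R \<Longrightarrow> x * y \<in> R"
begin

lemma R_zero: "0 \<in> R"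
  using R_diff[OF R_one R_one] by simp

lemma R_add: "x \<in> R \<Longrightarrow> y \<in> R \<Longrightarrow> x + y \<in> R"
  using R_diff[of x "0 - y"] R_diff[of 0 y] R_zero by simp

lemma R_sum: "(\<And>i. i \<in> I \<Longrightarrow> f i \<in> R) \<Longrightarrow> sum f I \<in> R"
  by (induction I rule: infinite_finite_induct) (auto simp: R_zero R_add)

lemma R_power: "x \<in> R \<Longrightarrow> x ^ n \<in> R"
  by (induction n) (auto simp: R_one R_mult)

lemma P_mult': "y \<in> P \<Longrightarrow> x * y \<in> P"
  using P_mult[of y x] by (simp add: mult.commute)

lemma P_diff: "x \<in> P \<Longrightarrow> y \<in> P \<Longrightarrow> x - y \<in> P"
  using P_add[of x "y * (-1)"] P_mult[of y "-1"] by simp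

lemma P_sum: "(\<And>i. i \<in> I \<Longrightarrow> f i \<in> P) \<Longrightarrow> sum f I \<in> P"
  by (induction I rule: infinite_finite_induct) (auto simp: P_zero P_add)

lemma P_power: "x ^ n \<in> P \<Longrightarrow> x \<in> P"
  by (induction n) (use P_one P_prime in auto)

definition RX :: "'r poly set" where
  "RX = {p. \<forall>i. coeff p i \<in> R}"

lemma RX_coeff: "p \<in> RX \<Longrightarrow> coeff p i \<in> R"
  by (simp add: RX_def)

lemma RX_diff: "p \<in> RX \<Longrightarrow> p' \<in> RX \<Longrightarrow> p - p' \<in> RX"
  by (simp add: RX_def R_diff)

lemma RX_add: "p \<in> RX \<Longrightarrow> p' \<in> RX \<Longrightarrow> p + p' \<in> RX"
  by (simp add: RX_def R_add)

lemma RX_mult: "p \<in> RX \<Longrightarrow> p' \<in> RX \<Longrightarrow> p * p' \<in> RX"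
  by (auto simp: RX_def coeff_mult intro!: R_sum R_mult)

lemma RX_monom: "c \<in> R \<Longrightarrow> monom c n \<in> RX"
  by (simp add: RX_def R_zero)

lemma RX_smult: "c \<in> R \<Longrightarrow> p \<in> RX \<Longrightarrow> smult c p \<in> RX"
  by (simp add: RX_def R_mult)

lemma RX_const: "c \<in> R \<Longrightarrow> [:c:] \<in> RX"
  using RX_monom[of c 0] by (simp add: monom_0)

lemma poly_in_P: "(\<And>i. coeff p i \<in> P) \<Longrightarrow> poly p u \<in> P"
  by (auto simp: poly_altdef intro!: P_sum P_mult)

definition adjoin :: "'r \<Rightarrow> 'r set" where
  "adjoin u = (\<lambda>p. poly p u) ` RX"

lemma adjoin_prime_subring: "prime_subring P (adjoin u)"
proof
  show "1 \<in> adjoin u"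
    unfolding adjoin_def by (rule image_eqI[of _ _ "[:1:]"]) (auto intro: RX_const R_one)
  fix x y assume "x \<in> adjoin u" "y \<in> adjoin u"
  then obtain p p' where "p \<in> RX" "p' \<in> RX" "x = poly p u" "y = poly p' u"
    unfolding adjoin_def by auto
  then show "x - y \<in> adjoin u" "x * y \<in> adjoin u"
    unfolding adjoin_def
    by (auto intro: image_eqI[of _ _ "p - p'"] image_eqI[of _ _ "p * p'"] RX_diff RX_mult)
qed (use P_zero P_add P_mult P_one P_prime in auto)

lemma adjoin_superset: "R \<subseteq> adjoin u"
  unfolding adjoin_def by (auto intro!: image_eqI[of _ _ "[:_:]"] RX_const)

lemma adjoin_self: "u \<in> adjoin u"
  unfolding adjoin_def
  by (rule image_eqI[of _ _ "monom 1 1"]) (auto intro!: RX_monom R_one simp: poly_monom)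

text \<open>Leading coefficients are not invertible, hence the power of \<open>lead_coeff p\<close>.
  As there may be zero divisors, the degree of the quotient cannot be read off from a product; its
  bound is part of the conclusion because \<open>extend_algebraic\<close> compares it with the
  degree of a minimal relation.\<close>

lemma pseudo_division:
  assumes "f \<in> RX" "p \<in> RX" "degree p > 0"
  shows "\<exists>k h t. h \<in> RX \<and> t \<in> RX \<and> smult (lead_coeff p ^ k) f = p * h + t \<and>
           degree t < degree p \<and> (h = 0 \<or> degree h + degree p \<le> degree f)"
  using assms(1)
proof (induction "degree f" arbitrary: f rule: less_induct)
  case less
  show ?case
  proof (cases "degree f < degree p")
    case True
    then show ?thesis
      by (intro exI[of _ 0] exI[of _ "0::'r poly"] exI[of _ f]) (use less in \<open>auto simp: RX_def R_zero\<close>)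
  next
    case False
    define d where "d = degree f - degree p"
    define g where "g = smult (lead_coeff p) f - monom (lead_coeff f) d * p"
    have lc: "lead_coeff p \<in> R" "lead_coeff f \<in> R"
      using assms(2) less by (auto intro: RX_coeff)
    have gRX: "g \<in> RX"
      unfolding g_def using lc assms(2) less by (intro RX_diff RX_smult RX_mult RX_monom)
    have dle: "degree g \<le> degree f"
      unfolding g_def
      by (rule degree_diff_le[OF degree_smult_le], rule order.trans[OF degree_mult_le])
         (use False degree_monom_le[of "lead_coeff f" d] in \<open>auto simp: d_def\<close>)
    have "coeff g (degree f) = 0"
      unfolding g_def using False by (simp add: coeff_monom_mult d_def mult.commute[of "lead_coeff p"])
    then have dlt: "degree g < degree f"
      using dle False assms(3) by (metis degree_0 gr_implies_not0 lead_coeff_monom le_neq_implies_less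
          leading_coeff_0_iff linorder_not_less not_gr_zero)
    obtain k h t where IH: "h \<in> RX" "t \<in> RX" "smult (lead_coeff p ^ k) g = p * h + t"
      "degree t < degree p" "h = 0 \<or> degree h + degree p \<le> degree g"
      using less.hyps[OF dlt gRX] by blast
    define h' where "h' = h + monom (lead_coeff p ^ k * lead_coeff f) d"
    have "smult (lead_coeff p ^ Suc k) f
        = smult (lead_coeff p ^ k) g + smult (lead_coeff p ^ k) (monom (lead_coeff f) d * p)"
      by (simp add: g_def smult_diff_right mult.commute)
    also have "\<dots> = p * h' + t"
    proof -
      have "smult (lead_coeff p ^ k) (monom (lead_coeff f) d * p)
          = p * monom (lead_coeff p ^ k * lead_coeff f) d"
        by (simp add: smult_monom mult.commute[of p] flip: mult_smult_left)
      then show ?thesis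
        by (simp add: IH(3) h'_def distrib_left)
    qed
    finally have "smult (lead_coeff p ^ Suc k) f = p * h' + t" .
    moreover have "h' \<in> RX"
      unfolding h'_def by (intro RX_add IH(1) RX_monom R_mult R_power lc)
    moreover have "degree h' \<le> d"
      unfolding h'_def using IH(5) dlt False
      by (intro degree_add_le degree_monom_le) (auto simp: d_def)
    ultimately show ?thesis
      using IH(2,4) False
      by (intro exI[of _ "Suc k"] exI[of _ h'] exI[of _ t]) (auto simp: d_def)
  qed
qed

end

text \<open>\<open>\<phi>\<close> is a total function constrained on \<open>R\<close> only; by
  \<open>phi_P\<close> it amounts to a homomorphism from \<open>R / (R \<inter> P)\<close> to
  \<open>'k\<close>.\<close>

locale prime_subring_hom = prime_subring P R
  for P :: "'r::comm_ring_1 set" and R +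
  fixes \<phi> :: "'r \<Rightarrow> 'k::field"
  assumes phi_one: "\<phi> 1 = 1"
    and phi_add: "\<And>x y. x \<in> R \<Longrightarrow> y \<in> R \<Longrightarrow> \<phi> (x + y) = \<phi> x + \<phi> y"
    and phi_mult: "\<And>x y. x \<in> R \<Longrightarrow> y \<in> R \<Longrightarrow> \<phi> (x * y) = \<phi> x * \<phi> y"
    and phi_P: "\<And>x. x \<in> R \<Longrightarrow> x \<in> P \<Longrightarrow> \<phi> x = 0"
begin

lemma phi_zero: "\<phi> 0 = 0"
  using phi_P R_zero P_zero by blast

lemma phi_diff: "x \<in> R \<Longrightarrow> y \<in> R \<Longrightarrow> \<phi> (x - y) = \<phi> x - \<phi> y"
  using phi_add[of "x - y" y] R_diff by simp

lemma phi_sum: "(\<And>i. i \<in> I \<Longrightarrow> f i \<in> R) \<Longrightarrow> \<phi> (sum f I) = (\<Sum>i\<in>I. \<phi> (f i))"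
  by (induction I rule: infinite_finite_induct) (auto simp: phi_zero phi_add R_sum)

lemma phi_power: "x \<in> R \<Longrightarrow> \<phi> (x ^ n) = \<phi> x ^ n"
  by (induction n) (auto simp: phi_one phi_mult R_power)

lemma map_phi_add: "p \<in> RX \<Longrightarrow> p' \<in> RX \<Longrightarrow> map_poly \<phi> (p + p') = map_poly \<phi> p + map_poly \<phi> p'"
  by (rule poly_eqI) (simp add: coeff_map_poly phi_zero phi_add RX_coeff)

lemma map_phi_diff: "p \<in> RX \<Longrightarrow> p' \<in> RX \<Longrightarrow> map_poly \<phi> (p - p') = map_poly \<phi> p - map_poly \<phi> p'"
  by (rule poly_eqI) (simp add: coeff_map_poly phi_zero phi_diff RX_coeff)

lemma map_phi_mult: "p \<in> RX \<Longrightarrow> p' \<in> RX \<Longrightarrow> map_poly \<phi> (p * p') = map_poly \<phi> p * map_poly \<phi> p'"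
  by (rule poly_eqI)
     (simp add: coeff_map_poly phi_zero coeff_mult phi_sum phi_mult RX_coeff R_mult)

lemma map_phi_smult: "c \<in> R \<Longrightarrow> p \<in> RX \<Longrightarrow> map_poly \<phi> (smult c p) = smult (\<phi> c) (map_poly \<phi> p)"
  by (rule poly_eqI) (simp add: coeff_map_poly phi_zero phi_mult RX_coeff)

lemma map_phi_P: "p \<in> RX \<Longrightarrow> (\<And>i. coeff p i \<in> P) \<Longrightarrow> map_poly \<phi> p = 0"
  by (rule poly_eqI) (simp add: coeff_map_poly phi_zero phi_P RX_coeff)

text \<open>The extension has to send \<open>poly p u\<close> to the value at \<beta> of the image
  of \<open>p\<close>. By \<open>wd\<close> this does not depend on the polynomial picked by
  \<open>SOME\<close>, since two choices differ by one vanishing at \<open>u\<close>, and it is zero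
  on \<open>P\<close>.\<close>

lemma extend_hom:
  assumes wd: "\<And>p. p \<in> RX \<Longrightarrow> poly p u \<in> P \<Longrightarrow> poly (map_poly \<phi> p) \<beta> = 0"
  obtains \<phi>' where "prime_subring_hom P (adjoin u) \<phi>'" "\<And>x. x \<in> R \<Longrightarrow> \<phi>' x = \<phi> x"
    "\<And>p. p \<in> RX \<Longrightarrow> \<phi>' (poly p u) = poly (map_poly \<phi> p) \<beta>"
proof -
  define \<phi>' where "\<phi>' x = poly (map_poly \<phi> (SOME p. p \<in> RX \<and> poly p u = x)) \<beta>" for x
  have ev: "\<phi>' (poly p u) = poly (map_poly \<phi> p) \<beta>" if p: "p \<in> RX" for p
  proof -
    define p' where "p' = (SOME p'. p' \<in> RX \<and> poly p' u = poly p u)"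
    have p': "p' \<in> RX \<and> poly p' u = poly p u"
      unfolding p'_def by (rule someI[of _ p]) (use p in simp)
    have "poly (map_poly \<phi> (p' - p)) \<beta> = 0"
      using p p' P_zero by (intro wd RX_diff) auto
    then show ?thesis
      using p p' by (simp add: map_phi_diff \<phi>'_def flip: p'_def)
  qed
  have R: "\<phi>' x = \<phi> x" if "x \<in> R" for x
    using ev[OF RX_const[OF that]] by (simp add: map_poly_pCons phi_zero)
  have "prime_subring_hom P (adjoin u) \<phi>'"
  proof (intro prime_subring_hom.intro adjoin_prime_subring prime_subring_hom_axioms.intro)
    show "\<phi>' 1 = 1"
      using R[OF R_one] phi_one by simp
    fix x y assume "x \<in> adjoin u" "y \<in> adjoin u"
    then obtain p p' where p: "p \<in> RX" "p' \<in> RX" "x = poly p u" "y = poly p' u"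
      unfolding adjoin_def by auto
    then show "\<phi>' (x + y) = \<phi>' x + \<phi>' y" "\<phi>' (x * y) = \<phi>' x * \<phi>' y"
      using ev[OF RX_add[OF p(1,2)]] ev[OF RX_mult[OF p(1,2)]] ev[OF p(1)] ev[OF p(2)]
      by (simp_all add: map_phi_add map_phi_mult)
  next
    fix x assume "x \<in> adjoin u" "x \<in> P"
    then show "\<phi>' x = 0"
      unfolding adjoin_def using ev wd by auto
  qed
  then show ?thesis
    using that R ev by blast
qed

end

section \<open>Extension of homomorphisms by one element\<close>

context prime_subring
begin

text \<open>All relations of \<open>u\<close> modulo \<open>P\<close> being trivial, any \<beta> may
  become the image of \<open>u\<close>; it only has to avoid the roots of the image of a polynomial
  \<open>g\<close> with value \<open>s\<close>. That image is nonzero as soon as \<phi> does not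
  kill \<open>r\<close>, a coefficient of \<open>g\<close> outside \<open>P\<close>.\<close>

lemma extend_transcendental:
  fixes u :: 'r
  assumes transc: "\<And>p i. p \<in> RX \<Longrightarrow> poly p u \<in> P \<Longrightarrow> coeff p i \<in> P"
    and s: "s \<in> adjoin u" "s \<notin> P"
  shows "\<exists>r\<in>R. r \<notin> P \<and> (\<forall>\<phi> :: 'r \<Rightarrow> 'k::alg_closed_field. prime_subring_hom P R \<phi> \<longrightarrow> \<phi> r \<noteq> 0 \<longrightarrow>
           (\<exists>\<phi>'. prime_subring_hom P (adjoin u) \<phi>' \<and> (\<forall>x\<in>R. \<phi>' x = \<phi> x) \<and> \<phi>' s \<noteq> 0))"
proof -
  obtain g where g: "g \<in> RX" "s = poly g u"
    using s unfolding adjoin_def by auto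
  obtain i where i: "coeff g i \<notin> P"
    using poly_in_P g s by blast
  show ?thesis
  proof (intro bexI[of _ "coeff g i"] conjI allI impI i)
    fix \<phi> :: "'r \<Rightarrow> 'k" assume "prime_subring_hom P R \<phi>" and nz: "\<phi> (coeff g i) \<noteq> 0"
    then interpret prime_subring_hom P R \<phi> by simp
    define G where "G = map_poly \<phi> g"
    have "G \<noteq> 0"
      using nz coeff_map_poly[of \<phi> g i] phi_zero by (auto simp: G_def)
    \<comment> \<open>At a root of \<open>G - 1\<close> the value of \<open>G\<close> is 1, so
      algebraic closedness takes the place of counting the roots of \<open>G\<close>.\<close>
    obtain \<beta> where \<beta>: "poly G \<beta> \<noteq> 0"
    proof (cases "degree G = 0")
      case True
      then obtain c where "G = [:c:]"
        by (metis degree_eq_zeroE)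
      with \<open>G \<noteq> 0\<close> show ?thesis
        using that by auto
    next
      case False
      then have "coeff (G - 1) (degree G) \<noteq> 0"
        using \<open>G \<noteq> 0\<close> by simp
      then have "degree (G - 1) > 0"
        using le_degree[of "G - 1" "degree G"] False by simp
      then obtain \<beta> where "poly (G - 1) \<beta> = 0"
        using alg_closed_imp_poly_has_root by blast
      then show ?thesis
        using that[of \<beta>] by simp
    qed
    have "poly (map_poly \<phi> p) \<beta> = 0" if "p \<in> RX" "poly p u \<in> P" for p
      using map_phi_P transc that by simp
    then obtain \<phi>' where "prime_subring_hom P (adjoin u) \<phi>'" "\<And>x. x \<in> R \<Longrightarrow> \<phi>' x = \<phi> x"
        "\<And>p. p \<in> RX \<Longrightarrow> \<phi>' (poly p u) = poly (map_poly \<phi> p) \<beta>"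
      by (rule extend_hom) blast+
    then show "\<exists>\<phi>'. prime_subring_hom P (adjoin u) \<phi>' \<and> (\<forall>x\<in>R. \<phi>' x = \<phi> x) \<and> \<phi>' s \<noteq> 0"
      using g \<beta> G_def by auto
  qed (use g RX_coeff in auto)
qed

text \<open>A leading coefficient in \<open>P\<close> is zero modulo \<open>P\<close>. Removing it
  preserves the value at \<open>u\<close> modulo \<open>P\<close> and lowers the degree, which is
  used against choices of minimal degree.\<close>

lemma RX_drop_lead:
  assumes "p \<in> RX" "lead_coeff p \<in> P"
  shows "p - monom (lead_coeff p) (degree p) \<in> RX"
    and "poly (p - monom (lead_coeff p) (degree p)) u - poly p u \<in> P"
    and "degree p > 0 \<Longrightarrow> degree (p - monom (lead_coeff p) (degree p)) < degree p"
proof -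
  define p' where "p' = p - monom (lead_coeff p) (degree p)"
  show "p - monom (lead_coeff p) (degree p) \<in> RX"
    using assms by (intro RX_diff RX_monom RX_coeff)
  show "poly (p - monom (lead_coeff p) (degree p)) u - poly p u \<in> P"
    using P_diff[OF P_zero P_mult[OF assms(2), of "u ^ degree p"]] by (simp add: poly_monom)
  have "degree p' \<le> degree p" "coeff p' (degree p) = 0"
    by (auto simp: p'_def intro: degree_diff_le degree_monom_le)
  then show "degree p > 0 \<Longrightarrow> degree p' < degree p"
    by (metis degree_0 le_neq_implies_less leading_coeff_0_iff)
qed

text \<open>The witness is \<open>r = lead_coeff f * c\<close>: here \<open>f\<close> is a relation for \<open>u\<close> of minimal degree, and
  \<open>c\<close> is a multiple of \<open>s\<close> in \<open>R\<close> modulo \<open>P\<close>, found as a multiple of \<open>s\<close> of minimal degree in \<open>u\<close>.\<close>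

lemma extend_algebraic:
  fixes u :: 'r
  assumes alg: "\<exists>p\<in>RX. poly p u \<in> P \<and> (\<exists>i. coeff p i \<notin> P)"
    and s: "s \<in> adjoin u" "s \<notin> P"
  shows "\<exists>r\<in>R. r \<notin> P \<and> (\<forall>\<phi> :: 'r \<Rightarrow> 'k::alg_closed_field. prime_subring_hom P R \<phi> \<longrightarrow> \<phi> r \<noteq> 0 \<longrightarrow>
           (\<exists>\<phi>'. prime_subring_hom P (adjoin u) \<phi>' \<and> (\<forall>x\<in>R. \<phi>' x = \<phi> x) \<and> \<phi>' s \<noteq> 0))"
proof -
  define F where "F = {p\<in>RX. poly p u \<in> P \<and> (\<exists>i. coeff p i \<notin> P)}"
  obtain f where f: "f \<in> F" and f_min: "\<And>g. g \<in> F \<Longrightarrow> degree f \<le> degree g"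
    using alg ex_has_least_nat[of "\<lambda>p. p \<in> F" _ degree] by (force simp: F_def)
  have fRX: "f \<in> RX" and fu: "poly f u \<in> P"
    using f by (auto simp: F_def)
  \<comment> \<open>By minimality of \<open>f\<close>, relations of smaller degree are trivial
    modulo \<open>P\<close>: below \<open>degree f\<close> the element \<open>u\<close> looks
    transcendental.\<close>
  have low: "coeff g i \<in> P" if "g \<in> RX" "poly g u \<in> P" "degree g < degree f" for g i
    using f_min[of g] that by (force simp: F_def)
  have f_deg: "degree f > 0"
  proof (rule ccontr)
    assume "\<not> degree f > 0"
    then obtain c where "f = [:c:]"
      by (metis degree_eq_zeroE not_gr_zero)
    then show False
      using f P_zero by (auto simp: F_def coeff_eq_0 gr0_conv_Suc) (metis coeff_pCons_0 coeff_pCons_Suc coeff_0 not0_implies_Suc)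
  qed
  have f_lc: "lead_coeff f \<notin> P"
  proof
    assume lc: "lead_coeff f \<in> P"
    define f' where "f' = f - monom (lead_coeff f) (degree f)"
    note dr = RX_drop_lead[OF fRX lc, folded f'_def]
    have "poly f' u \<in> P"
      using P_add[OF dr(2)[of u] fu] by simp
    then have "coeff f' i \<in> P" for i
      using low dr f_deg by blast
    moreover have "coeff f i = coeff f' i + (if i = degree f then lead_coeff f else 0)" for i
      by (auto simp: f'_def)
    ultimately have "coeff f i \<in> P" for i
      using lc P_add P_zero by (metis (full_types))
    then show False
      using f by (simp add: F_def)
  qed
  \<comment> \<open>Polynomials whose value at \<open>u\<close> is outside \<open>P\<close> and a
    multiple of \<open>s\<close> modulo \<open>P\<close>. The aim is that a member of least degree
    is constant.\<close>
  define H where "H = {p\<in>RX. poly p u \<notin> P \<and> (\<exists>a\<in>RX. poly p u - poly a u * s \<in> P)}"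
  obtain g where g: "g \<in> RX" "s = poly g u"
    using s unfolding adjoin_def by auto
  have "g \<in> H"
    using g s P_zero by (auto simp: H_def intro!: bexI[of _ "[:1:]"] RX_const R_one)
  then obtain p where p: "p \<in> H" and p_min: "\<And>p'. p' \<in> H \<Longrightarrow> degree p \<le> degree p'"
    using ex_has_least_nat[of "\<lambda>p. p \<in> H" _ degree] by force
  have pRX: "p \<in> RX" and pu: "poly p u \<notin> P"
    using p by (auto simp: H_def)
  obtain a where a: "a \<in> RX" "poly p u - poly a u * s \<in> P"
    using p by (auto simp: H_def)
  \<comment> \<open>The remainder of \<open>p\<close> by \<open>f\<close> is again in
    \<open>H\<close>, because \<open>f\<close> vanishes at \<open>u\<close> modulo \<open>P\<close>
    and the powers of its leading coefficient stay outside \<open>P\<close>.\<close>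
  have p_deg_f: "degree p < degree f"
  proof -
    obtain k h t where t: "h \<in> RX" "t \<in> RX" "smult (lead_coeff f ^ k) p = f * h + t" "degree t < degree f"
      using pseudo_division[OF pRX fRX f_deg] by blast
    have "poly (smult (lead_coeff f ^ k) p) u = poly (f * h + t) u"
      using t(3) by simp
    then have tu: "poly t u = lead_coeff f ^ k * poly p u - poly f u * poly h u"
      by (simp add: algebra_simps)
    have "poly t u \<notin> P"
    proof
      assume "poly t u \<in> P"
      then have "lead_coeff f ^ k * poly p u \<in> P"
        using P_add[OF _ P_mult[OF fu, of "poly h u"], of "poly t u"] tu by simp
      then show False
        using P_prime P_power f_lc pu by blast
    qed
    moreover have "poly t u - poly (smult (lead_coeff f ^ k) a) u * s \<in> P"
      using P_diff[OF P_mult'[OF a(2), of "lead_coeff f ^ k"] P_mult[OF fu, of "poly h u"]]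
      by (simp add: tu algebra_simps)
    ultimately have "t \<in> H"
      using t a fRX by (auto simp: H_def intro!: bexI[of _ "smult (lead_coeff f ^ k) a"] RX_smult R_power RX_coeff)
    then show ?thesis
      using p_min t(4) by force
  qed
  \<comment> \<open>Otherwise divide \<open>f\<close> by \<open>p\<close>. The remainder has a
    multiple of \<open>s\<close> as its value, which lies in \<open>P\<close> by minimality; then so
    does the value of the quotient, and as both degrees are below \<open>degree f\<close>, all their
    coefficients lie in \<open>P\<close>. Comparing coefficients at \<open>degree f\<close> puts the
    leading coefficient of \<open>p\<close> into \<open>P\<close>, and dropping it contradicts
    minimality.\<close>
  have p_deg: "degree p = 0"
  proof (rule ccontr)
    assume "degree p \<noteq> 0"
    then have pos: "degree p > 0" by simp
    obtain k h t where t: "h \<in> RX" "t \<in> RX" "smult (lead_coeff p ^ k) f = p * h + t" "degree t < degree p"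
        "h = 0 \<or> degree h + degree p \<le> degree f"
      using pseudo_division[OF fRX pRX pos] by blast
    have "poly (smult (lead_coeff p ^ k) f) u = poly (p * h + t) u"
      using t(3) by simp
    then have tu: "poly t u = lead_coeff p ^ k * poly f u - poly p u * poly h u"
      by (simp add: algebra_simps)
    have "poly t u - poly (0 - h * a) u * s \<in> P"
      using P_diff[OF P_mult'[OF fu, of "lead_coeff p ^ k"] P_mult[OF a(2), of "poly h u"]]
      by (simp add: tu algebra_simps)
    moreover have "0 - h * a \<in> RX"
      using t a by (intro RX_diff RX_mult) (auto simp: RX_def R_zero)
    ultimately have tP: "poly t u \<in> P"
      using t p_min[of t] by (force simp: H_def)
    then have "poly p u * poly h u \<in> P"
      using P_diff[OF P_mult'[OF fu, of "lead_coeff p ^ k"] tP] by (simp add: tu)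
    then have "poly h u \<in> P"
      using P_prime pu by blast
    then have hP: "coeff h i \<in> P" for i
      using t(5) low[OF t(1)] pos by (cases "h = 0") (auto simp: P_zero)
    have "coeff (smult (lead_coeff p ^ k) f) (degree f) \<in> P"
      unfolding t(3) using low[OF t(2) tP] t(4) p_deg_f
      by (auto simp: coeff_mult intro!: P_add P_sum P_mult' hP)
    then have "lead_coeff p ^ k * lead_coeff f \<in> P"
      by simp
    then have lcp: "lead_coeff p \<in> P"
      using P_prime P_power f_lc by blast
    define p' where "p' = p - monom (lead_coeff p) (degree p)"
    note dr = RX_drop_lead[OF pRX lcp, folded p'_def]
    have "poly p' u \<notin> P"
      using P_diff[OF _ dr(2)[of u], of "poly p' u"] pu by auto
    moreover have "poly p' u - poly a u * s \<in> P"
      using P_add[OF dr(2)[of u] a(2)] by simp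
    ultimately have "p' \<in> H"
      using dr a by (auto simp: H_def)
    then show False
      using p_min dr(3)[OF pos] by force
  qed
  then obtain c where c: "p = [:c:]"
    by (metis degree_eq_zeroE)
  have cR: "c \<in> R" "c \<notin> P" "c - poly a u * s \<in> P"
    using RX_coeff[OF pRX, of 0] pu a by (auto simp: c)
  show ?thesis
  proof (intro bexI[of _ "lead_coeff f * c"] conjI allI impI)
    show "lead_coeff f * c \<notin> P"
      using P_prime f_lc cR by blast
    show lcR: "lead_coeff f * c \<in> R"
      using cR fRX by (intro R_mult RX_coeff)
    fix \<phi> :: "'r \<Rightarrow> 'k" assume "prime_subring_hom P R \<phi>" and nz: "\<phi> (lead_coeff f * c) \<noteq> 0"
    then interpret prime_subring_hom P R \<phi> by simp
    have lR: "lead_coeff f \<in> R"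
      using fRX RX_coeff by simp
    have nz1: "\<phi> (lead_coeff f) \<noteq> 0" "\<phi> c \<noteq> 0"
      using nz phi_mult[OF lR cR(1)] by auto
    have "coeff (map_poly \<phi> f) (degree f) \<noteq> 0"
      using nz1 coeff_map_poly[of \<phi> f "degree f"] phi_zero by auto
    then have "degree (map_poly \<phi> f) > 0"
      using f_deg le_degree by fastforce
    then obtain \<beta> where \<beta>: "poly (map_poly \<phi> f) \<beta> = 0"
      using alg_closed_imp_poly_has_root by blast
    \<comment> \<open>Pseudo-division by \<open>f\<close> leaves a relation of smaller degree,
      trivial modulo \<open>P\<close>. So, up to a power of the leading coefficient, the image of
      \<open>g\<close> is a multiple of the image of \<open>f\<close>, which vanishes at
      \<beta>.\<close>
    have "poly (map_poly \<phi> g) \<beta> = 0" if g: "g \<in> RX" "poly g u \<in> P" for g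
    proof -
      obtain k h t where t: "h \<in> RX" "t \<in> RX" "smult (lead_coeff f ^ k) g = f * h + t" "degree t < degree f"
        using pseudo_division[OF g(1) fRX f_deg] by blast
      have "poly (smult (lead_coeff f ^ k) g) u = poly (f * h + t) u"
        using t(3) by simp
      then have "poly t u = lead_coeff f ^ k * poly g u - poly f u * poly h u"
        by (simp add: algebra_simps)
      then have "poly t u \<in> P"
        using P_diff P_mult P_mult' g(2) fu by simp
      then have "map_poly \<phi> t = 0"
        using map_phi_P low t by blast
      moreover have "smult (\<phi> (lead_coeff f) ^ k) (map_poly \<phi> g) = map_poly \<phi> (smult (lead_coeff f ^ k) g)"
        using lR g by (simp add: map_phi_smult R_power phi_power)
      moreover have "map_poly \<phi> (f * h + t) = map_poly \<phi> f * map_poly \<phi> h + map_poly \<phi> t"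
        using t fRX by (simp add: map_phi_mult map_phi_add RX_mult)
      ultimately have "smult (\<phi> (lead_coeff f) ^ k) (map_poly \<phi> g) = map_poly \<phi> f * map_poly \<phi> h"
        using t(3) by simp
      then have "poly (smult (\<phi> (lead_coeff f) ^ k) (map_poly \<phi> g)) \<beta> = 0"
        using \<beta> by simp
      then show ?thesis
        using nz1 by simp
    qed
    then obtain \<phi>' where \<phi>': "prime_subring_hom P (adjoin u) \<phi>'" "\<And>x. x \<in> R \<Longrightarrow> \<phi>' x = \<phi> x"
      by (rule extend_hom) blast+
    interpret E: prime_subring_hom P "adjoin u" \<phi>' by fact
    have au: "poly a u \<in> adjoin u"
      using a by (auto simp: adjoin_def)
    have cu: "c \<in> adjoin u"
      using cR adjoin_superset by blast
    have "\<phi>' (c - poly a u * s) = 0"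
      using au cu s cR E.R_mult E.R_diff by (intro E.phi_P) auto
    then have "\<phi>' (poly a u) * \<phi>' s = \<phi> c"
      using au cu s cR \<phi>'(2) by (simp add: E.phi_diff E.phi_mult E.R_mult)
    then show "\<exists>\<phi>'. prime_subring_hom P (adjoin u) \<phi>' \<and> (\<forall>x\<in>R. \<phi>' x = \<phi> x) \<and> \<phi>' s \<noteq> 0"
      using \<phi>' nz1 by (intro exI[of _ \<phi>']) auto
  qed
qed

text \<open>The classical one-step extension lemma. Demanding that a prescribed \<open>s\<close>
  stays nonzero, at the price of a condition \<open>r\<close> on the smaller ring, is what makes the
  step iterable.\<close>

lemma extend:
  assumes "s \<in> adjoin u" "s \<notin> P"
  shows "\<exists>r\<in>R. r \<notin> P \<and> (\<forall>\<phi> :: 'r \<Rightarrow> 'k::alg_closed_field. prime_subring_hom P R \<phi> \<longrightarrow> \<phi> r \<noteq> 0 \<longrightarrow>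
           (\<exists>\<phi>'. prime_subring_hom P (adjoin u) \<phi>' \<and> (\<forall>x\<in>R. \<phi>' x = \<phi> x) \<and> \<phi>' s \<noteq> 0))"
  using extend_algebraic[of u s] extend_transcendental[of u s] assms by blast

end


text \<open>Elements are adjoined one after another. The claim \<open>ext\<close> is kept for every
  \<open>s\<close> outside \<open>P\<close>, because each step imposes a new nonvanishing condition
  on the homomorphism before it; at the end \<open>s = 1\<close> is enough.\<close>

lemma extend_finitely_generated:
  fixes \<phi>\<^sub>0 :: "'r::comm_ring_1 \<Rightarrow> 'k::alg_closed_field"
  assumes hom: "prime_subring_hom P R \<phi>\<^sub>0"
    and inj: "\<And>x. x \<in> R \<Longrightarrow> x \<notin> P \<Longrightarrow> \<phi>\<^sub>0 x \<noteq> 0"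
  obtains S \<phi> where "R \<subseteq> S" "set us \<subseteq> S" "prime_subring_hom P S \<phi>" "\<And>x. x \<in> R \<Longrightarrow> \<phi> x = \<phi>\<^sub>0 x"
proof -
  interpret prime_subring_hom P R \<phi>\<^sub>0 by (rule hom)
  define S where "S us = foldl prime_subring.adjoin R us" for us
  have S: "prime_subring P (S us) \<and> R \<subseteq> S us \<and> set us \<subseteq> S us" for us
  proof (induction us rule: rev_induct)
    case Nil
    show ?case by (simp add: S_def prime_subring_axioms)
  next
    case (snoc u us)
    interpret S: prime_subring P "S us" using snoc by simp
    show ?case
      using snoc S.adjoin_prime_subring[of u] S.adjoin_superset[of u] S.adjoin_self[of u]
      by (auto simp: S_def)
  qed
  have ext: "\<exists>\<phi>. prime_subring_hom P (S us) \<phi> \<and> (\<forall>x\<in>R. \<phi> x = \<phi>\<^sub>0 x) \<and> \<phi> s \<noteq> 0"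
    if "s \<in> S us" "s \<notin> P" for us s
    using that
  proof (induction us arbitrary: s rule: rev_induct)
    case Nil
    then show ?case
      using hom inj by (auto simp: S_def)
  next
    case (snoc u us)
    interpret S: prime_subring P "S us" using S by simp
    have "s \<in> S.adjoin u"
      using snoc.prems by (simp add: S_def)
    then obtain r where r: "r \<in> S us" "r \<notin> P" and
      lift: "\<And>\<phi> :: 'r \<Rightarrow> 'k. prime_subring_hom P (S us) \<phi> \<Longrightarrow> \<phi> r \<noteq> 0 \<Longrightarrow>
        \<exists>\<phi>'. prime_subring_hom P (S.adjoin u) \<phi>' \<and> (\<forall>x\<in>S us. \<phi>' x = \<phi> x) \<and> \<phi>' s \<noteq> 0"
      using S.extend snoc.prems(2) by blast
    obtain \<phi> where \<phi>: "prime_subring_hom P (S us) \<phi>" "\<forall>x\<in>R. \<phi> x = \<phi>\<^sub>0 x" "\<phi> r \<noteq> 0"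
      using snoc.IH[OF r] by blast
    obtain \<phi>' where \<phi>': "prime_subring_hom P (S.adjoin u) \<phi>'" "\<forall>x\<in>S us. \<phi>' x = \<phi> x" "\<phi>' s \<noteq> 0"
      using lift[OF \<phi>(1,3)] by blast
    show ?case
    proof (intro exI[of _ \<phi>'] conjI ballI)
      show "prime_subring_hom P (S (us @ [u])) \<phi>'"
        using \<phi>' by (simp add: S_def)
      show "\<phi>' x = \<phi>\<^sub>0 x" if "x \<in> R" for x
        using \<phi>(2) \<phi>'(2) S that by (metis subsetD)
    qed (rule \<phi>')
  qed
  interpret U: prime_subring P "S us" using S by simp
  show ?thesis
    using ext[OF U.R_one P_one] S that by blast
qed

section \<open>Central elements act by scalars on simple modules\<close>

text \<open>A bridge between two styles: the extension theorem lives on a type class, whereas the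
  centre of an algebra is a carrier set. Finitely supported maps serve as the polynomial ring,
  evaluated at \<open>y 0\<close>, ..., \<open>y (n - 1)\<close>; the construction sends all other
  variables to one.\<close>

lemma (in cring) poly_mapping_eval:
  fixes \<sigma> :: "'k::comm_ring_1 \<Rightarrow> 'a" and y :: "nat \<Rightarrow> 'a" and n :: nat
  assumes \<sigma>: "\<And>c. \<sigma> c \<in> carrier R" "\<And>c d. \<sigma> (c + d) = \<sigma> c \<oplus> \<sigma> d" "\<And>c d. \<sigma> (c * d) = \<sigma> c \<otimes> \<sigma> d"
      "\<sigma> 1 = \<one>"
    and y: "\<And>i. y i \<in> carrier R"
  obtains ev :: "((nat \<Rightarrow>\<^sub>0 nat) \<Rightarrow>\<^sub>0 'k) \<Rightarrow> 'a" where "\<And>p. ev p \<in> carrier R"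
    "\<And>p p'. ev (p + p') = ev p \<oplus> ev p'" "\<And>p p'. ev (p * p') = ev p \<otimes> ev p'"
    "\<And>c. ev (Poly_Mapping.single 0 c) = \<sigma> c"
    "\<And>i. i < n \<Longrightarrow> ev (Poly_Mapping.single (Poly_Mapping.single i 1) 1) = y i"
proof -
  have \<sigma>0: "\<sigma> 0 = \<zero>"
    using \<sigma>(1)[of 0] \<sigma>(2)[of 0 0] by (metis add.r_cancel_one add_0)
  define mon where "mon \<mu> = (\<Otimes>i\<in>{..<n}. y i [^] Poly_Mapping.lookup \<mu> i)" for \<mu> :: "nat \<Rightarrow>\<^sub>0 nat"
  have mon_closed: "mon \<mu> \<in> carrier R" for \<mu>
    unfolding mon_def using y by (intro finprod_closed) auto
  have mon_add: "mon (\<mu> + \<nu>) = mon \<mu> \<otimes> mon \<nu>" for \<mu> \<nu>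
  proof -
    have "mon (\<mu> + \<nu>) = (\<Otimes>i\<in>{..<n}. y i [^] Poly_Mapping.lookup \<mu> i \<otimes> y i [^] Poly_Mapping.lookup \<nu> i)"
      unfolding mon_def using y by (intro finprod_cong') (auto simp: lookup_add nat_pow_mult)
    also have "\<dots> = mon \<mu> \<otimes> mon \<nu>"
      unfolding mon_def using y by (intro finprod_multf) auto
    finally show ?thesis .
  qed
  have mon_0: "mon 0 = \<one>"
    unfolding mon_def by (simp add: finprod_one_eqI)
  have mon_single: "mon (Poly_Mapping.single i 1) = y i" if "i < n" for i
  proof -
    have "mon (Poly_Mapping.single i 1) = (\<Otimes>j\<in>{..<n}. if i = j then y j else \<one>)"
      unfolding mon_def using y by (intro finprod_cong') (auto simp: lookup_single when_def)
    also have "\<dots> = y i"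
      using that y by (intro finprod_singleton) auto
    finally show ?thesis .
  qed
  define tm where "tm p \<mu> = \<sigma> (Poly_Mapping.lookup p \<mu>) \<otimes> mon \<mu>" for p :: "(nat \<Rightarrow>\<^sub>0 nat) \<Rightarrow>\<^sub>0 'k" and \<mu>
  have tm_closed: "tm p \<mu> \<in> carrier R" for p \<mu>
    unfolding tm_def using \<sigma> mon_closed by simp
  define ev where "ev p = (\<Oplus>\<mu>\<in>Poly_Mapping.keys p. tm p \<mu>)" for p
  have ev_closed: "ev p \<in> carrier R" for p
    unfolding ev_def by (intro finsum_closed) (auto simp: tm_closed)
  \<comment> \<open>Allowing any finite superset of the support lets two polynomials be summed over
    the same set.\<close>
  have ev_sup: "ev p = (\<Oplus>\<mu>\<in>W. tm p \<mu>)" if "finite W" "Poly_Mapping.keys p \<subseteq> W" for p W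
    unfolding ev_def using that
    by (intro add.finprod_mono_neutral_cong_left)
       (auto simp: tm_closed, auto simp: tm_def \<sigma>0 mon_closed in_keys_iff)
  have ev_add: "ev (p + p') = ev p \<oplus> ev p'" for p p'
  proof -
    let ?W = "Poly_Mapping.keys p \<union> Poly_Mapping.keys p'"
    have "ev (p + p') = (\<Oplus>\<mu>\<in>?W. tm (p + p') \<mu>)"
      by (rule ev_sup) (use Poly_Mapping.keys_add[of p p'] in auto)
    also have "\<dots> = (\<Oplus>\<mu>\<in>?W. tm p \<mu> \<oplus> tm p' \<mu>)"
      by (rule finsum_cong') (simp_all add: tm_closed, simp add: tm_def lookup_add \<sigma> mon_closed l_distr)
    also have "\<dots> = (\<Oplus>\<mu>\<in>?W. tm p \<mu>) \<oplus> (\<Oplus>\<mu>\<in>?W. tm p' \<mu>)"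
      by (rule finsum_addf) (auto simp: tm_closed)
    also have "\<dots> = ev p \<oplus> ev p'"
      using ev_sup[of ?W p] ev_sup[of ?W p'] by simp
    finally show ?thesis .
  qed
  have ev_single: "ev (Poly_Mapping.single \<mu> c) = \<sigma> c \<otimes> mon \<mu>" for \<mu> c
  proof -
    have "ev (Poly_Mapping.single \<mu> c) = (\<Oplus>\<nu>\<in>{\<mu>}. tm (Poly_Mapping.single \<mu> c) \<nu>)"
      by (rule ev_sup) auto
    also have "\<dots> = \<sigma> c \<otimes> mon \<mu>"
      by (simp add: tm_closed) (simp add: tm_def)
    finally show ?thesis .
  qed
  have ind: "S p" if "\<And>\<mu> c. S (Poly_Mapping.single \<mu> c)" "\<And>p p'. S p \<Longrightarrow> S p' \<Longrightarrow> S (p + p')"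
    for S and p :: "(nat \<Rightarrow>\<^sub>0 nat) \<Rightarrow>\<^sub>0 'k"
  proof (induction p rule: update_induct)
    case const
    show ?case using that(1)[of 0 0] by simp
  next
    case (update f a b)
    have "Poly_Mapping.update a b f = f + Poly_Mapping.single a b"
      using update(1) by (intro poly_mapping_eqI)
        (auto simp: lookup_update lookup_add lookup_single when_def in_keys_iff)
    then show ?case using that update by simp
  qed
  have ev_mult: "ev (p * p') = ev p \<otimes> ev p'" for p p'
  proof (induction p rule: ind)
    case (1 \<mu> c)
    show ?case
    proof (induction p' rule: ind)
      case (1 \<nu> d)
      have "\<sigma> c \<otimes> \<sigma> d \<otimes> (mon \<mu> \<otimes> mon \<nu>) = \<sigma> c \<otimes> mon \<mu> \<otimes> (\<sigma> d \<otimes> mon \<nu>)"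
        using \<sigma>(1)[of c] \<sigma>(1)[of d] mon_closed[of \<mu>] mon_closed[of \<nu>] by algebra
      then show ?case by (simp add: mult_single ev_single \<sigma>(3) mon_add)
    next
      case (2 p p')
      then show ?case by (simp add: distrib_left ev_add r_distr ev_closed)
    qed
  next
    case (2 p p')
    then show ?case by (simp add: distrib_right ev_add l_distr ev_closed)
  qed
  show ?thesis
    by (rule that[of ev])
       (auto simp: ev_closed ev_add ev_mult ev_single mon_0 mon_single[simplified] \<sigma> y)
qed

section \<open>Nakayama's lemma for a commutative action\<close>

locale comm_action = abelian_group N for N :: "('v, 'x) ring_scheme" (structure) +
  fixes act :: "'v \<Rightarrow> 'r::comm_ring_1 \<Rightarrow> 'v"
  assumes act_closed [simp, intro]: "v \<in> carrier N \<Longrightarrow> act v p \<in> carrier N"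
    and act_add_left: "v \<in> carrier N \<Longrightarrow> w \<in> carrier N \<Longrightarrow> act (v \<oplus> w) p = act v p \<oplus> act w p"
    and act_add_right: "v \<in> carrier N \<Longrightarrow> act v (p + p') = act v p \<oplus> act v p'"
    and act_mult: "v \<in> carrier N \<Longrightarrow> act v (p * p') = act (act v p) p'"
    and act_one: "v \<in> carrier N \<Longrightarrow> act v 1 = v"
begin

lemma act_zero_left: "act \<zero> p = \<zero>"
  using act_add_left[of \<zero> \<zero> p] by (metis act_closed add.r_cancel_one l_zero zero_closed)

lemma act_zero_right: "v \<in> carrier N \<Longrightarrow> act v 0 = \<zero>"
  using act_add_right[of v 0 0] by (metis act_closed add.r_cancel_one add_0)

lemma act_uminus: "v \<in> carrier N \<Longrightarrow> act v (- p) = \<ominus> act v p"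
  using act_add_right[of v p "- p"] act_zero_right[of v]
  by (metis act_closed add.inv_unique' add.right_inverse minus_equality a_comm)

text \<open>Recursive along the list, so that \<open>nakayama\<close> can eliminate one generator at
  a time.\<close>

fun span :: "'r set \<Rightarrow> 'v list \<Rightarrow> 'v set" where
  "span S [] = {\<zero>}"
| "span S (g # gs) = {act g p \<oplus> w | p w. p \<in> S \<and> w \<in> span S gs}"

context
  fixes P S and \<phi> :: "'r \<Rightarrow> 'k::field"
  assumes hom: "prime_subring_hom P S \<phi>"
begin

interpretation prime_subring_hom P S \<phi> by (rule hom)

lemma span_closed: "set gs \<subseteq> carrier N \<Longrightarrow> span S gs \<subseteq> carrier N"
  by (induction gs) auto

lemma span_zero: "set gs \<subseteq> carrier N \<Longrightarrow> \<zero> \<in> span S gs"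
proof (induction gs)
  case (Cons g gs)
  then show ?case
    using R_zero by (auto intro!: exI[of _ "0::'r"] exI[of _ "\<zero>"] simp: act_zero_right)
qed simp

lemma span_add: "set gs \<subseteq> carrier N \<Longrightarrow> v \<in> span S gs \<Longrightarrow> w \<in> span S gs \<Longrightarrow> v \<oplus> w \<in> span S gs"
proof (induction gs arbitrary: v w)
  case (Cons g gs)
  then obtain p v' p' w' where *: "p \<in> S" "p' \<in> S" "v' \<in> span S gs" "w' \<in> span S gs"
    "v = act g p \<oplus> v'" "w = act g p' \<oplus> w'"
    by auto
  have c: "v' \<in> carrier N" "w' \<in> carrier N" "g \<in> carrier N"
    using span_closed[of gs] Cons.prems(1) * by auto
  then have "v \<oplus> w = act g (p + p') \<oplus> (v' \<oplus> w')"
    by (simp add: * act_add_right a_ac)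
  then show ?case
    using Cons.IH[of v' w'] Cons.prems * R_add by auto
qed simp

lemma span_act: "set gs \<subseteq> carrier N \<Longrightarrow> v \<in> span S gs \<Longrightarrow> p \<in> S \<Longrightarrow> act v p \<in> span S gs"
proof (induction gs arbitrary: v)
  case (Cons g gs)
  then obtain p' v' where *: "p' \<in> S" "v' \<in> span S gs" "v = act g p' \<oplus> v'"
    by auto
  have c: "v' \<in> carrier N" "g \<in> carrier N"
    using span_closed[of gs] Cons.prems(1) * by auto
  then have "act v p = act g (p' * p) \<oplus> act v' p"
    by (simp add: * act_add_left act_mult)
  then show ?case
    using Cons.IH[of v'] Cons.prems * R_mult by auto
qed (simp add: act_zero_left)

lemma span_superset: "set gs \<subseteq> carrier N \<Longrightarrow> set gs \<subseteq> span S gs"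
proof (induction gs)
  case (Cons g gs)
  have "g \<in> span S (g # gs)"
    using Cons.prems R_one span_zero[of gs] by (auto intro!: exI[of _ "1::'r"] exI[of _ "\<zero>"] simp: act_one)
  moreover have "v \<in> span S (g # gs)" if "v \<in> span S gs" for v
    using Cons.prems R_zero that span_closed[of gs]
    by (auto intro!: exI[of _ "0::'r"] exI[of _ v] simp: act_zero_right)
  ultimately show ?case
    using Cons by auto
qed simp

lemma span_subgroup:
  assumes gs: "set gs \<subseteq> carrier N"
  shows "additive_subgroup (span S gs) N"
proof (intro additive_subgroupI add.subgroupI)
  fix v assume v: "v \<in> span S gs"
  then have "v \<in> carrier N" using span_closed[OF gs] by auto
  then have "\<ominus> v = act v (0 - 1)"
    by (simp add: act_uminus act_one)
  also have "\<dots> \<in> span S gs"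
    using R_zero R_one by (intro span_act gs v R_diff)
  finally show "\<ominus> v \<in> span S gs" .
qed (use span_closed[OF gs] span_zero[OF gs] span_add[OF gs] in auto)

text \<open>Instead of a determinant, generators are removed one by one. The invariant is an element
  \<open>d\<close> with \<open>\<phi> d = 1\<close> that maps the module into the span of the
  remaining generators; when none remain, \<open>d\<close> annihilates the module.\<close>

lemma nakayama:
  assumes y: "y \<in> S" "\<phi> y = 0" and surj: "\<And>w. w \<in> carrier N \<Longrightarrow> \<exists>u\<in>carrier N. act u y = w"
    and gs: "set gs \<subseteq> carrier N"
    and gen: "\<And>U. additive_subgroup U N \<Longrightarrow> set gs \<subseteq> U \<Longrightarrow> (\<And>v p. v \<in> U \<Longrightarrow> p \<in> S \<Longrightarrow> act v p \<in> U)
      \<Longrightarrow> carrier N \<subseteq> U"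
  shows "\<exists>d\<in>S. \<phi> d = 1 \<and> (\<forall>v\<in>carrier N. act v d = \<zero>)"
proof -
  have step: "\<exists>d\<in>S. \<phi> d = 1 \<and> (\<forall>v\<in>carrier N. act v d = \<zero>)"
    if "set gs \<subseteq> carrier N" "d \<in> S" "\<phi> d = 1" "\<forall>v\<in>carrier N. act v d \<in> span S gs" for gs d
    using that
  proof (induction gs arbitrary: d)
    case Nil
    then show ?case by auto
  next
    case (Cons g gs)
    have g: "g \<in> carrier N" and gs: "set gs \<subseteq> carrier N" using Cons.prems by auto
    obtain u where u: "u \<in> carrier N" "act u y = g" using surj g by blast
    have "act u d \<in> span S (g # gs)" using Cons.prems u by blast
    then obtain p w where p: "p \<in> S" "w \<in> span S gs" "act u d = act g p \<oplus> w" by auto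
    have w: "w \<in> carrier N" using p span_closed gs by auto
    \<comment> \<open>Acting with \<open>y\<close> on \<open>u d = g p + w\<close> gives
      \<open>g d = g p y + w y\<close>. Hence \<open>e\<close>, still of value 1 as
      \<open>\<phi> y = 0\<close>, moves \<open>g\<close> into the span of the other
      generators.\<close>
    define e where "e = d - p * y"
    have eS: "e \<in> S" unfolding e_def using Cons.prems p y by (intro R_diff R_mult)
    have \<phi>e: "\<phi> e = 1"
      unfolding e_def using Cons.prems p y by (simp add: phi_diff phi_mult R_mult)
    have "act g e \<oplus> act g (p * y) = act g d"
      using act_add_right[OF g, of e "p * y"] by (simp add: e_def)
    also have "\<dots> = act (act u d) y"
      using u act_mult[of u y d] act_mult[of u d y] by (simp add: mult.commute)
    also have "\<dots> = act w y \<oplus> act g (p * y)"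
      using p w g by (simp add: act_add_left act_mult a_comm)
    finally have "act g e = act w y"
      using g w by simp
    then have ge: "act g e \<in> span S gs"
      using span_act[OF gs p(2) y(1)] by simp
    have "act v (d * e) \<in> span S gs" if v: "v \<in> carrier N" for v
    proof -
      obtain p' w' where p': "p' \<in> S" "w' \<in> span S gs" "act v d = act g p' \<oplus> w'"
        using Cons.prems v by force
      have w': "w' \<in> carrier N" using p' span_closed gs by auto
      have "act (act g p') e = act (act g e) p'"
        using act_mult[OF g, of p' e] act_mult[OF g, of e p'] by (simp add: mult.commute)
      then have "act v (d * e) = act (act g e) p' \<oplus> act w' e"
        using v g w' by (simp add: act_mult p' act_add_left)
      then show ?thesis
        using span_add[OF gs span_act[OF gs ge p'(1)] span_act[OF gs p'(2) eS]] by simp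
    qed
    then show ?case
      using Cons.IH[OF gs, of "d * e"] Cons.prems eS \<phi>e by (simp add: R_mult phi_mult)
  qed
  have "carrier N \<subseteq> span S gs"
    by (intro gen span_subgroup gs span_superset span_act)
  then have "\<forall>v\<in>carrier N. act v 1 \<in> span S gs"
    by (auto simp: act_one)
  then show ?thesis
    using step[OF gs R_one phi_one] by blast
qed

end

end


section \<open>Normal and central elements on simple modules\<close>

context right_module
begin

lemma ract_zero_right: "v \<in> carrier M \<Longrightarrow> v \<cdot>\<^bsub>M\<^esub> \<zero>\<^bsub>A\<^esub> = \<zero>\<^bsub>M\<^esub>"
  using ract_add_right[of v "\<zero>\<^bsub>A\<^esub>" "\<zero>\<^bsub>A\<^esub>"]
  by (metis M.add.r_cancel_one R.l_zero R.zero_closed ract_closed)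

lemma ract_zero_left: "r \<in> carrier A \<Longrightarrow> \<zero>\<^bsub>M\<^esub> \<cdot>\<^bsub>M\<^esub> r = \<zero>\<^bsub>M\<^esub>"
  using ract_add_left[of "\<zero>\<^bsub>M\<^esub>" "\<zero>\<^bsub>M\<^esub>" r]
  by (metis M.add.r_cancel_one M.l_zero M.zero_closed ract_closed)

lemma ract_uminus_left:
  "v \<in> carrier M \<Longrightarrow> r \<in> carrier A \<Longrightarrow> (\<ominus>\<^bsub>M\<^esub> v) \<cdot>\<^bsub>M\<^esub> r = \<ominus>\<^bsub>M\<^esub> (v \<cdot>\<^bsub>M\<^esub> r)"
  using ract_add_left[of "\<ominus>\<^bsub>M\<^esub> v" v r] ract_zero_left[of r]
  by (metis M.a_inv_closed M.l_neg M.minus_equality ract_closed)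

end

locale simple_module = T: scalar_algebra T sc L gen + N: right_module T N
  for T :: "('t, 'x) ring_scheme" and sc :: "'k::field \<Rightarrow> 't" and L :: "'l set" and gen
    and N :: "('t, 'v, 'y) rmodule_scheme" +
  assumes simple: "simple_right_module T N"
begin

lemma submodule_cases: "right_submodule U T N \<Longrightarrow> U = {\<zero>\<^bsub>N\<^esub>} \<or> U = carrier N"
  using simple by (simp add: simple_right_module_def)

lemma nonzero_exists: "\<exists>v\<in>carrier N. v \<noteq> \<zero>\<^bsub>N\<^esub>"
  using simple N.M.zero_closed by (auto simp: simple_right_module_def)

text \<open>Meant for right multiplication by an element commuting with the letters only up to
  scalars: it is not a module homomorphism, yet its image is a submodule.\<close>

lemma semilinear_image_submodule:
  assumes f: "\<And>v. v \<in> carrier N \<Longrightarrow> f v \<in> carrier N"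
    and add: "\<And>v w. v \<in> carrier N \<Longrightarrow> w \<in> carrier N \<Longrightarrow> f (v \<oplus>\<^bsub>N\<^esub> w) = f v \<oplus>\<^bsub>N\<^esub> f w"
    and sc: "\<And>v c. v \<in> carrier N \<Longrightarrow> f v \<cdot>\<^bsub>N\<^esub> sc c = f (v \<cdot>\<^bsub>N\<^esub> sc c)"
    and gen: "\<And>v l. v \<in> carrier N \<Longrightarrow> l \<in> L \<Longrightarrow> \<exists>c. f v \<cdot>\<^bsub>N\<^esub> gen l = f (v \<cdot>\<^bsub>N\<^esub> gen l) \<cdot>\<^bsub>N\<^esub> sc c"
  shows "right_submodule (f ` carrier N) T N"
proof (rule T.submodule_if_closed_gen)
  show "right_module T N" ..
  have zero: "f \<zero>\<^bsub>N\<^esub> = \<zero>\<^bsub>N\<^esub>"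
    using add[of "\<zero>\<^bsub>N\<^esub>" "\<zero>\<^bsub>N\<^esub>"] f[of "\<zero>\<^bsub>N\<^esub>"] by (metis N.M.add.r_cancel_one N.M.l_zero N.M.zero_closed)
  show "additive_subgroup (f ` carrier N) N"
  proof (intro additive_subgroupI N.M.add.subgroupI)
    show "f ` carrier N \<noteq> {}" using N.M.zero_closed by blast
    fix v assume "v \<in> f ` carrier N"
    then obtain u where u: "u \<in> carrier N" "v = f u" by blast
    have "f (\<ominus>\<^bsub>N\<^esub> u) \<oplus>\<^bsub>N\<^esub> f u = \<zero>\<^bsub>N\<^esub>"
      using add[of "\<ominus>\<^bsub>N\<^esub> u" u] u zero by (simp add: N.M.l_neg)
    then have "\<ominus>\<^bsub>N\<^esub> v = f (\<ominus>\<^bsub>N\<^esub> u)"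
      using u f by (simp add: N.M.minus_equality)
    then show "\<ominus>\<^bsub>N\<^esub> v \<in> f ` carrier N" using u by blast
    fix w assume "w \<in> f ` carrier N"
    then obtain u' where u': "u' \<in> carrier N" "w = f u'" by blast
    have "v \<oplus>\<^bsub>N\<^esub> w = f (u \<oplus>\<^bsub>N\<^esub> u')" using add u u' by simp
    then show "v \<oplus>\<^bsub>N\<^esub> w \<in> f ` carrier N" using u u' by blast
  qed (use f in auto)
  fix v assume "v \<in> f ` carrier N"
  then obtain u where u: "u \<in> carrier N" "v = f u" by blast
  show "v \<cdot>\<^bsub>N\<^esub> sc c \<in> f ` carrier N" for c
    using sc u N.ract_closed by auto
  show "v \<cdot>\<^bsub>N\<^esub> gen l \<in> f ` carrier N" if "l \<in> L" for l
    using gen[OF u(1) that] sc[of "u \<cdot>\<^bsub>N\<^esub> gen l"] u N.ract_closed that by auto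
qed

text \<open>The counterpart for kernels. Here the scalar stands on the other side of the commutation
  rule, so that deriving both forms from one rule requires an invertible scalar.\<close>

lemma semilinear_kernel_submodule:
  assumes f: "\<And>v. v \<in> carrier N \<Longrightarrow> f v \<in> carrier N"
    and add: "\<And>v w. v \<in> carrier N \<Longrightarrow> w \<in> carrier N \<Longrightarrow> f (v \<oplus>\<^bsub>N\<^esub> w) = f v \<oplus>\<^bsub>N\<^esub> f w"
    and sc: "\<And>v c. v \<in> carrier N \<Longrightarrow> f (v \<cdot>\<^bsub>N\<^esub> sc c) = f v \<cdot>\<^bsub>N\<^esub> sc c"
    and gen: "\<And>v l. v \<in> carrier N \<Longrightarrow> l \<in> L \<Longrightarrow> \<exists>c. f (v \<cdot>\<^bsub>N\<^esub> gen l) = f v \<cdot>\<^bsub>N\<^esub> gen l \<cdot>\<^bsub>N\<^esub> sc c"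
  shows "right_submodule {v\<in>carrier N. f v = \<zero>\<^bsub>N\<^esub>} T N"
proof (rule T.submodule_if_closed_gen)
  show "right_module T N" ..
  have zero: "f \<zero>\<^bsub>N\<^esub> = \<zero>\<^bsub>N\<^esub>"
    using add[of "\<zero>\<^bsub>N\<^esub>" "\<zero>\<^bsub>N\<^esub>"] f[of "\<zero>\<^bsub>N\<^esub>"] by (metis N.M.add.r_cancel_one N.M.l_zero N.M.zero_closed)
  show "additive_subgroup {v\<in>carrier N. f v = \<zero>\<^bsub>N\<^esub>} N"
  proof (intro additive_subgroupI N.M.add.subgroupI)
    fix v assume v: "v \<in> {v\<in>carrier N. f v = \<zero>\<^bsub>N\<^esub>}"
    then have "f (\<ominus>\<^bsub>N\<^esub> v) \<oplus>\<^bsub>N\<^esub> f v = \<zero>\<^bsub>N\<^esub>"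
      using add[of "\<ominus>\<^bsub>N\<^esub> v" v] zero by (simp add: N.M.l_neg)
    then show "\<ominus>\<^bsub>N\<^esub> v \<in> {v\<in>carrier N. f v = \<zero>\<^bsub>N\<^esub>}"
      using v f[of "\<ominus>\<^bsub>N\<^esub> v"] by simp
  qed (use zero add in auto)
  fix v assume v: "v \<in> {v\<in>carrier N. f v = \<zero>\<^bsub>N\<^esub>}"
  show "v \<cdot>\<^bsub>N\<^esub> sc c \<in> {v\<in>carrier N. f v = \<zero>\<^bsub>N\<^esub>}" for c
    using v sc N.ract_zero_left N.ract_closed by auto
  show "v \<cdot>\<^bsub>N\<^esub> gen l \<in> {v\<in>carrier N. f v = \<zero>\<^bsub>N\<^esub>}" if "l \<in> L" for l
    using v gen[of v l] that N.ract_zero_left N.ract_closed by auto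
qed

text \<open>Schur's lemma for normal elements: image and kernel are submodules of a simple module.
  The kernel part uses the inverses of the scalars \<open>c\<close>.\<close>

lemma normal_zero_or_bij:
  assumes z: "z \<in> carrier T" and comm: "\<And>l. l \<in> L \<Longrightarrow> \<exists>c\<noteq>0. z \<otimes>\<^bsub>T\<^esub> gen l = gen l \<otimes>\<^bsub>T\<^esub> z \<otimes>\<^bsub>T\<^esub> sc c"
  shows "(\<forall>v\<in>carrier N. v \<cdot>\<^bsub>N\<^esub> z = \<zero>\<^bsub>N\<^esub>) \<or> bij_betw (\<lambda>v. v \<cdot>\<^bsub>N\<^esub> z) (carrier N) (carrier N)"
proof (cases "\<forall>v\<in>carrier N. v \<cdot>\<^bsub>N\<^esub> z = \<zero>\<^bsub>N\<^esub>")
  case False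
  let ?f = "\<lambda>v. v \<cdot>\<^bsub>N\<^esub> z"
  have closed: "?f v \<in> carrier N" if "v \<in> carrier N" for v
    using N.ract_closed z that by blast
  have add: "?f (v \<oplus>\<^bsub>N\<^esub> w) = ?f v \<oplus>\<^bsub>N\<^esub> ?f w" if "v \<in> carrier N" "w \<in> carrier N" for v w
    using N.ract_add_left z that by blast
  have sc: "?f v \<cdot>\<^bsub>N\<^esub> sc c = ?f (v \<cdot>\<^bsub>N\<^esub> sc c)" if "v \<in> carrier N" for v c
    using z that T.sc_comm[of z c] N.ract_mult[of v z "sc c"] N.ract_mult[of v "sc c" z] by simp
  have g1: "\<exists>c. ?f v \<cdot>\<^bsub>N\<^esub> gen l = ?f (v \<cdot>\<^bsub>N\<^esub> gen l) \<cdot>\<^bsub>N\<^esub> sc c" if v: "v \<in> carrier N" and l: "l \<in> L" for v l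
  proof -
    obtain c where c: "z \<otimes>\<^bsub>T\<^esub> gen l = gen l \<otimes>\<^bsub>T\<^esub> z \<otimes>\<^bsub>T\<^esub> sc c" using comm[OF l] by blast
    have "v \<cdot>\<^bsub>N\<^esub> (z \<otimes>\<^bsub>T\<^esub> gen l) = v \<cdot>\<^bsub>N\<^esub> (gen l \<otimes>\<^bsub>T\<^esub> z \<otimes>\<^bsub>T\<^esub> sc c)" by (simp add: c)
    then show ?thesis
      using v l z by (auto simp: N.ract_mult)
  qed
  have g2: "\<exists>c. ?f (v \<cdot>\<^bsub>N\<^esub> gen l) = ?f v \<cdot>\<^bsub>N\<^esub> gen l \<cdot>\<^bsub>N\<^esub> sc c" if v: "v \<in> carrier N" and l: "l \<in> L" for v l
  proof -
    obtain c where c: "c \<noteq> 0" "z \<otimes>\<^bsub>T\<^esub> gen l = gen l \<otimes>\<^bsub>T\<^esub> z \<otimes>\<^bsub>T\<^esub> sc c" using comm[OF l] by blast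
    have "z \<otimes>\<^bsub>T\<^esub> gen l \<otimes>\<^bsub>T\<^esub> sc (inverse c) = gen l \<otimes>\<^bsub>T\<^esub> z \<otimes>\<^bsub>T\<^esub> (sc c \<otimes>\<^bsub>T\<^esub> sc (inverse c))"
      using z l by (simp add: c T.m_assoc)
    also have "\<dots> = gen l \<otimes>\<^bsub>T\<^esub> z"
      using z l c by (simp add: T.sc_one flip: T.sc_mult)
    finally have "v \<cdot>\<^bsub>N\<^esub> (z \<otimes>\<^bsub>T\<^esub> gen l \<otimes>\<^bsub>T\<^esub> sc (inverse c)) = v \<cdot>\<^bsub>N\<^esub> (gen l \<otimes>\<^bsub>T\<^esub> z)" by simp
    then show ?thesis
      using v l z by (intro exI[of _ "inverse c"]) (auto simp: N.ract_mult)
  qed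
  have im: "right_submodule (?f ` carrier N) T N"
    by (rule semilinear_image_submodule) (use closed add sc g1 in auto)
  have ker: "right_submodule {v\<in>carrier N. ?f v = \<zero>\<^bsub>N\<^esub>} T N"
    by (rule semilinear_kernel_submodule) (use closed add sc g2 in auto)
  have surj: "?f ` carrier N = carrier N"
    using submodule_cases[OF im] False by blast
  have "{v\<in>carrier N. ?f v = \<zero>\<^bsub>N\<^esub>} = {\<zero>\<^bsub>N\<^esub>}"
    using submodule_cases[OF ker] False by blast
  then have ker0: "v = \<zero>\<^bsub>N\<^esub>" if "v \<in> carrier N" "?f v = \<zero>\<^bsub>N\<^esub>" for v
    using that by blast
  have "inj_on ?f (carrier N)"
  proof (rule inj_onI)
    fix v w assume vw: "v \<in> carrier N" "w \<in> carrier N" "?f v = ?f w"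
    then have "?f (v \<oplus>\<^bsub>N\<^esub> \<ominus>\<^bsub>N\<^esub> w) = \<zero>\<^bsub>N\<^esub>"
      using z closed[of w] by (simp add: add N.ract_uminus_left N.M.r_neg)
    then have "v \<oplus>\<^bsub>N\<^esub> \<ominus>\<^bsub>N\<^esub> w = \<zero>\<^bsub>N\<^esub>"
      using ker0 vw by simp
    then show "v = w"
      using vw by (metis N.M.a_inv_closed N.M.minus_equality N.M.minus_minus)
  qed
  then show ?thesis
    using surj by (simp add: bij_betw_def)
qed simp

lemma central_zero_or_bij:
  assumes "T.central z"
  shows "(\<forall>v\<in>carrier N. v \<cdot>\<^bsub>N\<^esub> z = \<zero>\<^bsub>N\<^esub>) \<or> bij_betw (\<lambda>v. v \<cdot>\<^bsub>N\<^esub> z) (carrier N) (carrier N)"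
  using assms
  by (intro normal_zero_or_bij) (auto simp: T.central_def T.sc_one intro!: exI[of _ "1::'k"])

end

context scalar_algebra
begin

lemma central_uminus: "central z \<Longrightarrow> central (\<ominus> z)"
  unfolding central_def by (simp add: l_minus r_minus)

lemma cring_center: "cring (T\<lparr>carrier := {z. central z}\<rparr>)"
proof -
  have "subring {z. central z} T"
    by (rule subringI) (auto simp: central_one central_uminus central_add central_mult centralD)
  then have "subcring {z. central z} T"
    by (rule subcringI) (auto simp: centralD)
  then show ?thesis
    using subcring_iff[of "{z. central z}"] centralD by blast
qed

end

context simple_module
begin

text \<open>Finite generation over the subalgebra generated by \<open>Y\<close> and the scalars,
  expressed through stable additive subgroups so that this subalgebra never has to be
  formed.\<close>

definition fin_gen :: "'t set \<Rightarrow> bool" where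
  "fin_gen Y \<longleftrightarrow> (\<exists>gs. set gs \<subseteq> carrier N \<and> (\<forall>U. additive_subgroup U N \<longrightarrow> set gs \<subseteq> U \<longrightarrow>
     (\<forall>v\<in>U. \<forall>c. v \<cdot>\<^bsub>N\<^esub> sc c \<in> U) \<longrightarrow> (\<forall>v\<in>U. \<forall>y\<in>Y. v \<cdot>\<^bsub>N\<^esub> y \<in> U) \<longrightarrow> carrier N \<subseteq> U))"

lemma fin_gen_mono: "fin_gen Y \<Longrightarrow> Y \<subseteq> Y' \<Longrightarrow> fin_gen Y'"
  unfolding fin_gen_def by (meson subset_iff)

end

locale simple_module_alg_closed = simple_module T sc L gen N
  for T :: "('t, 'x) ring_scheme" and sc :: "'k::alg_closed_field \<Rightarrow> 't" and L :: "'l set" and gen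
    and N :: "('t, 'v, 'y) rmodule_scheme"
begin

text \<open>Let \<open>\<phi>\<close> be a point at which all annihilating polynomials vanish. If
  \<open>z\<close> minus its value there did not annihilate \<open>N\<close>, it would act
  surjectively, and \<open>nakayama\<close> would provide an annihilating polynomial with value 1 at
  \<open>\<phi>\<close>.\<close>

lemma central_acts_as_scalar:
  assumes Y: "finite Y" "\<And>y. y \<in> Y \<Longrightarrow> T.central y" "fin_gen Y" and z: "z \<in> Y"
  shows "\<exists>c. \<forall>v\<in>carrier N. v \<cdot>\<^bsub>N\<^esub> z = v \<cdot>\<^bsub>N\<^esub> sc c"
proof -
  obtain ys where ys: "set ys = Y" using finite_list[OF Y(1)] by blast
  obtain i where i: "i < length ys" "z = ys ! i" using z ys by (metis in_set_conv_nth)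
  interpret C: cring "T\<lparr>carrier := {z. T.central z}\<rparr>" by (rule T.cring_center)
  obtain ev :: "((nat \<Rightarrow>\<^sub>0 nat) \<Rightarrow>\<^sub>0 'k) \<Rightarrow> 't" where ev:
    "\<And>p. ev p \<in> carrier (T\<lparr>carrier := {z. T.central z}\<rparr>)"
    "\<And>p p'. ev (p + p') = ev p \<oplus>\<^bsub>T\<lparr>carrier := {z. T.central z}\<rparr>\<^esub> ev p'"
    "\<And>p p'. ev (p * p') = ev p \<otimes>\<^bsub>T\<lparr>carrier := {z. T.central z}\<rparr>\<^esub> ev p'"
    "\<And>c. ev (Poly_Mapping.single 0 c) = sc c"
    "\<And>i. i < length ys \<Longrightarrow> ev (Poly_Mapping.single (Poly_Mapping.single i 1) 1)
       = (if i < length ys then ys ! i else \<one>\<^bsub>T\<^esub>)"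
    by (rule C.poly_mapping_eval[of sc "\<lambda>i. if i < length ys then ys ! i else \<one>\<^bsub>T\<^esub>" "length ys"])
       (use ys Y(2) in \<open>auto simp: T.central_sc T.sc_add T.sc_mult T.sc_one T.central_one\<close>)
  have ev_central: "T.central (ev p)" for p using ev(1) by simp
  have ev_closed: "ev p \<in> carrier T" for p using ev_central T.centralD by blast
  have ev_var: "ev (Poly_Mapping.single (Poly_Mapping.single j 1) 1) = ys ! j" if "j < length ys" for j
    using ev(5)[OF that] by (simp only: that if_True)
  define act where "act v p = v \<cdot>\<^bsub>N\<^esub> ev p" for v p
  interpret act: comm_action N act
  proof (intro comm_action.intro comm_action_axioms.intro N.M.abelian_group_axioms)
    fix v assume "v \<in> carrier N"
    then show "act v 1 = v"
      using N.ract_one ev(4)[of 1] by (simp add: act_def T.sc_one)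
  qed (auto simp: act_def ev(2,3) ev_closed N.ract_closed N.ract_add_left N.ract_add_right N.ract_mult)
  define P where "P = {p. \<forall>v\<in>carrier N. act v p = \<zero>\<^bsub>N\<^esub>}"
  let ?c = "\<lambda>c :: 'k. Poly_Mapping.single (0 :: nat \<Rightarrow>\<^sub>0 nat) c"
  have dich: "bij_betw (\<lambda>v. act v p) (carrier N) (carrier N)" if "p \<notin> P" for p
    using central_zero_or_bij[OF ev_central[of p]] that by (auto simp: P_def act_def)
  interpret P: prime_subring P "range ?c"
  proof
    show "0 \<in> P" by (simp add: P_def act.act_zero_right)
    fix x y
    show "x \<in> P \<Longrightarrow> y \<in> P \<Longrightarrow> x + y \<in> P" by (simp add: P_def act.act_add_right)
    show xP: "x \<in> P \<Longrightarrow> x * y \<in> P" by (simp add: P_def act.act_mult act.act_zero_left)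
    show "1 \<notin> P" using nonzero_exists by (auto simp: P_def act.act_one)
    \<comment> \<open>Primeness rests on the dichotomy for central elements: a factor outside
      \<open>P\<close> acts injectively and can be cancelled.\<close>
    show "x * y \<in> P \<Longrightarrow> x \<in> P \<or> y \<in> P"
    proof (rule disjCI)
      assume xy: "x * y \<in> P" and "y \<notin> P"
      then have inj: "inj_on (\<lambda>v. act v y) (carrier N)"
        using dich bij_betw_imp_inj_on by blast
      show "x \<in> P"
        unfolding P_def
      proof (intro CollectI ballI)
        fix v assume v: "v \<in> carrier N"
        have "act (act v x) y = act \<zero>\<^bsub>N\<^esub> y"
          using xy v by (simp add: P_def act.act_mult act.act_zero_left)
        then show "act v x = \<zero>\<^bsub>N\<^esub>"
          using inj v by (auto dest: inj_onD)
      qed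
    qed
  next
    show "1 \<in> range ?c" by (metis rangeI single_one)
    fix x y assume "x \<in> range ?c" "y \<in> range ?c"
    then show "x - y \<in> range ?c" "x * y \<in> range ?c"
      by (auto simp: mult_single simp flip: single_diff)
  qed
  have unit: "?c c \<notin> P" if "c \<noteq> 0" for c
    using P.P_mult[of "?c c" "?c (inverse c)"] P.P_one that by (auto simp: mult_single)
  \<comment> \<open>The starting point is the identity of \<open>'k\<close>, read off a constant
    polynomial as its coefficient at the trivial monomial.\<close>
  have hom0: "prime_subring_hom P (range ?c) (\<lambda>p. Poly_Mapping.lookup p 0)"
  proof (intro prime_subring_hom.intro prime_subring_hom_axioms.intro P.prime_subring_axioms)
    show "Poly_Mapping.lookup x 0 = 0" if "x \<in> range ?c" "x \<in> P" for x
      using that unit by (auto simp: lookup_single) (metis lookup_single_eq)+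
  qed (auto simp: lookup_add mult_single lookup_one)
  define us where "us = map (\<lambda>i. Poly_Mapping.single (Poly_Mapping.single i (1 :: nat)) (1 :: 'k)) [0..<length ys]"
  obtain S and \<phi> :: "((nat \<Rightarrow>\<^sub>0 nat) \<Rightarrow>\<^sub>0 'k) \<Rightarrow> 'k" where S: "range ?c \<subseteq> S" "set us \<subseteq> S"
      "prime_subring_hom P S \<phi>" "\<And>x. x \<in> range ?c \<Longrightarrow> \<phi> x = Poly_Mapping.lookup x 0"
  proof (rule extend_finitely_generated[OF hom0, of us])
    show "Poly_Mapping.lookup x 0 \<noteq> 0" if "x \<in> range ?c" "x \<notin> P" for x
      using that P.P_zero by auto
  qed blast
  interpret S: prime_subring_hom P S \<phi> by (rule S)
  define x where "x = Poly_Mapping.single (Poly_Mapping.single i (1 :: nat)) (1 :: 'k)"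
  have var: "Poly_Mapping.single (Poly_Mapping.single j (1 :: nat)) (1 :: 'k) \<in> S" if "j < length ys" for j
    using S(2) that by (auto simp: us_def)
  have xS: "x \<in> S" using var i by (simp add: x_def)
  \<comment> \<open>\<open>x\<close> is the variable that evaluates to \<open>z\<close>; subtracting
    its value puts \<open>y\<close> into the kernel of \<open>\<phi>\<close>.\<close>
  define y where "y = x - ?c (\<phi> x)"
  have cS: "?c c \<in> S" for c using S(1) by auto
  have \<phi>c: "\<phi> (?c c) = c" for c using S(4) by simp
  have yS: "y \<in> S" unfolding y_def by (intro S.R_diff xS cS)
  have \<phi>y: "\<phi> y = 0"
    unfolding y_def using S.phi_diff[OF xS cS] \<phi>c by simp
  have "y \<in> P"
  proof (rule ccontr)
    assume "y \<notin> P"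
    from dich[OF this] have surj: "\<exists>u\<in>carrier N. act u y = w" if "w \<in> carrier N" for w
      using that unfolding bij_betw_def by (metis imageE)
    obtain gs where gs: "set gs \<subseteq> carrier N" and
      gen: "\<And>U. additive_subgroup U N \<Longrightarrow> set gs \<subseteq> U \<Longrightarrow> (\<forall>v\<in>U. \<forall>c. v \<cdot>\<^bsub>N\<^esub> sc c \<in> U) \<Longrightarrow>
        (\<forall>v\<in>U. \<forall>y\<in>Y. v \<cdot>\<^bsub>N\<^esub> y \<in> U) \<Longrightarrow> carrier N \<subseteq> U"
      using Y(3) unfolding fin_gen_def by blast
    have "\<exists>d\<in>S. \<phi> d = 1 \<and> (\<forall>v\<in>carrier N. act v d = \<zero>\<^bsub>N\<^esub>)"
    proof (rule act.nakayama[OF S(3) yS \<phi>y surj gs])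
      fix U assume U: "additive_subgroup U N" "set gs \<subseteq> U" "\<And>v p. v \<in> U \<Longrightarrow> p \<in> S \<Longrightarrow> act v p \<in> U"
      have "v \<cdot>\<^bsub>N\<^esub> sc c \<in> U" if "v \<in> U" for v c
        using U(3)[OF that, of "?c c"] S(1) by (auto simp: act_def ev)
      moreover have "v \<cdot>\<^bsub>N\<^esub> y' \<in> U" if vU: "v \<in> U" and yY: "y' \<in> Y" for v y'
      proof -
        obtain j where j: "j < length ys" "y' = ys ! j" using yY unfolding ys[symmetric] in_set_conv_nth by blast
        then show ?thesis
          using U(3)[OF vU var[OF j(1)]] j(2) by (simp only: act_def ev_var[OF j(1)])
      qed
      ultimately show "carrier N \<subseteq> U" using gen U by blast
    qed blast
    then obtain d where d: "d \<in> S" "\<phi> d = 1" "d \<in> P" by (auto simp: P_def)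
    then show False using S.phi_P by fastforce
  qed
  show ?thesis
  proof (intro exI[of _ "\<phi> x"] ballI)
    fix v assume v: "v \<in> carrier N"
    have "v \<cdot>\<^bsub>N\<^esub> z = act v x" by (simp only: act_def x_def ev_var[OF i(1)] i(2))
    also have "\<dots> = act v (y + ?c (\<phi> x))" by (simp add: y_def)
    also have "\<dots> = v \<cdot>\<^bsub>N\<^esub> sc (\<phi> x)"
    proof -
      have "act v y = \<zero>\<^bsub>N\<^esub>" "act v (?c (\<phi> x)) = v \<cdot>\<^bsub>N\<^esub> sc (\<phi> x)"
        using \<open>y \<in> P\<close> v by (auto simp: P_def act_def ev(4))
      then show ?thesis
        using v N.ract_closed by (simp add: act.act_add_right)
    qed
    finally show "v \<cdot>\<^bsub>N\<^esub> z = v \<cdot>\<^bsub>N\<^esub> sc (\<phi> x)" .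
  qed
qed

end

section \<open>The quantum torus in normal form\<close>

context scalar_algebra
begin

definition qcomm :: "'k \<Rightarrow> 't \<Rightarrow> 't \<Rightarrow> bool" where
  "qcomm c a b \<longleftrightarrow> a \<otimes> b = sc c \<otimes> (b \<otimes> a)"

lemma qcomm_1_iff: "a \<in> carrier T \<Longrightarrow> b \<in> carrier T \<Longrightarrow> qcomm 1 a b \<longleftrightarrow> a \<otimes> b = b \<otimes> a"
  by (simp add: qcomm_def sc_one)

lemma sc_left_commute: "x \<in> carrier T \<Longrightarrow> y \<in> carrier T \<Longrightarrow> x \<otimes> (sc c \<otimes> y) = sc c \<otimes> (x \<otimes> y)"
  using sc_comm[of x c] m_assoc[of x "sc c" y] m_assoc[of "sc c" x y] by simp

lemma sc_sc: "x \<in> carrier T \<Longrightarrow> sc c \<otimes> (sc d \<otimes> x) = sc (c * d) \<otimes> x"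
  by (simp add: sc_mult m_assoc)

lemma qcomm_mult:
  assumes "a \<in> carrier T" "a' \<in> carrier T" "b \<in> carrier T" "qcomm c a b" "qcomm d a' b"
  shows "qcomm (c * d) (a \<otimes> a') b"
proof -
  note closed = assms(1-3) m_closed sc_closed
  have "a \<otimes> a' \<otimes> b = a \<otimes> (sc d \<otimes> (b \<otimes> a'))"
    using assms(5) closed by (simp only: qcomm_def m_assoc)
  also have "\<dots> = sc d \<otimes> ((a \<otimes> b) \<otimes> a')"
    using closed by (simp only: sc_left_commute[of a "b \<otimes> a'"] m_assoc)
  also have "\<dots> = sc d \<otimes> (sc c \<otimes> (b \<otimes> (a \<otimes> a')))"
    using assms(4) closed by (simp only: qcomm_def m_assoc)
  also have "\<dots> = sc (d * c) \<otimes> (b \<otimes> (a \<otimes> a'))"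
    using closed by (simp only: sc_sc)
  finally show ?thesis by (simp add: qcomm_def mult.commute)
qed

lemma qcomm_pow:
  assumes "a \<in> carrier T" "b \<in> carrier T" "qcomm c a b"
  shows "qcomm (c ^ k) (a [^] k) b"
proof (induction k)
  case 0
  then show ?case using assms by (simp add: qcomm_def sc_one)
next
  case (Suc k)
  then show ?case using qcomm_mult[OF _ _ _ Suc assms(3)] assms by (simp add: mult.commute)
qed

lemma qcomm_sym:
  assumes "a \<in> carrier T" "b \<in> carrier T" "qcomm c a b" "c \<noteq> 0"
  shows "qcomm (inverse c) b a"
proof -
  have "sc (inverse c) \<otimes> (a \<otimes> b) = sc (inverse c * c) \<otimes> (b \<otimes> a)"
    using assms by (simp add: qcomm_def sc_sc)
  then show ?thesis using assms by (simp add: qcomm_def sc_one)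
qed

lemma qcomm_pow_commute:
  assumes "a \<in> carrier T" "b \<in> carrier T" "qcomm c a b" "c ^ k = 1"
  shows "a [^] k \<otimes> b = b \<otimes> a [^] k"
  using qcomm_pow[OF assms(1-3), of k] assms by (simp add: qcomm_1_iff)

text \<open>Multiply \<open>z a = a z\<close> by the two-sided inverse \<open>b\<close> of
  \<open>a\<close> on both sides.\<close>

lemma commute_inverse:
  assumes "z \<in> carrier T" "a \<in> carrier T" "b \<in> carrier T" "a \<otimes> b = \<one>" "b \<otimes> a = \<one>" "z \<otimes> a = a \<otimes> z"
  shows "z \<otimes> b = b \<otimes> z"
proof -
  have "z \<otimes> b = (b \<otimes> a) \<otimes> (z \<otimes> b)" using assms(1-3) by (simp only: assms(5) l_one m_closed)
  also have "\<dots> = b \<otimes> ((a \<otimes> z) \<otimes> b)" using assms(1-3) by (simp only: m_assoc m_closed)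
  also have "\<dots> = b \<otimes> (z \<otimes> (a \<otimes> b))" using assms(1-3) by (simp only: assms(6)[symmetric] m_assoc m_closed)
  also have "\<dots> = b \<otimes> z" using assms by simp
  finally show ?thesis .
qed

lemma inverse_pow:
  assumes "a \<in> carrier T" "b \<in> carrier T" "a \<otimes> b = \<one>" "b \<otimes> a = \<one>"
  shows "a [^] (k::nat) \<otimes> b [^] k = \<one>"
  using assms by (metis commute_inverse pow_mult_distrib nat_pow_one)

end

lemma presentation_nf: "presentation (nf_letters n) (nf_rels n s h (q :: 'k::field))" if "2 * s \<le> n"
proof
  interpret F: ring "free_algebra (nf_letters n) :: (torus_letter list \<Rightarrow> 'k) ring"
    by (rule free_algebra_ring)
  have c: "fmonom c w \<in> carrier (free_algebra (nf_letters n))" if "set w \<subseteq> nf_letters n" for c :: 'k and w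
    using that by (rule fmonom_carrier)
  show "nf_rels n s h q \<subseteq> carrier (free_algebra (nf_letters n))"
    using that unfolding nf_rels_def Let_def
    by (auto simp del: fa_simps intro!: F.minus_closed F.one_closed c) (auto simp: nf_letters_def)
qed

text \<open>\<open>q_order\<close> is the form in which \<open>q\<close> is known to be a primitive
  \<open>m\<close>-th root of unity.\<close>

locale torus =
  fixes n s m :: nat and h :: "nat \<Rightarrow> nat" and q :: "'k::alg_closed_field"
  assumes exps: "nf_exponents n s m h" and q_nonzero: "q \<noteq> 0" and m_pos: "m > 0"
    and q_order: "\<And>i. q ^ i = 1 \<longleftrightarrow> m dvd i"
begin

lemma s_le: "2 * s \<le> n"
  using exps by (simp add: nf_exponents_def)

lemma h_facts: "i \<in> {1..s} \<Longrightarrow> 0 < h i \<and> h i dvd m \<and> h i < m"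
  using exps by (simp add: nf_exponents_def)

abbreviation "T \<equiv> nf_torus n s h q"
abbreviation "sc \<equiv> nf_scalar n s h q"
abbreviation "gX \<equiv> nf_gen n s h q"
abbreviation "cl \<equiv> pa_class (nf_letters n) (nf_rels n s h q)"

definition gXi :: "nat \<Rightarrow> (torus_letter list \<Rightarrow> 'k) set" where
  "gXi k = cl (fmonom 1 [Tinv k])"

sublocale pres: presentation "nf_letters n" "nf_rels n s h q"
  by (rule presentation_nf[OF s_le])

sublocale T: scalar_algebra T sc "nf_letters n" "\<lambda>l. cl (fmonom 1 [l])"
  using pres.A.scalar_algebra_axioms by (simp add: nf_torus_def nf_scalar_def[abs_def])

lemma X_closed [simp]: "k \<in> {1..n} \<Longrightarrow> gX k \<in> carrier T"
  using T.gen_closed[of "Tgen k"] by (auto simp: nf_gen_def nf_letters_def)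

lemma Xi_closed [simp]: "k \<in> {1..n} \<Longrightarrow> gXi k \<in> carrier T"
  using T.gen_closed[of "Tinv k"] by (auto simp: gXi_def nf_letters_def)

lemma cl_monom_mult: "set u \<subseteq> nf_letters n \<Longrightarrow> set v \<subseteq> nf_letters n \<Longrightarrow>
    cl (fmonom c u) \<otimes>\<^bsub>T\<^esub> cl (fmonom d v) = cl (fmonom (c * d) (u @ v))"
  using pres.cls_monom_mult by (simp add: nf_torus_def)

lemma letters: "k \<in> {1..n} \<Longrightarrow> Tgen k \<in> nf_letters n" "k \<in> {1..n} \<Longrightarrow> Tinv k \<in> nf_letters n"
  by (auto simp: nf_letters_def)

lemma X_Xi: assumes "k \<in> {1..n}" shows "gX k \<otimes>\<^bsub>T\<^esub> gXi k = \<one>\<^bsub>T\<^esub>" "gXi k \<otimes>\<^bsub>T\<^esub> gX k = \<one>\<^bsub>T\<^esub>"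
proof -
  have "cl (fmonom 1 [Tgen k, Tinv k]) = cl \<one>\<^bsub>pres.F\<^esub>"
    using assms by (intro pres.cls_minus pres.F.one_closed fmonom_carrier)
      (auto simp: nf_rels_def Let_def letters simp del: fa_simps)
  then show "gX k \<otimes>\<^bsub>T\<^esub> gXi k = \<one>\<^bsub>T\<^esub>"
    using assms T.sc_one by (simp add: nf_gen_def gXi_def cl_monom_mult letters nf_scalar_def)
  have "cl (fmonom 1 [Tinv k, Tgen k]) = cl \<one>\<^bsub>pres.F\<^esub>"
    using assms by (intro pres.cls_minus pres.F.one_closed fmonom_carrier)
      (auto simp: nf_rels_def Let_def letters simp del: fa_simps)
  then show "gXi k \<otimes>\<^bsub>T\<^esub> gX k = \<one>\<^bsub>T\<^esub>"
    using assms T.sc_one by (simp add: nf_gen_def gXi_def cl_monom_mult letters nf_scalar_def)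
qed

text \<open>The scalars in \<open>X\<^sub>k X\<^sub>l = cc k l X\<^sub>l X\<^sub>k\<close>.\<close>

definition cc :: "nat \<Rightarrow> nat \<Rightarrow> 'k" where
  "cc k l = (if k \<in> {1..s} \<and> l = k + s then q ^ h k
     else if l \<in> {1..s} \<and> k = l + s then inverse (q ^ h l) else 1)"

lemma cc_pow_m: "cc k l ^ m = 1"
proof -
  have "(q ^ h i) ^ m = 1" for i
    using q_order[of "h i * m"] by (simp add: power_mult)
  then show ?thesis by (auto simp: cc_def power_inverse)
qed

lemma cc_nonzero: "cc k l \<noteq> 0"
  using q_nonzero by (simp add: cc_def)

lemma X_qcomm:
  assumes k: "k \<in> {1..n}" and l: "l \<in> {1..n}"
  shows "T.qcomm (cc k l) (gX k) (gX l)"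
proof -
  have pair: "T.qcomm (q ^ h i) (gX i) (gX (i + s))" if i: "i \<in> {1..s}" for i
  proof -
    have i': "i \<in> {1..n}" "i + s \<in> {1..n}" using i s_le by auto
    have "cl (fmonom 1 [Tgen i, Tgen (i + s)]) = cl (fmonom (q ^ h i) [Tgen (i + s), Tgen i])"
      using i i' by (intro pres.cls_minus fmonom_carrier)
        (auto simp: nf_rels_def Let_def letters simp del: fa_simps)
    then show ?thesis
      using i' by (simp add: T.qcomm_def nf_gen_def cl_monom_mult letters nf_scalar_def)
  qed
  consider "k \<in> {1..s}" "l = k + s" | "l \<in> {1..s}" "k = l + s" "\<not> (k \<in> {1..s} \<and> l = k + s)"
    | "\<not> (k \<in> {1..s} \<and> l = k + s)" "\<not> (l \<in> {1..s} \<and> k = l + s)" by blast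
  then show ?thesis
  proof cases
    case 1
    then show ?thesis using pair by (simp add: cc_def)
  next
    case 2
    have "T.qcomm (inverse (q ^ h l)) (gX (l + s)) (gX l)"
      using 2 k l pair[of l] q_nonzero by (intro T.qcomm_sym) auto
    moreover have "cc k l = inverse (q ^ h l)" using 2 by (simp only: cc_def if_False simp_thms if_True)
    ultimately show ?thesis using 2 by simp
  next
    case 3
    have ne: "\<forall>i\<in>{1..s}. {k, l} \<noteq> {i, i + s}"
      using 3 by (auto simp: doubleton_eq_iff)
    have "cl (fmonom 1 [Tgen k, Tgen l]) = cl (fmonom 1 [Tgen l, Tgen k])"
    proof (intro pres.cls_minus fmonom_carrier)
      show "fmonom 1 [Tgen k, Tgen l] \<ominus>\<^bsub>pres.F\<^esub> fmonom 1 [Tgen l, Tgen k] \<in> nf_rels n s h q"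
        unfolding nf_rels_def Let_def using k l ne by blast
    qed (use k l letters in auto)
    moreover have "cc k l = 1" using 3 by (simp only: cc_def if_False)
    ultimately show ?thesis
      using k l by (simp add: T.qcomm_def nf_gen_def cl_monom_mult letters nf_scalar_def)
  qed
qed

text \<open>The inverse generators are covered by \<open>commute_inverse\<close>.\<close>

lemma central_if_commutes_X:
  assumes z: "z \<in> carrier T" and comm: "\<And>k. k \<in> {1..n} \<Longrightarrow> z \<otimes>\<^bsub>T\<^esub> gX k = gX k \<otimes>\<^bsub>T\<^esub> z"
  shows "T.central z"
proof (rule T.central_if_commutes_gen[OF z])
  fix l assume "l \<in> nf_letters n"
  then consider k where "k \<in> {1..n}" "l = Tgen k" | k where "k \<in> {1..n}" "l = Tinv k"
    by (auto simp: nf_letters_def)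
  then show "z \<otimes>\<^bsub>T\<^esub> cl (fmonom 1 [l]) = cl (fmonom 1 [l]) \<otimes>\<^bsub>T\<^esub> z"
  proof cases
    case 1
    then show ?thesis using comm by (simp add: nf_gen_def)
  next
    case 2
    have "z \<otimes>\<^bsub>T\<^esub> gXi k = gXi k \<otimes>\<^bsub>T\<^esub> z"
      using T.commute_inverse[OF z X_closed Xi_closed X_Xi comm] 2 by blast
    then show ?thesis using 2 by (simp add: gXi_def)
  qed
qed

text \<open>Applied with \<open>d = m\<close> to every generator, and with
  \<open>d = m div h i\<close> to \<open>X\<^sub>i\<close> for \<open>i \<le> s\<close>, whose only
  commutation scalar different from 1 is \<open>q ^ h i\<close>.\<close>

lemma X_pow_central:
  assumes "k \<in> {1..n}" "\<And>l. l \<in> {1..n} \<Longrightarrow> cc k l ^ d = 1"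
  shows "T.central (gX k [^]\<^bsub>T\<^esub> d)"
  using assms by (intro central_if_commutes_X T.qcomm_pow_commute[OF _ _ X_qcomm]) simp_all

lemma X_pow_m_central: "k \<in> {1..n} \<Longrightarrow> T.central (gX k [^]\<^bsub>T\<^esub> m)"
  by (rule X_pow_central) (auto simp: cc_pow_m)

lemma Xi_pow_m_central:
  assumes k: "k \<in> {1..n}" shows "T.central (gXi k [^]\<^bsub>T\<^esub> m)"
proof (rule central_if_commutes_X)
  fix l assume l: "l \<in> {1..n}"
  have Xm: "gX k [^]\<^bsub>T\<^esub> m \<otimes>\<^bsub>T\<^esub> gXi k [^]\<^bsub>T\<^esub> m = \<one>\<^bsub>T\<^esub>" "gXi k [^]\<^bsub>T\<^esub> m \<otimes>\<^bsub>T\<^esub> gX k [^]\<^bsub>T\<^esub> m = \<one>\<^bsub>T\<^esub>"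
    using X_Xi[OF k] by (intro T.inverse_pow X_closed[OF k] Xi_closed[OF k]; simp)+
  have "gX l \<otimes>\<^bsub>T\<^esub> gXi k [^]\<^bsub>T\<^esub> m = gXi k [^]\<^bsub>T\<^esub> m \<otimes>\<^bsub>T\<^esub> gX l"
    using X_closed[OF k] Xi_closed[OF k]
    by (intro T.commute_inverse[OF X_closed[OF l] _ _ Xm T.centralD(2)[OF X_pow_m_central[OF k] X_closed[OF l], symmetric]])
      (rule T.nat_pow_closed, assumption)+
  then show "gXi k [^]\<^bsub>T\<^esub> m \<otimes>\<^bsub>T\<^esub> gX l = gX l \<otimes>\<^bsub>T\<^esub> gXi k [^]\<^bsub>T\<^esub> m" by simp
qed (use k in simp)

end

section \<open>Finite generation over the central \<open>m\<close>-th powers\<close>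

locale torus_module = torus n s m h q +
    N: simple_module_alg_closed "nf_torus n s h q" "nf_scalar n s h q" "nf_letters n"
      "\<lambda>l. pa_class (nf_letters n) (nf_rels n s h q) (fmonom 1 [l])" N
  for n s m h and q :: "'k::alg_closed_field" and N :: "((torus_letter list \<Rightarrow> 'k) set, 'v, 'y) rmodule_scheme"
begin

text \<open>The inverse powers are included so that the span over \<open>Y\<close> also absorbs the
  inverses of the generators.\<close>

definition Y :: "(torus_letter list \<Rightarrow> 'k) set set" where
  "Y = (\<lambda>k. gX k [^]\<^bsub>T\<^esub> m) ` {1..n} \<union> (\<lambda>k. gXi k [^]\<^bsub>T\<^esub> m) ` {1..n}"

lemma Y_central: "y \<in> Y \<Longrightarrow> T.central y"
  by (auto simp: Y_def X_pow_m_central Xi_pow_m_central)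

definition Yclosed :: "'v set \<Rightarrow> bool" where
  "Yclosed U \<longleftrightarrow> additive_subgroup U N \<and> (\<forall>v\<in>U. \<forall>c. v \<cdot>\<^bsub>N\<^esub> sc c \<in> U) \<and> (\<forall>v\<in>U. \<forall>y\<in>Y. v \<cdot>\<^bsub>N\<^esub> y \<in> U)"

text \<open>The span of \<open>G\<close> over the algebra generated by \<open>Y\<close>, as an
  intersection; inclusions are then proved by exhibiting a closed set.\<close>

definition Yhull :: "'v set \<Rightarrow> 'v set" where
  "Yhull G = \<Inter>{U. Yclosed U \<and> G \<subseteq> U}"

lemma Yclosed_carrier: "Yclosed (carrier N)"
  unfolding Yclosed_def
  using N.N.ract_closed T.centralD(1)[OF Y_central] by (auto intro!: additive_subgroupI N.N.M.add.subgroup_self)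

lemma Yclosed_Yhull:
  assumes "G \<subseteq> carrier N"
  shows "Yclosed (Yhull G)"
proof -
  have sub: "subgroup (Yhull G) (add_monoid N)"
    unfolding Yhull_def
    by (rule N.N.M.add.subgroups_Inter)
       (use assms Yclosed_carrier in \<open>auto simp: Yclosed_def intro: additive_subgroup.a_subgroup\<close>)
  then show ?thesis
    unfolding Yclosed_def by (auto intro!: additive_subgroupI) (auto simp: Yhull_def Yclosed_def)
qed

lemma Yhull_superset: "G \<subseteq> Yhull G"
  by (auto simp: Yhull_def)

lemma Yhull_carrier: "G \<subseteq> carrier N \<Longrightarrow> Yhull G \<subseteq> carrier N"
  using Yclosed_carrier by (auto simp: Yhull_def)

lemma Yhull_least: "Yclosed U \<Longrightarrow> G \<subseteq> U \<Longrightarrow> Yhull G \<subseteq> U"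
  by (auto simp: Yhull_def)

text \<open>Scalars and \<open>Y\<close> are central, so the vectors that \<open>t\<close> sends
  into \<open>Yhull G'\<close> form a closed set, and it suffices that it contains
  \<open>G\<close>.\<close>

lemma Yhull_ract:
  assumes G: "G \<subseteq> carrier N" "G' \<subseteq> carrier N" and t: "t \<in> carrier T"
    and gens: "\<And>g. g \<in> G \<Longrightarrow> g \<cdot>\<^bsub>N\<^esub> t \<in> Yhull G'" and v: "v \<in> Yhull G"
  shows "v \<cdot>\<^bsub>N\<^esub> t \<in> Yhull G'"
proof -
  let ?U = "{v \<in> carrier N. v \<cdot>\<^bsub>N\<^esub> t \<in> Yhull G'}"
  have Y': "Yclosed (Yhull G')" by (rule Yclosed_Yhull[OF G(2)])
  then interpret H: additive_subgroup "Yhull G'" N by (simp add: Yclosed_def)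
  have "Yclosed ?U"
    unfolding Yclosed_def
  proof (intro conjI ballI allI)
    show "additive_subgroup ?U N"
      by (intro additive_subgroupI N.N.M.add.subgroupI)
         (use t H.zero_closed in \<open>auto simp: N.N.ract_add_left N.N.ract_uminus_left N.N.ract_zero_left
            intro!: exI[of _ "\<zero>\<^bsub>N\<^esub>"]\<close>)
    fix v assume v: "v \<in> ?U"
    have swap: "v \<cdot>\<^bsub>N\<^esub> z \<in> ?U" if z: "T.central z" and "v \<cdot>\<^bsub>N\<^esub> t \<cdot>\<^bsub>N\<^esub> z \<in> Yhull G'" for z
    proof -
      have "v \<cdot>\<^bsub>N\<^esub> z \<cdot>\<^bsub>N\<^esub> t = v \<cdot>\<^bsub>N\<^esub> t \<cdot>\<^bsub>N\<^esub> z"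
        using v t T.centralD[OF z] N.N.ract_mult[of v z t] N.N.ract_mult[of v t z] by simp
      then show ?thesis using that v T.centralD[OF z] N.N.ract_closed by simp
    qed
    show "v \<cdot>\<^bsub>N\<^esub> sc c \<in> ?U" for c
      using swap[OF T.central_sc] v Y' by (auto simp: Yclosed_def)
    show "v \<cdot>\<^bsub>N\<^esub> y \<in> ?U" if "y \<in> Y" for y
      using swap[OF Y_central[OF that]] v Y' that by (auto simp: Yclosed_def)
  qed
  then have "Yhull G \<subseteq> ?U"
    using Yhull_least[of ?U G] gens G by auto
  then show ?thesis using v by blast
qed

text \<open>The translates of \<open>v\<close> by ordered monomials in the first \<open>k\<close>
  generators, with exponents below \<open>m\<close>; higher exponents are absorbed by
  \<open>Y\<close>.\<close>

fun mons :: "'v \<Rightarrow> nat \<Rightarrow> 'v set" where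
  "mons v 0 = {v}"
| "mons v (Suc k) = (\<Union>a<m. (\<lambda>g. g \<cdot>\<^bsub>N\<^esub> (gX (Suc k) [^]\<^bsub>T\<^esub> a)) ` mons v k)"

lemma mons_finite: "finite (mons v k)"
  by (induction k) auto

lemma mons_carrier: "v \<in> carrier N \<Longrightarrow> k \<le> n \<Longrightarrow> mons v k \<subseteq> carrier N"
proof (induction k)
  case (Suc k)
  then have "gX (Suc k) [^]\<^bsub>T\<^esub> a \<in> carrier T" for a :: nat by simp
  then show ?case using Suc N.N.ract_closed by auto
qed simp

text \<open>Normal ordering: a generator with smaller index is moved to the left of the last power
  at the cost of a scalar, where the induction hypothesis takes over; the last generator itself only
  raises its exponent.\<close>

lemma Yhull_mons_closed:
  assumes v: "v \<in> carrier N" and "k \<le> n" "l \<in> {1..k}" "w \<in> Yhull (mons v k)"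
  shows "w \<cdot>\<^bsub>N\<^esub> gX l \<in> Yhull (mons v k)"
  using assms(2-)
proof (induction k arbitrary: l w)
  case (Suc k)
  have G: "mons v k \<subseteq> carrier N" "mons v (Suc k) \<subseteq> carrier N"
    by (rule mons_carrier[OF v]; use Suc.prems in simp)+
  have Sk: "Suc k \<in> {1..n}" and l: "l \<in> {1..n}" using Suc.prems by auto
  have Xa: "gX (Suc k) [^]\<^bsub>T\<^esub> a \<in> carrier T" for a :: nat using Sk by simp
  have H: "Yclosed (Yhull (mons v (Suc k)))" by (rule Yclosed_Yhull[OF G(2)])
  have mem: "g \<cdot>\<^bsub>N\<^esub> (gX (Suc k) [^]\<^bsub>T\<^esub> a) \<in> mons v (Suc k)" if "a < m" "g \<in> mons v k" for a g
    using that by auto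
  have in_hull: "u \<cdot>\<^bsub>N\<^esub> (gX (Suc k) [^]\<^bsub>T\<^esub> a) \<in> Yhull (mons v (Suc k))" if "a < m" "u \<in> Yhull (mons v k)" for a u
    by (rule Yhull_ract[OF G Xa _ that(2)]) (intro subsetD[OF Yhull_superset] mem that(1))
  show ?case
  proof (rule Yhull_ract[OF G(2) G(2) X_closed[OF l] _ Suc.prems(3)])
    fix g' assume "g' \<in> mons v (Suc k)"
    then obtain a g where a: "a < m" "g \<in> mons v k" "g' = g \<cdot>\<^bsub>N\<^esub> (gX (Suc k) [^]\<^bsub>T\<^esub> a)" by auto
    have g: "g \<in> carrier N" using a G by auto
    show "g' \<cdot>\<^bsub>N\<^esub> gX l \<in> Yhull (mons v (Suc k))"
    proof (cases "l = Suc k")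
      case True
      have eq: "g' \<cdot>\<^bsub>N\<^esub> gX l = g \<cdot>\<^bsub>N\<^esub> (gX (Suc k) [^]\<^bsub>T\<^esub> Suc a)"
        using g Xa Sk by (simp add: a True N.N.ract_mult)
      show ?thesis
      proof (cases "Suc a < m")
        case True
        then show ?thesis
          unfolding eq by (intro subsetD[OF Yhull_superset] mem a(2))
      next
        \<comment> \<open>The exponent has reached \<open>m\<close>. The \<open>m\<close>-th power
          belongs to \<open>Y\<close>, and \<open>g\<close> is itself a monomial, with last exponent
          0.\<close>
        case False
        then have "Suc a = m" using a by simp
        moreover have "g \<in> Yhull (mons v (Suc k))"
          using subsetD[OF Yhull_superset mem[of 0 g]] m_pos a(2) g by (simp add: N.N.ract_one)
        ultimately show ?thesis
          unfolding eq using H Sk by (auto simp: Yclosed_def Y_def)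
      qed
    next
      case False
      then have lk: "l \<in> {1..k}" using Suc.prems by auto
      let ?c = "cc (Suc k) l ^ a"
      have "gX (Suc k) [^]\<^bsub>T\<^esub> a \<otimes>\<^bsub>T\<^esub> gX l = gX l \<otimes>\<^bsub>T\<^esub> gX (Suc k) [^]\<^bsub>T\<^esub> a \<otimes>\<^bsub>T\<^esub> sc ?c"
        using T.qcomm_pow[OF _ _ X_qcomm[OF Sk l], of a] Sk l T.sc_comm
        by (simp add: T.qcomm_def)
      moreover have "g' \<cdot>\<^bsub>N\<^esub> gX l = g \<cdot>\<^bsub>N\<^esub> (gX (Suc k) [^]\<^bsub>T\<^esub> a \<otimes>\<^bsub>T\<^esub> gX l)"
        using g Xa l by (simp add: a N.N.ract_mult)
      ultimately have "g' \<cdot>\<^bsub>N\<^esub> gX l = g \<cdot>\<^bsub>N\<^esub> gX l \<cdot>\<^bsub>N\<^esub> (gX (Suc k) [^]\<^bsub>T\<^esub> a) \<cdot>\<^bsub>N\<^esub> sc ?c"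
        using g l Xa by (simp add: N.N.ract_mult N.N.ract_closed)
      moreover have "g \<cdot>\<^bsub>N\<^esub> gX l \<in> Yhull (mons v k)"
        using Suc.IH[OF _ lk] Suc.prems a Yhull_superset by auto
      ultimately show ?thesis
        using in_hull[OF a(1)] H by (simp add: Yclosed_def)
    qed
  qed
qed simp

text \<open>The hull of the monomial translates of one nonzero vector is stable under the whole
  torus, hence is all of the simple module.\<close>

lemma fin_gen_Y: "N.fin_gen Y"
proof -
  obtain v where v: "v \<in> carrier N" "v \<noteq> \<zero>\<^bsub>N\<^esub>" using N.nonzero_exists by blast
  let ?H = "Yhull (mons v n)"
  have G: "mons v n \<subseteq> carrier N" by (rule mons_carrier[OF v(1) order.refl])
  have H: "Yclosed ?H" by (rule Yclosed_Yhull[OF G])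
  have HX: "w \<cdot>\<^bsub>N\<^esub> gX k \<in> ?H" if "k \<in> {1..n}" "w \<in> ?H" for k w
    using Yhull_mons_closed[OF v(1) order.refl that] .
  have HXa: "w \<cdot>\<^bsub>N\<^esub> (gX k [^]\<^bsub>T\<^esub> a) \<in> ?H" if "k \<in> {1..n}" "w \<in> ?H" for k w and a :: nat
  proof (induction a)
    case 0
    have "w \<in> carrier N" using that Yhull_carrier[OF G] by auto
    then show ?case using that by (simp add: N.N.ract_one)
  next
    case (Suc a)
    have "w \<in> carrier N" using that Yhull_carrier[OF G] by auto
    then show ?case using HX[OF that(1) Suc] that(1) by (simp add: N.N.ract_mult)
  qed
  \<comment> \<open>An inverse generator is its own \<open>m\<close>-th power, an element of
    \<open>Y\<close>, times the power \<open>m - 1\<close> of the generator.\<close>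
  have HXi: "w \<cdot>\<^bsub>N\<^esub> gXi k \<in> ?H" if k: "k \<in> {1..n}" and w: "w \<in> ?H" for k w
  proof -
    have "gXi k [^]\<^bsub>T\<^esub> m = gXi k \<otimes>\<^bsub>T\<^esub> gXi k [^]\<^bsub>T\<^esub> (m - 1)"
      using T.nat_pow_Suc2[OF Xi_closed[OF k], of "m - 1"] m_pos by simp
    moreover have "gXi k [^]\<^bsub>T\<^esub> (m - 1) \<otimes>\<^bsub>T\<^esub> gX k [^]\<^bsub>T\<^esub> (m - 1) = \<one>\<^bsub>T\<^esub>"
      using X_Xi[OF k] k by (intro T.inverse_pow) simp_all
    ultimately have "gXi k = gXi k [^]\<^bsub>T\<^esub> m \<otimes>\<^bsub>T\<^esub> gX k [^]\<^bsub>T\<^esub> (m - 1)"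
      using k by (simp add: T.m_assoc)
    then have "w \<cdot>\<^bsub>N\<^esub> gXi k = w \<cdot>\<^bsub>N\<^esub> (gXi k [^]\<^bsub>T\<^esub> m) \<cdot>\<^bsub>N\<^esub> (gX k [^]\<^bsub>T\<^esub> (m - 1))"
      using k w Yhull_carrier[OF G] m_pos N.N.ract_mult[of w "gXi k [^]\<^bsub>T\<^esub> m" "gX k [^]\<^bsub>T\<^esub> (m - 1)"]
      by auto
    moreover have "w \<cdot>\<^bsub>N\<^esub> (gXi k [^]\<^bsub>T\<^esub> m) \<in> ?H"
      using H w k by (auto simp: Yclosed_def Y_def)
    ultimately show ?thesis using HXa[OF k] by simp
  qed
  have "right_submodule ?H T N"
  proof (rule T.submodule_if_closed_gen)
    fix w l assume "w \<in> ?H" "l \<in> nf_letters n"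
    then show "w \<cdot>\<^bsub>N\<^esub> cl (fmonom 1 [l]) \<in> ?H"
      using HX HXi by (auto simp: nf_letters_def nf_gen_def gXi_def)
  qed (use H in \<open>auto simp: Yclosed_def intro: N.N.right_module_axioms\<close>)
  moreover have "v \<in> mons v k" for k
  proof (induction k)
    case (Suc k)
    then show ?case using m_pos v by (auto simp: N.N.ract_one intro!: bexI[of _ 0] image_eqI[of _ _ v])
  qed simp
  ultimately have HN: "?H = carrier N"
    using N.submodule_cases[of ?H] v Yhull_superset by blast
  obtain gs where gs: "set gs = mons v n" using finite_list[OF mons_finite] by blast
  show ?thesis
    unfolding N.fin_gen_def
  proof (intro exI[of _ gs] conjI allI impI)
    show "set gs \<subseteq> carrier N" using gs G by simp
    fix U assume "additive_subgroup U N" "set gs \<subseteq> U" "\<forall>v\<in>U. \<forall>c. v \<cdot>\<^bsub>N\<^esub> sc c \<in> U"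
      "\<forall>v\<in>U. \<forall>y\<in>Y. v \<cdot>\<^bsub>N\<^esub> y \<in> U"
    then show "carrier N \<subseteq> U"
      using Yhull_least[of U "mons v n"] gs HN by (auto simp: Yclosed_def)
  qed
qed

text \<open>Adding \<open>z\<close> to the finite central set \<open>Y\<close> preserves finite
  generation, so the scalar action extends from \<open>Y\<close> to the entire centre.\<close>

lemma central_scalar:
  assumes z: "T.central z"
  shows "\<exists>c. \<forall>v\<in>carrier N. v \<cdot>\<^bsub>N\<^esub> z = v \<cdot>\<^bsub>N\<^esub> sc c"
proof (rule N.central_acts_as_scalar[of "insert z Y"])
  show "N.fin_gen (insert z Y)" by (rule N.fin_gen_mono[OF fin_gen_Y]) auto
qed (use z Y_central in \<open>auto simp: Y_def\<close>)

end

section \<open>Weight vectors\<close>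

context simple_module_alg_closed
begin

text \<open>The minimal polynomial of a vector: since \<open>t ^ d\<close> acts on \<open>v\<close>
  by a scalar, a nonzero polynomial in \<open>t\<close> kills \<open>v\<close>. Splitting a linear
  factor off one of least degree leaves a nonzero vector killed by that factor. The subspace
  \<open>W\<close> allows the search to stay inside an eigenspace of other operators.\<close>

lemma exists_eigenvector:
  assumes W: "additive_subgroup W N" "\<And>w c. w \<in> W \<Longrightarrow> w \<cdot>\<^bsub>N\<^esub> sc c \<in> W" "\<And>w. w \<in> W \<Longrightarrow> w \<cdot>\<^bsub>N\<^esub> t \<in> W"
    and t: "t \<in> carrier T" and v: "v \<in> W" "v \<noteq> \<zero>\<^bsub>N\<^esub>" and d: "(d::nat) > 0"
    and pow: "v \<cdot>\<^bsub>N\<^esub> (t [^]\<^bsub>T\<^esub> d) = v \<cdot>\<^bsub>N\<^esub> sc \<mu>"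
  shows "\<exists>u\<in>W. \<exists>\<rho>. u \<noteq> \<zero>\<^bsub>N\<^esub> \<and> u \<cdot>\<^bsub>N\<^esub> t = u \<cdot>\<^bsub>N\<^esub> sc \<rho>"
proof -
  interpret W: additive_subgroup W N by (rule W)
  have vN: "v \<in> carrier N" using v W.a_subset by auto
  \<comment> \<open>\<open>A p\<close> is \<open>v\<close> acted on by \<open>p(t)\<close>, computed
    by Horner's scheme.\<close>
  define A where "A p = fold_coeffs (\<lambda>c w. v \<cdot>\<^bsub>N\<^esub> sc c \<oplus>\<^bsub>N\<^esub> w \<cdot>\<^bsub>N\<^esub> t) p \<zero>\<^bsub>N\<^esub>" for p
  have A0: "A 0 = \<zero>\<^bsub>N\<^esub>" by (simp add: A_def)
  have ApCons: "A (pCons c p) = v \<cdot>\<^bsub>N\<^esub> sc c \<oplus>\<^bsub>N\<^esub> A p \<cdot>\<^bsub>N\<^esub> t" for c p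
  \<comment> \<open>\<open>pCons 0 0\<close> is the zero polynomial, on which
    \<open>fold_coeffs\<close> makes no step, so this case is separate.\<close>
  proof (cases "c = 0 \<and> p = 0")
    case True
    then show ?thesis
      using vN t by (simp add: A0 T.sc_zero N.ract_zero_right N.ract_zero_left)
  qed (auto simp: A_def)
  have AW: "A p \<in> W" for p
    by (induction p) (auto simp: A0 ApCons W.zero_closed intro!: W.a_closed W v)
  have AN: "A p \<in> carrier N" for p
    using AW W.a_subset by auto
  have A_add: "A (p + p') = A p \<oplus>\<^bsub>N\<^esub> A p'" for p p'
  proof (induction p arbitrary: p')
    case (pCons c p)
    obtain c' r where p': "p' = pCons c' r" by (cases p') auto
    have "A (pCons c p + p') = (v \<cdot>\<^bsub>N\<^esub> sc c \<oplus>\<^bsub>N\<^esub> v \<cdot>\<^bsub>N\<^esub> sc c') \<oplus>\<^bsub>N\<^esub> (A p \<cdot>\<^bsub>N\<^esub> t \<oplus>\<^bsub>N\<^esub> A r \<cdot>\<^bsub>N\<^esub> t)"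
      using vN t by (simp add: p' ApCons pCons.IH T.sc_add N.ract_add_right N.ract_add_left AN)
    then show ?case
      using vN t by (simp add: p' ApCons N.M.a_ac AN N.ract_closed)
  qed (simp add: A0 AN)
  have A_smult: "A (smult a p) = A p \<cdot>\<^bsub>N\<^esub> sc a" for a p
  proof (induction p)
    case (pCons c p)
    have "A p \<cdot>\<^bsub>N\<^esub> sc a \<cdot>\<^bsub>N\<^esub> t = A p \<cdot>\<^bsub>N\<^esub> t \<cdot>\<^bsub>N\<^esub> sc a"
      using AN[of p] t T.sc_comm[OF t, of a] N.ract_mult[OF AN[of p]] by (metis T.sc_closed)
    moreover have "v \<cdot>\<^bsub>N\<^esub> sc (a * c) = v \<cdot>\<^bsub>N\<^esub> sc c \<cdot>\<^bsub>N\<^esub> sc a"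
      using vN by (simp add: mult.commute[of a] T.sc_mult N.ract_mult)
    ultimately show ?case
      using vN t by (simp add: ApCons pCons.IH N.ract_add_left AN N.ract_closed)
  qed (simp add: A0 N.ract_zero_left)
  have A_monom: "A (monom 1 k) = v \<cdot>\<^bsub>N\<^esub> (t [^]\<^bsub>T\<^esub> k)" for k
  proof (induction k)
    case 0
    then show ?case
      using vN t by (simp add: monom_0 ApCons A0 T.sc_one N.ract_one N.ract_zero_left)
  next
    case (Suc k)
    then show ?case
      using vN t by (simp add: monom_Suc ApCons T.sc_zero N.ract_zero_right N.ract_mult N.ract_closed)
  qed
  define p0 where "p0 = monom 1 d + [:- \<mu>:]"
  have "A p0 = v \<cdot>\<^bsub>N\<^esub> sc \<mu> \<oplus>\<^bsub>N\<^esub> v \<cdot>\<^bsub>N\<^esub> sc (- \<mu>)"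
    using vN t by (simp add: p0_def A_add A_monom pow ApCons A0 N.ract_zero_left N.ract_closed)
  also have "\<dots> = v \<cdot>\<^bsub>N\<^esub> sc (\<mu> + (- \<mu>))"
    using vN by (simp only: T.sc_add N.ract_add_right T.sc_closed)
  also have "\<dots> = \<zero>\<^bsub>N\<^esub>"
    using vN by (simp add: T.sc_zero N.ract_zero_right)
  finally have Ap0: "A p0 = \<zero>\<^bsub>N\<^esub>" .
  have "coeff p0 d = 1" using d by (cases d) (auto simp: p0_def)
  then have "p0 \<noteq> 0" by auto
  then obtain p where p: "p \<noteq> 0" "A p = \<zero>\<^bsub>N\<^esub>" and p_min: "\<And>r. r \<noteq> 0 \<Longrightarrow> A r = \<zero>\<^bsub>N\<^esub> \<Longrightarrow> degree p \<le> degree r"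
    using Ap0 ex_has_least_nat[of "\<lambda>p. p \<noteq> 0 \<and> A p = \<zero>\<^bsub>N\<^esub>" p0 degree] by blast
  have "degree p > 0"
  proof (rule ccontr)
    assume "\<not> degree p > 0"
    then obtain c where c: "p = [:c:]" by (metis degree_eq_zeroE not_gr_zero)
    then have "v \<cdot>\<^bsub>N\<^esub> sc c = \<zero>\<^bsub>N\<^esub>"
      using p vN t by (simp add: ApCons A0 N.ract_zero_left N.ract_closed)
    then have "v \<cdot>\<^bsub>N\<^esub> sc c \<cdot>\<^bsub>N\<^esub> sc (inverse c) = \<zero>\<^bsub>N\<^esub>"
      by (simp add: N.ract_zero_left)
    moreover have "v \<cdot>\<^bsub>N\<^esub> sc c \<cdot>\<^bsub>N\<^esub> sc (inverse c) = v"
      using p c vN by (simp add: T.sc_one N.ract_one flip: N.ract_mult T.sc_mult)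
    ultimately show False using v by simp
  qed
  then obtain \<rho> where "poly p \<rho> = 0" using alg_closed_imp_poly_has_root by blast
  then obtain r where r: "p = [:- \<rho>, 1:] * r" using poly_eq_0_iff_dvd by (auto simp: dvd_def)
  have r0: "r \<noteq> 0" using p r by auto
  have "A r \<noteq> \<zero>\<^bsub>N\<^esub>"
  proof
    assume "A r = \<zero>\<^bsub>N\<^esub>"
    then have "degree p \<le> degree r" using p_min r0 by blast
    moreover have "degree p = Suc (degree r)" using r0 by (subst r, subst degree_mult_eq) auto
    ultimately show False by simp
  qed
  moreover have "A r \<cdot>\<^bsub>N\<^esub> t = A r \<cdot>\<^bsub>N\<^esub> sc \<rho>"
  proof -
    have pr: "p + smult \<rho> r = pCons 0 r" by (simp add: r)
    have "A (p + smult \<rho> r) = A r \<cdot>\<^bsub>N\<^esub> sc \<rho>"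
      using AN by (simp add: A_add p A_smult N.ract_closed)
    moreover have "A (pCons 0 r) = A r \<cdot>\<^bsub>N\<^esub> t"
      using vN t AN by (simp add: ApCons T.sc_zero N.ract_zero_right N.ract_closed)
    ultimately show ?thesis using pr by simp
  qed
  ultimately show ?thesis using AW by blast
qed

end

section \<open>The commuting products \<open>D i\<close>, the index set and its shifts\<close>

context torus
begin

text \<open>These act diagonally on \<open>M(\<alpha>)\<close>, with eigenvalue
  \<open>\<alpha> (i + s) * (q ^ h i) ^ a i\<close> at index \<open>a\<close>. They play the part of
  a Cartan subalgebra: they provide a weight vector in \<open>N\<close> and separate the basis
  vectors of \<open>M(\<alpha>)\<close>.\<close>

definition D :: "nat \<Rightarrow> (torus_letter list \<Rightarrow> 'k) set" where
  "D i = gX i \<otimes>\<^bsub>T\<^esub> gX (i + s)"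

lemma ix: "i \<in> {1..s} \<Longrightarrow> i \<in> {1..n} \<and> i + s \<in> {1..n}"
  using s_le by auto

lemma D_closed: "i \<in> {1..s} \<Longrightarrow> D i \<in> carrier T"
  using ix by (simp add: D_def del: atLeastAtMost_iff)

lemma D_qcomm:
  assumes i: "i \<in> {1..s}" and k: "k \<in> {1..n}"
  shows "T.qcomm (cc i k * cc (i + s) k) (D i) (gX k)"
  unfolding D_def using ix[OF i] k by (intro T.qcomm_mult X_qcomm X_closed) auto

text \<open>The scalars by which \<open>D j\<close> fails to commute with the two factors of
  \<open>D i\<close> are inverse to each other.\<close>

lemma D_commute:
  assumes i: "i \<in> {1..s}" and j: "j \<in> {1..s}"
  shows "D i \<otimes>\<^bsub>T\<^esub> D j = D j \<otimes>\<^bsub>T\<^esub> D i"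
proof -
  note c = ix[OF i] ix[OF j]
  have "T.qcomm (cc j i * cc (j + s) i) (D j) (gX i)" "T.qcomm (cc j (i + s) * cc (j + s) (i + s)) (D j) (gX (i + s))"
    using c by (auto intro!: D_qcomm j)
  note q = this
  have nz: "cc j i * cc (j + s) i \<noteq> 0" "cc j (i + s) * cc (j + s) (i + s) \<noteq> 0"
    using cc_nonzero by simp_all
  have "T.qcomm (inverse (cc j i * cc (j + s) i)) (gX i) (D j)"
    "T.qcomm (inverse (cc j (i + s) * cc (j + s) (i + s))) (gX (i + s)) (D j)"
    using T.qcomm_sym[OF D_closed[OF j] X_closed q(1) nz(1)] T.qcomm_sym[OF D_closed[OF j] X_closed q(2) nz(2)] c
    by simp_all
  then have "T.qcomm (inverse (cc j i * cc (j + s) i) * inverse (cc j (i + s) * cc (j + s) (i + s))) (D i) (D j)"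
    unfolding D_def[of i] using c D_closed[OF j] by (intro T.qcomm_mult) auto
  moreover have "inverse (cc j i * cc (j + s) i) * inverse (cc j (i + s) * cc (j + s) (i + s)) = 1"
    using i j q_nonzero by (auto simp: cc_def)
  ultimately show ?thesis
    using D_closed i j by (simp add: T.qcomm_1_iff)
qed

lemma D_pow_m_central:
  assumes "i \<in> {1..s}" shows "T.central (D i [^]\<^bsub>T\<^esub> m)"
proof (rule central_if_commutes_X)
  fix k assume k: "k \<in> {1..n}"
  show "D i [^]\<^bsub>T\<^esub> m \<otimes>\<^bsub>T\<^esub> gX k = gX k \<otimes>\<^bsub>T\<^esub> D i [^]\<^bsub>T\<^esub> m"
    by (rule T.qcomm_pow_commute[OF D_closed[OF assms] X_closed[OF k] D_qcomm[OF assms k]])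
       (simp add: power_mult_distrib cc_pow_m)
qed (use D_closed[OF assms] in simp)

text \<open>Consequently \<open>X\<^sub>i\<close> multiplies the \<open>D i\<close>-eigenvalue of a
  vector by \<open>q ^ h i\<close>, and the other generators \<open>X\<^sub>k\<close> with
  \<open>k \<le> s\<close> preserve it.\<close>

lemma X_D_qcomm:
  assumes i: "i \<in> {1..s}" and k: "k \<in> {1..s}"
  shows "T.qcomm (if k = i then q ^ h i else 1) (gX k) (D i)"
proof -
  have "T.qcomm (inverse (cc i k * cc (i + s) k)) (gX k) (D i)"
    using ix[OF k] D_closed[OF i] cc_nonzero by (intro T.qcomm_sym D_qcomm i) auto
  moreover have "inverse (cc i k * cc (i + s) k) = (if k = i then q ^ h i else 1)"
    using i k by (auto simp: cc_def)
  ultimately show ?thesis by simp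
qed

lemma h_div: "i \<in> {1..s} \<Longrightarrow> m div h i > 1 \<and> h i * (m div h i) = m"
  using h_facts[of i] by (auto elim!: dvdE)

lemma q_h_pow: "i \<in> {1..s} \<Longrightarrow> (q ^ h i) ^ a = 1 \<longleftrightarrow> m div h i dvd a"
proof -
  assume i: "i \<in> {1..s}"
  obtain c where c: "m = h i * c" using h_facts[OF i] by (auto elim: dvdE)
  then show "(q ^ h i) ^ a = 1 \<longleftrightarrow> m div h i dvd a"
    using q_order[of "h i * a"] h_facts[OF i] by (simp add: power_mult)
qed

text \<open>Makes the exponent \<open>a i - 1\<close> in the definition of
  \<open>M(\<alpha>)\<close> compatible with the wraparound of the index, including its value -1 at
  \<open>a i = 0\<close>.\<close>

lemma q_h_powi_mod:
  assumes "i \<in> {1..s}"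
  shows "(q ^ h i) powi (z mod int (m div h i)) = (q ^ h i) powi z"
proof -
  let ?K = "int (m div h i)"
  have "(q ^ h i) powi z = (q ^ h i) powi (?K * (z div ?K) + z mod ?K)" by simp
  also have "\<dots> = ((q ^ h i) powi ?K) powi (z div ?K) * (q ^ h i) powi (z mod ?K)"
    using q_nonzero by (subst power_int_add) (auto simp: power_int_mult)
  also have "(q ^ h i) powi ?K = 1"
    using q_h_pow[OF assms, of "m div h i"] by (simp add: power_int_of_nat)
  finally show ?thesis by simp
qed

text \<open>In \<open>M(\<alpha>)\<close> one has \<open>e(a) X\<^sub>k = co \<alpha> k a e(shiftv k a)\<close>.\<close>

definition shiftv :: "nat \<Rightarrow> (nat \<Rightarrow> nat) \<Rightarrow> nat \<Rightarrow> nat" where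
  "shiftv k a = (if k \<le> s then M_shift m h k 1 a else if k \<le> 2 * s then M_shift m h (k - s) (- 1) a else a)"

definition co :: "(nat \<Rightarrow> 'k) \<Rightarrow> nat \<Rightarrow> (nat \<Rightarrow> nat) \<Rightarrow> 'k" where
  "co \<alpha> k a = (if k \<le> s then \<alpha> k else if k \<le> 2 * s
     then inverse (\<alpha> (k - s)) * \<alpha> k * (q ^ h (k - s)) powi (int (a (k - s)) - 1) else \<alpha> k)"

abbreviation "idx \<equiv> M_index s m h"

lemma idx_less: "a \<in> idx \<Longrightarrow> i \<in> {1..s} \<Longrightarrow> a i < m div h i"
  by (auto simp: M_index_def PiE_def Pi_def)

lemma M_shift_closed: "a \<in> idx \<Longrightarrow> i \<in> {1..s} \<Longrightarrow> M_shift m h i z a \<in> idx"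
proof -
  assume a: "a \<in> idx" and i: "i \<in> {1..s}"
  have "int (m div h i) > 0" using h_div[OF i] by linarith
  then have "nat ((int (a i) + z) mod int (m div h i)) < m div h i"
    by (simp add: nat_less_iff)
  then show ?thesis
    using a i by (auto simp: M_index_def M_shift_def PiE_def Pi_def extensional_def)
qed

lemma M_shift_shift:
  assumes "a \<in> idx" "i \<in> {1..s}"
  shows "M_shift m h i z (M_shift m h i w a) = M_shift m h i (z + w) a"
proof -
  have "int (m div h i) > 0" using h_div[OF assms(2)] by linarith
  then show ?thesis
    by (simp add: M_shift_def mod_simps add_ac)
qed

lemma M_shift_0: "a \<in> idx \<Longrightarrow> i \<in> {1..s} \<Longrightarrow> M_shift m h i 0 a = a"
  using idx_less[of a i] by (simp add: M_shift_def)

lemma shiftv_bij: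
  assumes k: "k \<in> {1..n}"
  shows "bij_betw (shiftv k) idx idx"
proof -
  have sh: "bij_betw (M_shift m h i z) idx idx" if i: "i \<in> {1..s}" for i z
    by (rule bij_betw_byWitness[of _ "M_shift m h i (- z)"])
       (use i in \<open>auto simp: M_shift_closed M_shift_shift M_shift_0\<close>)
  consider "k \<in> {1..s}" | "k > s" "k - s \<in> {1..s}" "k \<le> 2 * s" | "k > 2 * s"
    using k by fastforce
  then show ?thesis
  proof cases
    case 1
    then show ?thesis using sh[OF 1, of 1] by (simp add: shiftv_def[abs_def])
  next
    case 2
    then show ?thesis using sh[OF 2(2), of "-1"] by (simp add: shiftv_def[abs_def])
  next
    case 3
    then show ?thesis by (simp add: shiftv_def[abs_def] bij_betw_def)
  qed
qed

lemma idx_finite: "finite idx"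
  by (simp add: M_index_def finite_PiE)

definition idx0 :: "nat \<Rightarrow> nat" where
  "idx0 = restrict (\<lambda>_. 0) {1..s}"

lemma idx0_in: "idx0 \<in> idx"
proof -
  have "0 < m div h i" if "i \<in> {1..s}" for i
    using h_div[OF that] by linarith
  then show ?thesis by (auto simp: idx0_def M_index_def)
qed

end

context torus_module
begin

text \<open>Induction on the number of operators. The common eigenspace \<open>W\<close> of the
  first \<open>j\<close> is stable under the next one, as they commute; the \<open>m\<close>-th
  power of the latter is central and thus acts by a scalar, so there is an eigenvector inside
  \<open>W\<close>.\<close>

lemma exists_common_eigenvector:
  "\<exists>v\<in>carrier N. \<exists>d. v \<noteq> \<zero>\<^bsub>N\<^esub> \<and> (\<forall>i\<in>{1..s}. v \<cdot>\<^bsub>N\<^esub> D i = v \<cdot>\<^bsub>N\<^esub> sc (d i))"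
proof -
  have "\<exists>v\<in>carrier N. \<exists>d. v \<noteq> \<zero>\<^bsub>N\<^esub> \<and> (\<forall>i\<in>{1..j}. v \<cdot>\<^bsub>N\<^esub> D i = v \<cdot>\<^bsub>N\<^esub> sc (d i))" if "j \<le> s" for j
    using that
  proof (induction j)
    case 0
    then show ?case using N.nonzero_exists by auto
  next
    case (Suc j)
    then obtain v d where v: "v \<in> carrier N" "v \<noteq> \<zero>\<^bsub>N\<^esub>" "\<forall>i\<in>{1..j}. v \<cdot>\<^bsub>N\<^esub> D i = v \<cdot>\<^bsub>N\<^esub> sc (d i)"
      by auto
    have Sj: "Suc j \<in> {1..s}" using Suc.prems by simp
    have Dc: "D i \<in> carrier T" if "i \<in> {1..Suc j}" for i
      using that Suc.prems D_closed by simp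
    define W where "W = {w\<in>carrier N. \<forall>i\<in>{1..j}. w \<cdot>\<^bsub>N\<^esub> D i = w \<cdot>\<^bsub>N\<^esub> sc (d i)}"
    have Wt: "w \<cdot>\<^bsub>N\<^esub> t \<in> W" if w: "w \<in> W" and t: "t \<in> carrier T"
      and comm: "\<And>i. i \<in> {1..j} \<Longrightarrow> t \<otimes>\<^bsub>T\<^esub> D i = D i \<otimes>\<^bsub>T\<^esub> t" for w t
      unfolding W_def
    proof (intro CollectI conjI ballI)
      have wN: "w \<in> carrier N" using w by (simp add: W_def)
      then show "w \<cdot>\<^bsub>N\<^esub> t \<in> carrier N" using t N.N.ract_closed by simp
      fix i assume i: "i \<in> {1..j}"
      then have Di: "D i \<in> carrier T" using Dc by simp
      have "w \<cdot>\<^bsub>N\<^esub> t \<cdot>\<^bsub>N\<^esub> D i = w \<cdot>\<^bsub>N\<^esub> D i \<cdot>\<^bsub>N\<^esub> t"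
        using N.N.ract_mult[OF wN t Di] N.N.ract_mult[OF wN Di t] comm[OF i] by simp
      also have "\<dots> = w \<cdot>\<^bsub>N\<^esub> sc (d i) \<cdot>\<^bsub>N\<^esub> t"
        using w i by (simp add: W_def)
      also have "\<dots> = w \<cdot>\<^bsub>N\<^esub> t \<cdot>\<^bsub>N\<^esub> sc (d i)"
        using N.N.ract_mult[OF wN t T.sc_closed] N.N.ract_mult[OF wN T.sc_closed t] T.sc_comm[OF t] by simp
      finally show "w \<cdot>\<^bsub>N\<^esub> t \<cdot>\<^bsub>N\<^esub> D i = w \<cdot>\<^bsub>N\<^esub> t \<cdot>\<^bsub>N\<^esub> sc (d i)" .
    qed
    have W: "additive_subgroup W N"
    proof (intro additive_subgroupI N.N.M.add.subgroupI)
      fix w assume w: "w \<in> W"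
      then show "\<ominus>\<^bsub>N\<^esub> w \<in> W"
        using Dc by (simp add: W_def N.N.ract_uminus_left)
      fix w' assume "w' \<in> W"
      then show "w \<oplus>\<^bsub>N\<^esub> w' \<in> W"
        using w Dc by (simp add: W_def N.N.ract_add_left)
    qed (use v in \<open>auto simp: W_def\<close>)
    obtain \<mu> where \<mu>: "\<forall>v\<in>carrier N. v \<cdot>\<^bsub>N\<^esub> (D (Suc j) [^]\<^bsub>T\<^esub> m) = v \<cdot>\<^bsub>N\<^esub> sc \<mu>"
      using central_scalar[OF D_pow_m_central[OF Sj]] by blast
    have "\<exists>u\<in>W. \<exists>\<rho>. u \<noteq> \<zero>\<^bsub>N\<^esub> \<and> u \<cdot>\<^bsub>N\<^esub> D (Suc j) = u \<cdot>\<^bsub>N\<^esub> sc \<rho>"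
    proof (rule N.exists_eigenvector[OF W])
      show "w \<cdot>\<^bsub>N\<^esub> sc c \<in> W" if "w \<in> W" for w c
        using that Dc by (intro Wt T.sc_comm) auto
      show "w \<cdot>\<^bsub>N\<^esub> D (Suc j) \<in> W" if "w \<in> W" for w
        using that Suc.prems by (intro Wt D_commute Dc) auto
      show "v \<in> W" using v by (simp add: W_def)
    qed (use v \<mu> m_pos Dc in auto)
    then obtain u \<rho> where u: "u \<in> W" "u \<noteq> \<zero>\<^bsub>N\<^esub>" "u \<cdot>\<^bsub>N\<^esub> D (Suc j) = u \<cdot>\<^bsub>N\<^esub> sc \<rho>" by blast
    show ?case
    proof (intro bexI[of _ u] exI[of _ "d(Suc j := \<rho>)"] conjI ballI)
      fix i assume "i \<in> {1..Suc j}"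
      then show "u \<cdot>\<^bsub>N\<^esub> D i = u \<cdot>\<^bsub>N\<^esub> sc ((d(Suc j := \<rho>)) i)"
        using u by (cases "i = Suc j") (auto simp: W_def)
    qed (use u in \<open>auto simp: W_def\<close>)
  qed
  then show ?thesis by blast
qed

lemma unit_acts_nonzero:
  assumes "v \<in> carrier N" "v \<noteq> \<zero>\<^bsub>N\<^esub>" "t \<in> carrier T" "t' \<in> carrier T" "t \<otimes>\<^bsub>T\<^esub> t' = \<one>\<^bsub>T\<^esub>"
  shows "v \<cdot>\<^bsub>N\<^esub> t \<noteq> \<zero>\<^bsub>N\<^esub>"
  using assms N.N.ract_mult[of v t t'] N.N.ract_zero_left[of t'] N.N.ract_one by metis

lemma unit_scalar_nonzero:
  assumes "v \<in> carrier N" "v \<noteq> \<zero>\<^bsub>N\<^esub>" "t \<in> carrier T" "t' \<in> carrier T" "t \<otimes>\<^bsub>T\<^esub> t' = \<one>\<^bsub>T\<^esub>"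
    and "v \<cdot>\<^bsub>N\<^esub> t = v \<cdot>\<^bsub>N\<^esub> sc c"
  shows "c \<noteq> 0"
  using unit_acts_nonzero[OF assms(1-5)] assms(1,6) N.N.ract_zero_right T.sc_zero by auto

text \<open>This fixes the parameters: \<open>\<alpha> i\<close> is a root of the scalar of a
  central power of \<open>X\<^sub>i\<close>, \<open>\<alpha> (i + s)\<close> is the eigenvalue of
  \<open>D i\<close> on \<open>v\<close>, and for \<open>k > 2 * s\<close> the generator is itself
  central. All are nonzero because units of the torus kill no nonzero vector.\<close>

lemma exists_weight_vector:
  obtains \<alpha> v where "\<alpha> \<in> Kstar n" "v \<in> carrier N" "v \<noteq> \<zero>\<^bsub>N\<^esub>"
    "\<And>i. i \<in> {1..s} \<Longrightarrow> v \<cdot>\<^bsub>N\<^esub> D i = v \<cdot>\<^bsub>N\<^esub> sc (\<alpha> (i + s))"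
    "\<And>i w. i \<in> {1..s} \<Longrightarrow> w \<in> carrier N \<Longrightarrow> w \<cdot>\<^bsub>N\<^esub> (gX i [^]\<^bsub>T\<^esub> (m div h i)) = w \<cdot>\<^bsub>N\<^esub> sc (\<alpha> i ^ (m div h i))"
    "\<And>k w. k \<in> {2 * s<..n} \<Longrightarrow> w \<in> carrier N \<Longrightarrow> w \<cdot>\<^bsub>N\<^esub> gX k = w \<cdot>\<^bsub>N\<^esub> sc (\<alpha> k)"
proof -
  obtain v d where v: "v \<in> carrier N" "v \<noteq> \<zero>\<^bsub>N\<^esub>" and d: "\<forall>i\<in>{1..s}. v \<cdot>\<^bsub>N\<^esub> D i = v \<cdot>\<^bsub>N\<^esub> sc (d i)"
    using exists_common_eigenvector by blast
  have "\<exists>c. \<forall>w\<in>carrier N. w \<cdot>\<^bsub>N\<^esub> (gX i [^]\<^bsub>T\<^esub> (m div h i)) = w \<cdot>\<^bsub>N\<^esub> sc c" if i: "i \<in> {1..s}" for i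
  proof (rule central_scalar, rule X_pow_central)
    show "i \<in> {1..n}" using ix[OF i] by blast
    fix l
    have "(q ^ h i) ^ (m div h i) = 1" using q_h_pow[OF i] by simp
    moreover have "\<not> (l \<in> {1..s} \<and> i = l + s)" using i by auto
    ultimately show "cc i l ^ (m div h i) = 1" by (auto simp: cc_def)
  qed
  then obtain e where e: "\<And>i w. i \<in> {1..s} \<Longrightarrow> w \<in> carrier N \<Longrightarrow> w \<cdot>\<^bsub>N\<^esub> (gX i [^]\<^bsub>T\<^esub> (m div h i)) = w \<cdot>\<^bsub>N\<^esub> sc (e i)"
    by metis
  have "\<exists>c. \<forall>w\<in>carrier N. w \<cdot>\<^bsub>N\<^esub> gX k = w \<cdot>\<^bsub>N\<^esub> sc c" if k: "k \<in> {2 * s<..n}" for k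
  proof (rule central_scalar, rule central_if_commutes_X)
    have kn: "k \<in> {1..n}" using k by auto
    then show "gX k \<in> carrier T" by simp
    fix l assume l: "l \<in> {1..n}"
    have "cc k l = 1" using k by (auto simp: cc_def)
    then show "gX k \<otimes>\<^bsub>T\<^esub> gX l = gX l \<otimes>\<^bsub>T\<^esub> gX k"
      using X_qcomm[OF kn l] X_closed[OF kn] X_closed[OF l] by (simp add: T.qcomm_1_iff)
  qed
  then obtain f where f: "\<And>k w. k \<in> {2 * s<..n} \<Longrightarrow> w \<in> carrier N \<Longrightarrow> w \<cdot>\<^bsub>N\<^esub> gX k = w \<cdot>\<^bsub>N\<^esub> sc (f k)"
    by metis
  have "\<exists>r. r ^ (m div h i) = e i" if i: "i \<in> {1..s}" for i
    using h_div[OF i] nth_root_exists[of "m div h i" "e i"] by auto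
  then obtain r where r: "\<And>i. i \<in> {1..s} \<Longrightarrow> r i ^ (m div h i) = e i" by metis
  have e0: "e i \<noteq> 0" if i: "i \<in> {1..s}" for i
  proof -
    have k: "i \<in> {1..n}" using ix[OF i] by blast
    have "gX i [^]\<^bsub>T\<^esub> (m div h i) \<otimes>\<^bsub>T\<^esub> gXi i [^]\<^bsub>T\<^esub> (m div h i) = \<one>\<^bsub>T\<^esub>"
      using X_Xi[OF k] by (intro T.inverse_pow X_closed[OF k] Xi_closed[OF k])
    then show ?thesis
      by (intro unit_scalar_nonzero[OF v _ _ _ e[OF i v(1)]]) (use k in \<open>simp_all\<close>)
  qed
  have f0: "f k \<noteq> 0" if k: "k \<in> {2 * s<..n}" for k
    using unit_scalar_nonzero[OF v X_closed Xi_closed X_Xi(1) f[OF k v(1)]] k by simp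
  have d0: "d i \<noteq> 0" if i: "i \<in> {1..s}" for i
  proof -
    have c: "gX i \<in> carrier T" "gX (i + s) \<in> carrier T" "gXi i \<in> carrier T" "gXi (i + s) \<in> carrier T"
      using ix[OF i] by simp_all
    have "D i \<otimes>\<^bsub>T\<^esub> (gXi (i + s) \<otimes>\<^bsub>T\<^esub> gXi i) = gX i \<otimes>\<^bsub>T\<^esub> (gX (i + s) \<otimes>\<^bsub>T\<^esub> gXi (i + s)) \<otimes>\<^bsub>T\<^esub> gXi i"
      using c by (simp add: D_def T.m_assoc)
    also have "\<dots> = \<one>\<^bsub>T\<^esub>" using c X_Xi(1)[of i] X_Xi(1)[of "i + s"] ix[OF i] by simp
    finally show ?thesis
      by (intro unit_scalar_nonzero[OF v D_closed[OF i] _ _ d[rule_format, OF i]]) (use c in simp_all)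
  qed
  define \<alpha> where "\<alpha> = (\<lambda>k\<in>{1..n}. if k \<le> s then r k else if k \<le> 2 * s then d (k - s) else f k)"
  show ?thesis
  proof (rule that[OF _ v])
    have "r k \<noteq> 0" if "k \<in> {1..s}" for k
      using e0[OF that] r[OF that] h_div[OF that] by (auto simp: power_0_left)
    moreover have "d (k - s) \<noteq> 0" if "\<not> k \<le> s" "k \<le> 2 * s" for k
      by (rule d0) (use that in auto)
    ultimately show "\<alpha> \<in> Kstar n"
      using f0 by (auto simp: Kstar_def \<alpha>_def split: if_splits)
    show "v \<cdot>\<^bsub>N\<^esub> D i = v \<cdot>\<^bsub>N\<^esub> sc (\<alpha> (i + s))" if i: "i \<in> {1..s}" for i
    proof -
      have "\<alpha> (i + s) = d i" using i s_le by (auto simp: \<alpha>_def)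
      then show ?thesis using d i by simp
    qed
    show "w \<cdot>\<^bsub>N\<^esub> (gX i [^]\<^bsub>T\<^esub> (m div h i)) = w \<cdot>\<^bsub>N\<^esub> sc (\<alpha> i ^ (m div h i))" if i: "i \<in> {1..s}" and w: "w \<in> carrier N" for i w
    proof -
      have "\<alpha> i = r i" using i s_le by (auto simp: \<alpha>_def)
      then show ?thesis using e[OF i w] r[OF i] by simp
    qed
    show "w \<cdot>\<^bsub>N\<^esub> gX k = w \<cdot>\<^bsub>N\<^esub> sc (\<alpha> k)" if k: "k \<in> {2 * s<..n}" and w: "w \<in> carrier N" for k w
    proof -
      have "\<alpha> k = f k" using k by (auto simp: \<alpha>_def)
      then show ?thesis using f[OF k w] by simp
    qed
  qed
qed

text \<open>\<open>E a\<close> is the translate of the weight vector by the monomial with exponents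
  \<open>a i\<close> in the first \<open>s\<close> generators, normalized by powers of the
  \<open>\<alpha> i\<close>. The action of \<open>X\<^sub>i\<^sub>+\<^sub>s\<close> is obtained from
  that of \<open>D i\<close>. Linear independence is left to \<open>iso_M\<close>.\<close>

lemma exists_M_basis:
  obtains \<alpha> E where "\<alpha> \<in> Kstar n" "\<And>a. E a \<in> carrier N" "E idx0 \<noteq> \<zero>\<^bsub>N\<^esub>"
    "\<And>k a. k \<in> {1..n} \<Longrightarrow> a \<in> idx \<Longrightarrow> E a \<cdot>\<^bsub>N\<^esub> gX k = E (shiftv k a) \<cdot>\<^bsub>N\<^esub> sc (co \<alpha> k a)"
proof -
  obtain \<alpha> v where \<alpha>: "\<alpha> \<in> Kstar n" and v: "v \<in> carrier N" "v \<noteq> \<zero>\<^bsub>N\<^esub>"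
    and vD: "\<And>i. i \<in> {1..s} \<Longrightarrow> v \<cdot>\<^bsub>N\<^esub> D i = v \<cdot>\<^bsub>N\<^esub> sc (\<alpha> (i + s))"
    and vK: "\<And>i w. i \<in> {1..s} \<Longrightarrow> w \<in> carrier N \<Longrightarrow> w \<cdot>\<^bsub>N\<^esub> (gX i [^]\<^bsub>T\<^esub> (m div h i)) = w \<cdot>\<^bsub>N\<^esub> sc (\<alpha> i ^ (m div h i))"
    and vf: "\<And>k w. k \<in> {2 * s<..n} \<Longrightarrow> w \<in> carrier N \<Longrightarrow> w \<cdot>\<^bsub>N\<^esub> gX k = w \<cdot>\<^bsub>N\<^esub> sc (\<alpha> k)"
    by (rule exists_weight_vector) blast
  have \<alpha>0: "\<alpha> k \<noteq> 0" if "k \<in> {1..n}" for k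
    using \<alpha> that by (auto simp: Kstar_def PiE_def Pi_def)
  have ract_sc: "w \<cdot>\<^bsub>N\<^esub> sc c \<cdot>\<^bsub>N\<^esub> t = w \<cdot>\<^bsub>N\<^esub> t \<cdot>\<^bsub>N\<^esub> sc c" if "w \<in> carrier N" "t \<in> carrier T" for w c t
    using N.N.ract_mult[OF that(1) that(2) T.sc_closed] N.N.ract_mult[OF that(1) T.sc_closed that(2)] T.sc_comm[OF that(2)] by simp
  have ract_sc_sc: "w \<cdot>\<^bsub>N\<^esub> sc c \<cdot>\<^bsub>N\<^esub> sc d = w \<cdot>\<^bsub>N\<^esub> sc (c * d)" if "w \<in> carrier N" for w c d
    using that by (simp add: T.sc_mult N.N.ract_mult)
  \<comment> \<open>Folding over the reversed list puts each new factor on the right, as recorded in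
    \<open>PS\<close>.\<close>
  define P where "P j a = foldr (\<lambda>i t. t \<otimes>\<^bsub>T\<^esub> gX i [^]\<^bsub>T\<^esub> a i) (rev [1..<Suc j]) \<one>\<^bsub>T\<^esub>" for j and a :: "nat \<Rightarrow> nat"
  have P0: "P 0 a = \<one>\<^bsub>T\<^esub>" and PS: "P (Suc j) a = P j a \<otimes>\<^bsub>T\<^esub> gX (Suc j) [^]\<^bsub>T\<^esub> a (Suc j)" for j a
    by (simp_all add: P_def)
  have Xc: "gX i [^]\<^bsub>T\<^esub> k \<in> carrier T" "gX i \<in> carrier T" if "i \<in> {1..s}" for i and k :: nat
    using ix[OF that] by simp_all
  have Pc: "P j a \<in> carrier T" if "j \<le> s" for j a
    using that by (induction j) (simp_all add: P0 PS Xc del: T.nat_pow_closed)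
  have XX: "gX i \<otimes>\<^bsub>T\<^esub> gX j = gX j \<otimes>\<^bsub>T\<^esub> gX i" if "i \<in> {1..s}" "j \<in> {1..s}" for i j
  proof -
    have "cc i j = 1" using that by (auto simp: cc_def)
    then show ?thesis
      using X_qcomm[of i j] ix[OF that(1)] ix[OF that(2)] by (simp add: T.qcomm_1_iff)
  qed
  have P_cong: "P j a = P j b" if "\<And>i. i \<in> {1..j} \<Longrightarrow> a i = b i" for j a b
    using that by (induction j) (auto simp: P0 PS)
  have P_X: "P j a \<otimes>\<^bsub>T\<^esub> gX i [^]\<^bsub>T\<^esub> r = P j (a(i := a i + r))" if "j \<le> s" "i \<in> {1..j}" for j a i and r :: nat
    using that
  proof (induction j)
    case (Suc j)
    have c: "P j a \<in> carrier T" "gX (Suc j) [^]\<^bsub>T\<^esub> a (Suc j) \<in> carrier T" "gX i [^]\<^bsub>T\<^esub> r \<in> carrier T"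
      using Suc.prems Pc Xc by simp_all
    show ?case
    proof (cases "i = Suc j")
      case True
      have "P j (a(i := a i + r)) = P j a" by (rule P_cong) (use True in auto)
      then have "P (Suc j) (a(i := a i + r)) = P j a \<otimes>\<^bsub>T\<^esub> gX (Suc j) [^]\<^bsub>T\<^esub> (a (Suc j) + r)"
        by (simp only: PS True fun_upd_same)
      moreover have "P (Suc j) a \<otimes>\<^bsub>T\<^esub> gX i [^]\<^bsub>T\<^esub> r = P j a \<otimes>\<^bsub>T\<^esub> gX (Suc j) [^]\<^bsub>T\<^esub> (a (Suc j) + r)"
        using c True Xc[of "Suc j"] Suc.prems by (simp add: PS T.m_assoc T.nat_pow_mult)
      ultimately show ?thesis by (simp only:)
    next
      case False
      then have ij: "i \<in> {1..j}" using Suc.prems by auto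
      have "gX (Suc j) [^]\<^bsub>T\<^esub> a (Suc j) \<otimes>\<^bsub>T\<^esub> gX i [^]\<^bsub>T\<^esub> r = gX i [^]\<^bsub>T\<^esub> r \<otimes>\<^bsub>T\<^esub> gX (Suc j) [^]\<^bsub>T\<^esub> a (Suc j)"
        using Suc.prems Xc by (intro T.group_commutes_pow T.group_commutes_pow[symmetric] XX) auto
      then have "P (Suc j) a \<otimes>\<^bsub>T\<^esub> gX i [^]\<^bsub>T\<^esub> r = (P j a \<otimes>\<^bsub>T\<^esub> gX i [^]\<^bsub>T\<^esub> r) \<otimes>\<^bsub>T\<^esub> gX (Suc j) [^]\<^bsub>T\<^esub> a (Suc j)"
        using c by (simp add: PS T.m_assoc)
      then show ?thesis
        using Suc.IH[OF _ ij] Suc.prems False by (simp add: PS)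
    qed
  qed simp
  \<comment> \<open>Among the factors of \<open>P j a\<close> only the power of
    \<open>X\<^sub>i\<close> fails to commute with \<open>D i\<close>, and it is present only for
    \<open>i \<le> j\<close>.\<close>
  have P_D: "T.qcomm (if i \<le> j then (q ^ h i) ^ a i else 1) (P j a) (D i)" if "j \<le> s" "i \<in> {1..s}" for j a i
    using that(1)
  proof (induction j)
    case 0
    then show ?case using that D_closed[OF that(2)] by (simp add: P0 T.qcomm_1_iff)
  next
    case (Suc j)
    have Sj: "Suc j \<in> {1..s}" using Suc.prems by simp
    let ?c = "if Suc j = i then q ^ h i else 1"
    have "T.qcomm ((if i \<le> j then (q ^ h i) ^ a i else 1) * ?c ^ a (Suc j)) (P (Suc j) a) (D i)"
      unfolding PS using Suc Pc Xc[OF Sj] D_closed[OF that(2)] X_D_qcomm[OF that(2) Sj]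
      by (intro T.qcomm_mult T.qcomm_pow) auto
    moreover have "(if i \<le> j then (q ^ h i) ^ a i else 1) * ?c ^ a (Suc j) = (if i \<le> Suc j then (q ^ h i) ^ a i else 1)"
      by (auto simp: le_Suc_eq)
    ultimately show ?case by simp
  qed
  \<comment> \<open>This weight gives each \<open>X\<^sub>i\<close> with \<open>i \<le> s\<close>
    the coefficient \<open>\<alpha> i\<close> at every index, the wraparound included.\<close>
  define w where "w a = (\<Prod>i=1..s. inverse (\<alpha> i) ^ a i)" for a :: "nat \<Rightarrow> nat"
  have w_upd: "w (a(i := r)) * \<alpha> i ^ r = w (a(i := 0))" if "i \<in> {1..s}" for i r a
  proof -
    have "w (a(i := r)) = inverse (\<alpha> i) ^ r * (\<Prod>j\<in>{1..s} - {i}. inverse (\<alpha> j) ^ a j)" for r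
      unfolding w_def by (subst prod.remove[OF _ that]) (auto intro!: prod.cong)
    then show ?thesis
      using \<alpha>0[of i] ix[OF that] by (simp add: power_inverse)
  qed
  define E where "E a = v \<cdot>\<^bsub>N\<^esub> P s a \<cdot>\<^bsub>N\<^esub> sc (w a)" for a
  have Ec: "E a \<in> carrier N" for a
    using v Pc N.N.ract_closed by (simp add: E_def)
  have E_X: "E a \<cdot>\<^bsub>N\<^esub> gX i = E (shiftv i a) \<cdot>\<^bsub>N\<^esub> sc (\<alpha> i)" if i: "i \<in> {1..s}" and a: "a \<in> idx" for i a
  proof -
    let ?K = "m div h i"
    have ai: "a i < ?K" by (rule idx_less[OF a i])
    let ?a' = "a(i := Suc (a i))"
    have "E a \<cdot>\<^bsub>N\<^esub> gX i = v \<cdot>\<^bsub>N\<^esub> P s a \<cdot>\<^bsub>N\<^esub> (gX i [^]\<^bsub>T\<^esub> (1::nat)) \<cdot>\<^bsub>N\<^esub> sc (w a)"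
      using v Pc[of s a] Xc[OF i] N.N.ract_closed by (simp add: E_def ract_sc[OF _ Xc(2)[OF i]])
    also have "v \<cdot>\<^bsub>N\<^esub> P s a \<cdot>\<^bsub>N\<^esub> (gX i [^]\<^bsub>T\<^esub> (1::nat)) = v \<cdot>\<^bsub>N\<^esub> P s ?a'"
    proof -
      have "P s ?a' = P s a \<otimes>\<^bsub>T\<^esub> gX i [^]\<^bsub>T\<^esub> (1::nat)"
        using P_X[of s i a 1] i by simp
      then show ?thesis
        by (simp only: N.N.ract_mult[OF v(1) Pc[OF order.refl] Xc(1)[OF i]])
    qed
    finally have eq: "E a \<cdot>\<^bsub>N\<^esub> gX i = v \<cdot>\<^bsub>N\<^esub> P s ?a' \<cdot>\<^bsub>N\<^esub> sc (w a)" .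
    have wa: "w a = w ?a' * \<alpha> i"
    proof -
      have "w a * \<alpha> i ^ a i = (w ?a' * \<alpha> i) * \<alpha> i ^ a i"
        using w_upd[OF i, of a "a i"] w_upd[OF i, of a "Suc (a i)"] by (simp add: mult_ac)
      moreover have "\<alpha> i ^ a i \<noteq> 0" using \<alpha>0[of i] ix[OF i] by simp
      ultimately show ?thesis by (metis mult_cancel_right)
    qed
    have "(int (a i) + 1) mod int ?K = int (Suc (a i) mod ?K)"
      by (simp add: zmod_int add.commute)
    then have shX: "shiftv i a = a(i := Suc (a i) mod ?K)"
      using i by (simp add: shiftv_def M_shift_def)
    show ?thesis
    proof (cases "Suc (a i) < ?K")
      case True
      then have "shiftv i a = ?a'"
        by (simp add: shX)
      then show ?thesis
        unfolding eq wa using v Pc N.N.ract_closed by (simp add: E_def ract_sc_sc)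
    next
      \<comment> \<open>Wraparound: the exponent becomes \<open>m div h i\<close>, and that power
        acts as \<open>\<alpha> i ^ (m div h i)\<close>. Passing from the weight of \<open>a\<close>
        to that of \<open>a(i := 0)\<close> uses up all of these factors but one.\<close>
      case False
      then have K: "Suc (a i) = ?K" using ai by simp
      have sh: "shiftv i a = a(i := 0)"
        by (simp add: shX K)
      have "P s ?a' = P s (a(i := 0)) \<otimes>\<^bsub>T\<^esub> gX i [^]\<^bsub>T\<^esub> ?K"
        using P_X[of s i "a(i := 0)" ?K] i K by simp
      then have "v \<cdot>\<^bsub>N\<^esub> P s ?a' = v \<cdot>\<^bsub>N\<^esub> P s (a(i := 0)) \<cdot>\<^bsub>N\<^esub> sc (\<alpha> i ^ ?K)"
        using v Pc[of s "a(i := 0)"] Xc[OF i] vK[OF i] N.N.ract_closed by (simp add: N.N.ract_mult)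
      then have "E a \<cdot>\<^bsub>N\<^esub> gX i = v \<cdot>\<^bsub>N\<^esub> P s (a(i := 0)) \<cdot>\<^bsub>N\<^esub> sc (\<alpha> i ^ ?K * w a)"
        using v Pc N.N.ract_closed by (simp add: eq ract_sc_sc)
      moreover have "\<alpha> i ^ ?K * w a = w (a(i := 0)) * \<alpha> i"
        using w_upd[OF i, of a ?K] wa K by (simp add: mult_ac)
      moreover have "E (shiftv i a) \<cdot>\<^bsub>N\<^esub> sc (\<alpha> i) = v \<cdot>\<^bsub>N\<^esub> P s (a(i := 0)) \<cdot>\<^bsub>N\<^esub> sc (w (a(i := 0)) * \<alpha> i)"
        using v Pc N.N.ract_closed by (simp add: sh E_def ract_sc_sc)
      ultimately show ?thesis by (simp only:)
    qed
  qed
  have E_D: "E a \<cdot>\<^bsub>N\<^esub> D i = E a \<cdot>\<^bsub>N\<^esub> sc (\<alpha> (i + s) * (q ^ h i) ^ a i)" if i: "i \<in> {1..s}" for i a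
  proof -
    have "P s a \<otimes>\<^bsub>T\<^esub> D i = D i \<otimes>\<^bsub>T\<^esub> P s a \<otimes>\<^bsub>T\<^esub> sc ((q ^ h i) ^ a i)"
      using P_D[OF order.refl i, of a] Pc[of s a] D_closed[OF i] T.sc_comm i by (simp add: T.qcomm_def)
    then have "v \<cdot>\<^bsub>N\<^esub> P s a \<cdot>\<^bsub>N\<^esub> D i = v \<cdot>\<^bsub>N\<^esub> D i \<cdot>\<^bsub>N\<^esub> P s a \<cdot>\<^bsub>N\<^esub> sc ((q ^ h i) ^ a i)"
      using v Pc[of s a] D_closed[OF i] N.N.ract_mult[of v "P s a" "D i"]
      by (simp add: N.N.ract_mult N.N.ract_closed)
    also have "\<dots> = v \<cdot>\<^bsub>N\<^esub> P s a \<cdot>\<^bsub>N\<^esub> sc (\<alpha> (i + s) * (q ^ h i) ^ a i)"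
      using v Pc[of s a] vD[OF i] N.N.ract_closed
      by (simp add: ract_sc[OF v(1) Pc[OF order.refl]] ract_sc_sc)
    finally show ?thesis
      using v Pc[of s a] N.N.ract_closed
      by (simp add: E_def ract_sc[of "v \<cdot>\<^bsub>N\<^esub> P s a" "D i", OF _ D_closed[OF i]] ract_sc_sc mult.commute)
  qed
  have E_Y: "E a \<cdot>\<^bsub>N\<^esub> gX (i + s) = E (shiftv (i + s) a) \<cdot>\<^bsub>N\<^esub> sc (co \<alpha> (i + s) a)" if i: "i \<in> {1..s}" and a: "a \<in> idx" for i a
  proof -
    \<comment> \<open>\<open>E a\<close> is, up to \<open>\<alpha> i\<close>, the image under
      \<open>X\<^sub>i\<close> of \<open>E b\<close> for the predecessor \<open>b\<close>, so
      applying \<open>X\<^sub>i\<^sub>+\<^sub>s\<close> to it amounts to applying \<open>D i\<close>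
      to \<open>E b\<close>.\<close>
    define b where "b = shiftv (i + s) a"
    have b_eq: "b = M_shift m h i (- 1) a" using i by (simp add: b_def shiftv_def)
    have b: "b \<in> idx" using M_shift_closed[OF a i] b_eq by simp
    have ba: "shiftv i b = a" using i a by (simp add: b_eq shiftv_def M_shift_shift M_shift_0)
    have bi: "(q ^ h i) ^ b i = (q ^ h i) powi (int (a i) - 1)"
    proof -
      have "int (m div h i) > 0" using h_div[OF i] by linarith
      then have "int (b i) = (int (a i) - 1) mod int (m div h i)"
        by (simp add: b_eq M_shift_def)
      then show ?thesis
        using q_h_powi_mod[OF i, of "int (a i) - 1"] by (metis power_int_of_nat)
    qed
    have c: "gX i \<in> carrier T" "gX (i + s) \<in> carrier T" using ix[OF i] by simp_all
    have \<alpha>i: "\<alpha> i \<noteq> 0" using \<alpha>0 ix[OF i] by simp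
    have "E b \<cdot>\<^bsub>N\<^esub> gX i \<cdot>\<^bsub>N\<^esub> sc (inverse (\<alpha> i)) = E a"
      using E_X[OF i b] Ec \<alpha>i by (simp add: ba ract_sc_sc T.sc_one N.N.ract_one)
    then have "E a \<cdot>\<^bsub>N\<^esub> gX (i + s) = E b \<cdot>\<^bsub>N\<^esub> gX i \<cdot>\<^bsub>N\<^esub> sc (inverse (\<alpha> i)) \<cdot>\<^bsub>N\<^esub> gX (i + s)" by simp
    also have "\<dots> = E b \<cdot>\<^bsub>N\<^esub> D i \<cdot>\<^bsub>N\<^esub> sc (inverse (\<alpha> i))"
      using Ec c N.N.ract_closed by (simp add: ract_sc[OF _ c(2)] D_def N.N.ract_mult)
    also have "\<dots> = E b \<cdot>\<^bsub>N\<^esub> sc (co \<alpha> (i + s) a)"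
      using i Ec by (simp add: E_D[OF i] ract_sc_sc co_def bi mult_ac)
    finally show ?thesis by (simp add: b_def)
  qed
  show ?thesis
  proof (rule that[OF \<alpha> Ec])
    have "E idx0 = v"
    proof -
      have "P j idx0 = \<one>\<^bsub>T\<^esub>" if "j \<le> s" for j
        using that Xc by (induction j) (simp_all add: P0 PS idx0_def)
      moreover have "w idx0 = 1" by (simp add: w_def idx0_def)
      ultimately show ?thesis using v by (simp add: E_def N.N.ract_one T.sc_one)
    qed
    then show "E idx0 \<noteq> \<zero>\<^bsub>N\<^esub>" using v by simp
    show "E a \<cdot>\<^bsub>N\<^esub> gX k = E (shiftv k a) \<cdot>\<^bsub>N\<^esub> sc (co \<alpha> k a)" if k: "k \<in> {1..n}" and a: "a \<in> idx" for k a
    proof -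
      consider "k \<in> {1..s}" | i where "i \<in> {1..s}" "k = i + s" | "k \<in> {2 * s<..n}"
      proof -
        consider "k \<in> {1..s}" | "k - s \<in> {1..s}" "k = (k - s) + s" | "k \<in> {2 * s<..n}"
          using k by fastforce
        then show thesis using that by cases blast+
      qed
      then show ?thesis
      proof cases
        case 1
        then show ?thesis using E_X[OF 1 a] by (simp add: co_def)
      next
        case 2
        then show ?thesis using E_Y[OF 2(1) a] by simp
      next
        case 3
        then show ?thesis using vf[OF 3 Ec] by (simp add: co_def shiftv_def)
      qed
    qed
  qed
qed

end

section \<open>The module \<open>M(\<alpha>)\<close> over the torus\<close>

text \<open>Linear operators attached to the letters make the free algebra act; the relations are
  imposed separately in \<open>letter_ops_rels\<close>.\<close>

locale letter_ops = presentation L Rel for L :: "'l set" and Rel :: "('l list \<Rightarrow> 'k::field) set" +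
  fixes V :: "('i \<Rightarrow> 'k) set" and lop :: "'l \<Rightarrow> ('i \<Rightarrow> 'k) \<Rightarrow> ('i \<Rightarrow> 'k)"
  assumes V_zero: "(\<lambda>b. 0) \<in> V"
    and V_add: "\<And>v w. v \<in> V \<Longrightarrow> w \<in> V \<Longrightarrow> (\<lambda>b. v b + w b) \<in> V"
    and V_scale: "\<And>v c. v \<in> V \<Longrightarrow> (\<lambda>b. c * v b) \<in> V"
    and lop_closed: "\<And>l v. l \<in> L \<Longrightarrow> v \<in> V \<Longrightarrow> lop l v \<in> V"
    and lop_add: "\<And>l v w. l \<in> L \<Longrightarrow> v \<in> V \<Longrightarrow> w \<in> V \<Longrightarrow> lop l (\<lambda>b. v b + w b) = (\<lambda>b. lop l v b + lop l w b)"
    and lop_scale: "\<And>l v c. l \<in> L \<Longrightarrow> v \<in> V \<Longrightarrow> lop l (\<lambda>b. c * v b) = (\<lambda>b. c * lop l v b)"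
begin

definition wact :: "('i \<Rightarrow> 'k) \<Rightarrow> ('l list \<Rightarrow> 'k) \<Rightarrow> 'i \<Rightarrow> 'k" where
  "wact v f = (\<lambda>b. \<Sum>w | f w \<noteq> 0. f w * fold lop w v b)"

lemma fold_closed: "set w \<subseteq> L \<Longrightarrow> v \<in> V \<Longrightarrow> fold lop w v \<in> V"
  by (induction w arbitrary: v) (auto simp: lop_closed)

lemma fold_add: "set w \<subseteq> L \<Longrightarrow> v \<in> V \<Longrightarrow> v' \<in> V \<Longrightarrow> fold lop w (\<lambda>b. v b + v' b) = (\<lambda>b. fold lop w v b + fold lop w v' b)"
  by (induction w arbitrary: v v') (auto simp: lop_closed lop_add)

lemma fold_scale: "set w \<subseteq> L \<Longrightarrow> v \<in> V \<Longrightarrow> fold lop w (\<lambda>b. c * v b) = (\<lambda>b. c * fold lop w v b)"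
  by (induction w arbitrary: v) (auto simp: lop_closed lop_scale)

lemma wact_superset:
  assumes "finite W" "{w. f w \<noteq> 0} \<subseteq> W"
  shows "wact v f b = (\<Sum>w\<in>W. f w * fold lop w v b)"
  unfolding wact_def by (rule sum.mono_neutral_left) (use assms in auto)

lemma wact_fmonom: "wact v (fmonom c u) = (\<lambda>b. c * fold lop u v b)"
proof
  fix b
  have "wact v (fmonom c u) b = (\<Sum>w\<in>{u}. fmonom c u w * fold lop w v b)"
    by (rule wact_superset) (auto simp: fmonom_def)
  then show "wact v (fmonom c u) b = c * fold lop u v b" by (simp add: fmonom_def)
qed

lemma wact_add:
  assumes "f \<in> carrier F" "g \<in> carrier F"
  shows "wact v (\<lambda>w. f w + g w) = (\<lambda>b. wact v f b + wact v g b)"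
proof
  fix b
  let ?W = "{w. f w \<noteq> 0} \<union> {w. g w \<noteq> 0}"
  have fin: "finite ?W" using assms by (simp add: fa_carrier)
  have "wact v (\<lambda>w. f w + g w) b = (\<Sum>w\<in>?W. (f w + g w) * fold lop w v b)"
    by (rule wact_superset[OF fin]) auto
  moreover have "wact v f b = (\<Sum>w\<in>?W. f w * fold lop w v b)" "wact v g b = (\<Sum>w\<in>?W. g w * fold lop w v b)"
    by (auto intro!: wact_superset[OF fin])
  ultimately show "wact v (\<lambda>w. f w + g w) b = wact v f b + wact v g b"
    by (simp add: distrib_right sum.distrib)
qed

lemma wact_closed: "f \<in> carrier F \<Longrightarrow> v \<in> V \<Longrightarrow> wact v f \<in> V"
  by (induction f rule: fa_induct) (auto simp: wact_fmonom wact_add intro: V_add V_scale fold_closed)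

lemma wact_add_left:
  "f \<in> carrier F \<Longrightarrow> v \<in> V \<Longrightarrow> v' \<in> V \<Longrightarrow> wact (\<lambda>b. v b + v' b) f = (\<lambda>b. wact v f b + wact v' f b)"
  by (induction f rule: fa_induct) (auto simp: wact_fmonom wact_add fold_add algebra_simps)

lemma wact_scale_left:
  "f \<in> carrier F \<Longrightarrow> v \<in> V \<Longrightarrow> wact (\<lambda>b. c * v b) f = (\<lambda>b. c * wact v f b)"
  by (induction f rule: fa_induct) (auto simp: wact_fmonom wact_add fold_scale algebra_simps)

text \<open>Concatenation of words is composition of their actions, the first word acting first;
  additivity in both arguments reduces everything to words.\<close>

lemma wact_conv:
  assumes "f \<in> carrier F" "g \<in> carrier F" "v \<in> V"
  shows "wact v (conv f g) = wact (wact v f) g"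
  using assms(1)
proof (induction f rule: fa_induct)
  case (monom c u)
  have uc: "fmonom c u \<in> carrier F" by (rule fmonom_carrier[OF monom])
  from assms(2) show ?case
  proof (induction g rule: fa_induct)
    case (monom d u')
    have "fold lop u' (\<lambda>b. c * fold lop u v b) = (\<lambda>b. c * fold lop u' (fold lop u v) b)"
      using monom \<open>set u \<subseteq> L\<close> assms(3) by (intro fold_scale fold_closed)
    then show ?case by (simp add: conv_fmonom wact_fmonom mult_ac)
  next
    case (add g g')
    have "conv (fmonom c u) (\<lambda>w. g w + g' w) = (\<lambda>w. conv (fmonom c u) g w + conv (fmonom c u) g' w)"
      by (rule ext) (rule conv_add_right)
    then show ?case using add uc by (simp add: wact_add fa_conv_carrier)
  qed
next
  case (add f f')
  have "conv (\<lambda>w. f w + f' w) g = (\<lambda>w. conv f g w + conv f' g w)"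
    by (rule ext) (rule conv_add_left)
  then show ?case
    using add assms by (simp add: wact_add wact_add_left fa_conv_carrier wact_closed)
qed

lemma wact_zero: "wact v (\<lambda>w. 0) = (\<lambda>b. 0)"
  by (simp add: wact_def)

lemma wact_zero_left: "f \<in> carrier F \<Longrightarrow> wact (\<lambda>b. 0) f = (\<lambda>b. 0)"
  using wact_scale_left[of f "\<lambda>b. 0" 0] V_zero by simp

lemma fa_uminus: "f \<in> carrier F \<Longrightarrow> \<ominus>\<^bsub>F\<^esub> f = (\<lambda>w. - f w)"
  using fa_scale_carrier[of f L "-1"] by (intro F.minus_equality) auto

lemma wact_uminus: "f \<in> carrier F \<Longrightarrow> wact v (\<ominus>\<^bsub>F\<^esub> f) = (\<lambda>b. - wact v f b)"
  by (simp add: fa_uminus wact_def sum_negf)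

lemma wact_minus:
  assumes "f \<in> carrier F" "g \<in> carrier F" "v \<in> V"
  shows "wact v (f \<ominus>\<^bsub>F\<^esub> g) = (\<lambda>b. wact v f b - wact v g b)"
proof -
  have "(\<lambda>b. wact v (f \<ominus>\<^bsub>F\<^esub> g) b + wact v g b) = wact v ((f \<ominus>\<^bsub>F\<^esub> g) \<oplus>\<^bsub>F\<^esub> g)"
    using wact_add[OF F.minus_closed[OF assms(1,2)] assms(2)] by simp
  also have "(f \<ominus>\<^bsub>F\<^esub> g) \<oplus>\<^bsub>F\<^esub> g = f" using assms by algebra
  finally have "wact v (f \<ominus>\<^bsub>F\<^esub> g) b + wact v g b = wact v f b" for b
    by (rule fun_cong)
  then show ?thesis by (auto simp: fun_eq_iff eq_diff_eq)
qed

end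

locale letter_ops_rels = letter_ops L Rel V lop
  for L :: "'l set" and Rel :: "('l list \<Rightarrow> 'k::field) set" and V :: "('i \<Rightarrow> 'k) set" and lop +
  assumes rels: "\<And>r v. r \<in> Rel \<Longrightarrow> v \<in> V \<Longrightarrow> wact v r = (\<lambda>b. 0)"
begin

text \<open>The elements annihilating \<open>V\<close> form a two-sided ideal that contains the
  relations.\<close>

lemma wact_ideal:
  assumes "f \<in> I" "v \<in> V"
  shows "wact v f = (\<lambda>b. 0)"
proof -
  let ?J = "{f\<in>carrier F. \<forall>v\<in>V. wact v f = (\<lambda>b. 0)}"
  have "ideal ?J F"
  proof (rule idealI)
    show "ring F" by (rule free_algebra_ring)
    show "subgroup ?J (add_monoid F)"
    proof (rule F.add.subgroupI)
      show "?J \<noteq> {}" using fa_zero_carrier wact_zero by blast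
      fix f assume f: "f \<in> ?J"
      then show "\<ominus>\<^bsub>F\<^esub> f \<in> ?J"
        by (simp add: wact_uminus F.a_inv_closed)
      fix g assume "g \<in> ?J"
      then show "f \<oplus>\<^bsub>F\<^esub> g \<in> ?J" using f by (simp add: wact_add fa_add_carrier)
    qed auto
    fix f g assume "f \<in> ?J" "g \<in> carrier F"
    then show "g \<otimes>\<^bsub>F\<^esub> f \<in> ?J" "f \<otimes>\<^bsub>F\<^esub> g \<in> ?J"
      by (auto simp: wact_conv wact_closed wact_zero_left fa_conv_carrier)
  qed
  then have "I \<subseteq> ?J"
    by (rule F.genideal_minimal) (use Rel_carrier rels in auto)
  then show ?thesis using assms by blast
qed

abbreviation (input) Mact :: "('i \<Rightarrow> 'k) \<Rightarrow> ('l list \<Rightarrow> 'k) set \<Rightarrow> 'i \<Rightarrow> 'k" where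
  "Mact v C \<equiv> wact v (SOME f. f \<in> C)"

text \<open>The representative picked by \<open>SOME\<close> differs from \<open>f\<close> by an
  element of the ideal, which acts by zero.\<close>

lemma Mact_cls:
  assumes "f \<in> carrier F" "v \<in> V"
  shows "Mact v (cls f) = wact v f"
proof -
  have "f \<in> cls f" unfolding cls_eq by (rule I.a_rcos_self[OF assms(1)])
  then have "(SOME g. g \<in> cls f) \<in> cls f" by (rule someI[of "\<lambda>g. g \<in> cls f"])
  then obtain i where i: "i \<in> I" "(SOME g. g \<in> cls f) = (\<lambda>w. i w + f w)"
    using cls_eq_iff[OF assms(1)] by blast
  then show ?thesis
    using assms wact_add[of i f v] wact_ideal[OF i(1) assms(2)] I.a_subset by auto
qed

text \<open>The fields \<open>x\<close> and \<open>y\<close> are left arbitrary so that they can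
  match the \<open>undefined\<close> entries of \<open>M_mod\<close>.\<close>

lemma right_module_Mact:
  "right_module A \<lparr>carrier = V, monoid.mult = x, one = y, zero = (\<lambda>b. 0), add = (\<lambda>v w b. v b + w b), ract = Mact\<rparr>"
  (is "right_module A ?M")
proof (intro right_module.intro right_module_axioms.intro ring_A)
  show "abelian_group ?M"
  proof (rule abelian_groupI)
    fix v assume "v \<in> carrier ?M"
    then show "\<exists>w\<in>carrier ?M. w \<oplus>\<^bsub>?M\<^esub> v = \<zero>\<^bsub>?M\<^esub>"
      using V_scale[of v "-1"] by (intro bexI[of _ "\<lambda>b. - 1 * v b"]) auto
  qed (auto simp: V_add V_zero add_ac)
  fix v assume "v \<in> carrier ?M"
  then have v: "v \<in> V" by simp
  fix r assume "r \<in> carrier A"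
  then obtain f where f: "f \<in> carrier F" "r = cls f" using cls_surj by blast
  show "v \<cdot>\<^bsub>?M\<^esub> r \<in> carrier ?M" using f v by (simp add: Mact_cls wact_closed)
  show "(v \<oplus>\<^bsub>?M\<^esub> w) \<cdot>\<^bsub>?M\<^esub> r = v \<cdot>\<^bsub>?M\<^esub> r \<oplus>\<^bsub>?M\<^esub> w \<cdot>\<^bsub>?M\<^esub> r" if "w \<in> carrier ?M" for w
    using that f v by (simp add: Mact_cls wact_add_left V_add)
  fix t assume "t \<in> carrier A"
  then obtain g where g: "g \<in> carrier F" "t = cls g" using cls_surj by blast
  show "v \<cdot>\<^bsub>?M\<^esub> (r \<oplus>\<^bsub>A\<^esub> t) = v \<cdot>\<^bsub>?M\<^esub> r \<oplus>\<^bsub>?M\<^esub> v \<cdot>\<^bsub>?M\<^esub> t"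
    using f g v by (simp add: Mact_cls wact_add fa_add_carrier flip: cls_add)
  show "v \<cdot>\<^bsub>?M\<^esub> (r \<otimes>\<^bsub>A\<^esub> t) = v \<cdot>\<^bsub>?M\<^esub> r \<cdot>\<^bsub>?M\<^esub> t"
  proof -
    have m: "r \<otimes>\<^bsub>A\<^esub> t = cls (conv f g)"
      using ring_hom_mult[OF cls_hom f(1) g(1)] f g by simp
    show ?thesis
      unfolding m using f g v by (simp add: Mact_cls wact_conv fa_conv_carrier wact_closed)
  qed
next
  fix v assume "v \<in> carrier ?M"
  then show "v \<cdot>\<^bsub>?M\<^esub> \<one>\<^bsub>A\<^esub> = v"
    using ring_hom_one[OF cls_hom] Mact_cls[of "fmonom 1 []" v] by (simp add: fmonom_carrier wact_fmonom)
qed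

end

section \<open>The operators of \<open>M(\<alpha>)\<close> and the torus relations\<close>

locale torus_M = torus n s m h q for n s m h and q :: "'k::alg_closed_field" +
  fixes \<alpha> :: "nat \<Rightarrow> 'k"
  assumes alpha: "\<alpha> \<in> Kstar n"
begin

abbreviation "mop \<equiv> M_op s m h q \<alpha>"
abbreviation "V \<equiv> M_space s m h :: ((nat \<Rightarrow> nat) \<Rightarrow> 'k) set"
abbreviation "M \<equiv> M_mod s m h q \<alpha>"

lemma alpha_nonzero: "k \<in> {1..n} \<Longrightarrow> \<alpha> k \<noteq> 0"
  using alpha by (auto simp: Kstar_def PiE_def Pi_def)

lemma co_nonzero: "k \<in> {1..n} \<Longrightarrow> co \<alpha> k a \<noteq> 0"
proof -
  assume k: "k \<in> {1..n}"
  have "\<alpha> (k - s) \<noteq> 0" if "\<not> k \<le> s"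
    by (rule alpha_nonzero) (use k that in auto)
  then show ?thesis
    using alpha_nonzero[OF k] q_nonzero by (simp add: co_def)
qed

lemma M_gen_act_eq: "M_gen_act s m h q \<alpha> k a = (\<lambda>b. co \<alpha> k a * M_basis (shiftv k a) b)"
  by (auto simp: M_gen_act_def co_def shiftv_def Let_def)

lemma shiftv_closed: "k \<in> {1..n} \<Longrightarrow> a \<in> idx \<Longrightarrow> shiftv k a \<in> idx"
  using bij_betwE[OF shiftv_bij] by blast

lemma shiftv_inj: "k \<in> {1..n} \<Longrightarrow> a \<in> idx \<Longrightarrow> b \<in> idx \<Longrightarrow> shiftv k a = shiftv k b \<longleftrightarrow> a = b"
  using bij_betw_imp_inj_on[OF shiftv_bij] by (auto simp: inj_on_def)

lemma shiftv_surj: "k \<in> {1..n} \<Longrightarrow> b \<in> idx \<Longrightarrow> \<exists>a\<in>idx. b = shiftv k a"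
  using bij_betw_imp_surj_on[OF shiftv_bij] by blast

text \<open>\<open>X\<^sub>k\<close> permutes the basis up to factors; injectivity of the shift
  leaves one summand at each coordinate.\<close>

lemma mop_shiftv:
  assumes k: "k \<in> {1..n}" and a: "a \<in> idx"
  shows "mop k v (shiftv k a) = co \<alpha> k a * v a"
proof -
  have "mop k v (shiftv k a) = (\<Sum>b\<in>idx. if b = a then co \<alpha> k a * v a else 0)"
    unfolding M_op_def using assms by (intro sum.cong) (auto simp: M_gen_act_eq M_basis_def shiftv_inj)
  then show ?thesis using a idx_finite by simp
qed

lemma mop_outside: "k \<in> {1..n} \<Longrightarrow> b \<notin> idx \<Longrightarrow> mop k v b = 0"
  unfolding M_op_def using shiftv_closed by (intro sum.neutral) (auto simp: M_gen_act_eq M_basis_def)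

lemma mop_closed: "k \<in> {1..n} \<Longrightarrow> mop k v \<in> V"
  by (auto simp: M_space_def mop_outside)

lemma mop_add: "mop k (\<lambda>b. v b + w b) = (\<lambda>b. mop k v b + mop k w b)"
  by (simp add: M_op_def distrib_right sum.distrib)

lemma mop_scale: "mop k (\<lambda>b. c * v b) = (\<lambda>b. c * mop k v b)"
  by (simp add: M_op_def sum_distrib_left mult.assoc)

lemma V_eqI:
  assumes "v \<in> V" "w \<in> V" "\<And>a. a \<in> idx \<Longrightarrow> v a = w a" shows "v = w"
proof
  fix a show "v a = w a" using assms by (cases "a \<in> idx") (auto simp: M_space_def)
qed

lemma V_closed: "(\<lambda>b. 0) \<in> V" "v \<in> V \<Longrightarrow> w \<in> V \<Longrightarrow> (\<lambda>b. v b + w b) \<in> V" "v \<in> V \<Longrightarrow> (\<lambda>b. c * v b) \<in> V"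
  by (auto simp: M_space_def)

text \<open>A weighted permutation with nonzero weights. Its inverse on \<open>V\<close> is the
  operator assigned to \<open>Tinv k\<close>.\<close>

lemma mop_bij:
  assumes k: "k \<in> {1..n}"
  shows "bij_betw (mop k) V V"
  unfolding bij_betw_def
proof
  show "inj_on (mop k) V"
  proof (rule inj_onI)
    fix v w assume vw: "v \<in> V" "w \<in> V" "mop k v = mop k w"
    show "v = w"
    proof (rule V_eqI[OF vw(1,2)])
      fix a assume "a \<in> idx"
      then show "v a = w a"
        using mop_shiftv[OF k, of a v] mop_shiftv[OF k, of a w] vw co_nonzero[OF k, of a] by simp
    qed
  qed
  show "mop k ` V = V"
  proof (intro equalityI subsetI)
    fix w assume w: "w \<in> V"
    define v where "v a = (if a \<in> idx then w (shiftv k a) / co \<alpha> k a else 0)" for a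
    have v: "v \<in> V" by (simp add: v_def M_space_def)
    have "mop k v = w"
    proof (rule V_eqI[OF mop_closed[OF k] w])
      fix b assume "b \<in> idx"
      then obtain a where a: "a \<in> idx" "b = shiftv k a" using shiftv_surj[OF k] by blast
      then show "mop k v b = w b"
        using co_nonzero[OF k, of a] by (simp add: mop_shiftv[OF k] v_def)
    qed
    then show "w \<in> mop k ` V" using v by blast
  qed (use mop_closed[OF k] in auto)
qed

text \<open>Reduces a relation between operators to one between shifts and coefficients at each
  index. In a right action the product \<open>X\<^sub>k X\<^sub>l\<close> is \<open>mop l\<close>
  after \<open>mop k\<close>.\<close>

lemma mop_qcomm:
  assumes k: "k \<in> {1..n}" and l: "l \<in> {1..n}"
    and c: "\<And>a. a \<in> idx \<Longrightarrow> shiftv l (shiftv k a) = shiftv k (shiftv l a) \<and>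
      co \<alpha> l (shiftv k a) * co \<alpha> k a = c * (co \<alpha> k (shiftv l a) * co \<alpha> l a)"
  shows "mop l (mop k v) = (\<lambda>b. c * mop k (mop l v) b)"
proof (rule V_eqI[OF mop_closed[OF l]])
  show "(\<lambda>b. c * mop k (mop l v) b) \<in> V" using mop_closed[OF k] V_closed by blast
  fix b assume "b \<in> idx"
  then obtain a' where a': "a' \<in> idx" "b = shiftv l a'" using shiftv_surj[OF l] by blast
  then obtain a where a: "a \<in> idx" "a' = shiftv k a" using shiftv_surj[OF k] by blast
  have "mop l (mop k v) b = co \<alpha> l (shiftv k a) * co \<alpha> k a * v a"
    using a a' shiftv_closed k l by (simp add: mop_shiftv)
  moreover have "mop k (mop l v) b = co \<alpha> k (shiftv l a) * co \<alpha> l a * v a"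
    using a a' shiftv_closed k l c[OF a(1)] by (simp add: mop_shiftv)
  ultimately show "mop l (mop k v) b = c * mop k (mop l v) b"
    using c[OF a(1)] by (simp add: mult.assoc)
qed

text \<open>The coordinate of the index that \<open>X\<^sub>k\<close> moves; \<open>0\<close> stands for none.\<close>

definition crd :: "nat \<Rightarrow> nat" where
  "crd k = (if k \<le> s then k else if k \<le> 2 * s then k - s else 0)"

lemma co_cong: "a (crd k) = b (crd k) \<Longrightarrow> co \<alpha> k a = co \<alpha> k b"
  by (auto simp: co_def crd_def)

text \<open>Either the generators move different coordinates or one of them moves none, and each
  coefficient depends at most on the coordinate its generator moves.\<close>

lemma unpaired_commute:
  assumes k: "k \<in> {1..n}" and l: "l \<in> {1..n}" and ne: "crd k \<noteq> crd l \<or> crd k = 0"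
  shows "shiftv l (shiftv k a) = shiftv k (shiftv l a)"
    "co \<alpha> l (shiftv k a) * co \<alpha> k a = co \<alpha> k (shiftv l a) * co \<alpha> l a"
proof -
  consider "crd k = 0" | "crd l = 0" | "crd k \<noteq> 0" "crd l \<noteq> 0" "crd k \<noteq> crd l" using ne by fastforce
  then have "shiftv l (shiftv k a) = shiftv k (shiftv l a) \<and> co \<alpha> l (shiftv k a) = co \<alpha> l a \<and> co \<alpha> k (shiftv l a) = co \<alpha> k a"
  proof cases
    case 1
    then have "k > 2 * s" using k by (auto simp: crd_def split: if_splits)
    then have "shiftv k = (\<lambda>a. a)" "\<And>a b. co \<alpha> k a = co \<alpha> k b" by (auto simp: shiftv_def co_def)
    then show ?thesis by simp
  next
    case 2
    then have "l > 2 * s" using l by (auto simp: crd_def split: if_splits)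
    then have "shiftv l = (\<lambda>a. a)" "\<And>a b. co \<alpha> l a = co \<alpha> l b" by (auto simp: shiftv_def co_def)
    then show ?thesis by simp
  next
    case 3
    have upd: "\<exists>z. \<forall>a. shiftv k a = M_shift m h (crd k) z a" if "crd k \<noteq> 0" for k
      using that by (auto simp: shiftv_def crd_def split: if_splits)
    obtain z z' where z: "\<And>a. shiftv k a = M_shift m h (crd k) z a" "\<And>a. shiftv l a = M_shift m h (crd l) z' a"
      using upd[OF 3(1)] upd[OF 3(2)] by blast
    have "co \<alpha> l (shiftv k a) = co \<alpha> l a" "co \<alpha> k (shiftv l a) = co \<alpha> k a"
      by (rule co_cong; use 3 in \<open>simp add: z M_shift_def\<close>)+
    moreover have "shiftv l (shiftv k a) = shiftv k (shiftv l a)"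
      using 3 by (simp add: z M_shift_def fun_upd_twist)
    ultimately show ?thesis by simp
  qed
  then show "shiftv l (shiftv k a) = shiftv k (shiftv l a)"
    "co \<alpha> l (shiftv k a) * co \<alpha> k a = co \<alpha> k (shiftv l a) * co \<alpha> l a" by auto
qed

text \<open>Raising \<open>a i\<close> by one multiplies the coefficient of
  \<open>X\<^sub>i\<^sub>+\<^sub>s\<close> by \<open>q ^ h i\<close>, also across the wraparound by
  \<open>q_h_powi_mod\<close>.\<close>

lemma paired_commute:
  assumes i: "i \<in> {1..s}" and a: "a \<in> idx"
  shows "shiftv (i + s) (shiftv i a) = shiftv i (shiftv (i + s) a)"
    "co \<alpha> (i + s) (shiftv i a) * co \<alpha> i a = q ^ h i * (co \<alpha> i (shiftv (i + s) a) * co \<alpha> (i + s) a)"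
proof -
  show "shiftv (i + s) (shiftv i a) = shiftv i (shiftv (i + s) a)"
    using i a by (simp add: shiftv_def M_shift_shift)
  have K: "int (m div h i) > 0" using h_div[OF i] by linarith
  have "int (shiftv i a i) = (int (a i) + 1) mod int (m div h i)"
    using i K by (simp add: shiftv_def M_shift_def)
  then have "(q ^ h i) powi (int (shiftv i a i) - 1) = (q ^ h i) powi (int (a i))"
    using q_h_powi_mod[OF i, of "int (a i) + 1"] q_nonzero by (simp add: power_int_diff power_int_add)
  moreover have "(q ^ h i) powi (int (a i)) = q ^ h i * (q ^ h i) powi (int (a i) - 1)"
    using q_nonzero by (simp add: power_int_diff)
  ultimately show "co \<alpha> (i + s) (shiftv i a) * co \<alpha> i a = q ^ h i * (co \<alpha> i (shiftv (i + s) a) * co \<alpha> (i + s) a)"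
    using i by (simp add: co_def)
qed

sublocale lo: letter_ops "nf_letters n" "nf_rels n s h q" V "M_letter_op s m h q \<alpha>"
proof
  show "(\<lambda>b. 0) \<in> V" by (rule V_closed)
  show "(\<lambda>b. v b + w b) \<in> V" if "v \<in> V" "w \<in> V" for v w using that by (rule V_closed)
  show "(\<lambda>b. c * v b) \<in> V" if "v \<in> V" for v c using that by (rule V_closed)
  fix l assume "l \<in> nf_letters n"
  then consider k where "k \<in> {1..n}" "l = Tgen k" | k where "k \<in> {1..n}" "l = Tinv k"
    by (auto simp: nf_letters_def)
  then have *: "(\<forall>v\<in>V. M_letter_op s m h q \<alpha> l v \<in> V) \<and>
    (\<forall>v\<in>V. \<forall>w\<in>V. M_letter_op s m h q \<alpha> l (\<lambda>b. v b + w b) = (\<lambda>b. M_letter_op s m h q \<alpha> l v b + M_letter_op s m h q \<alpha> l w b)) \<and>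
    (\<forall>v\<in>V. \<forall>c. M_letter_op s m h q \<alpha> l (\<lambda>b. c * v b) = (\<lambda>b. c * M_letter_op s m h q \<alpha> l v b))"
  proof cases
    case 1
    then show ?thesis by (simp add: mop_closed mop_add mop_scale)
  next
    case 2
    let ?g = "inv_into V (mop k)"
    have inj: "inj_on (mop k) V" and surj: "mop k ` V = V"
      using mop_bij[OF 2(1)] by (auto simp: bij_betw_def)
    have g: "?g v \<in> V" "mop k (?g v) = v" if "v \<in> V" for v
      using that surj inv_into_into[of v "mop k" V] f_inv_into_f[of v "mop k" V] by auto
    have "?g (\<lambda>b. v b + w b) = (\<lambda>b. ?g v b + ?g w b)" if "v \<in> V" "w \<in> V" for v w
      using that g V_closed by (intro inv_into_f_eq[OF inj]) (auto simp: mop_add)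
    moreover have "?g (\<lambda>b. c * v b) = (\<lambda>b. c * ?g v b)" if "v \<in> V" for v c
      using that g V_closed by (intro inv_into_f_eq[OF inj]) (auto simp: mop_scale)
    ultimately show ?thesis using 2 g by simp
  qed
  show "M_letter_op s m h q \<alpha> l v \<in> V" if "v \<in> V" for v using * that by blast
  show "M_letter_op s m h q \<alpha> l (\<lambda>b. v b + w b) = (\<lambda>b. M_letter_op s m h q \<alpha> l v b + M_letter_op s m h q \<alpha> l w b)"
    if "v \<in> V" "w \<in> V" for v w using * that by blast
  show "M_letter_op s m h q \<alpha> l (\<lambda>b. c * v b) = (\<lambda>b. c * M_letter_op s m h q \<alpha> l v b)" if "v \<in> V" for v c
    using * that by blast
qed

sublocale lo: letter_ops_rels "nf_letters n" "nf_rels n s h q" V "M_letter_op s m h q \<alpha>"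
proof
  fix r v assume r: "r \<in> nf_rels n s h q" and v: "v \<in> V"
  let ?F = "free_algebra (nf_letters n) :: (torus_letter list \<Rightarrow> 'k) ring"
  have rel: "lo.wact v (fmonom 1 [x, y] \<ominus>\<^bsub>?F\<^esub> fmonom c [y, x]) = (\<lambda>b. 0)"
    if "x \<in> nf_letters n" "y \<in> nf_letters n"
      "M_letter_op s m h q \<alpha> y (M_letter_op s m h q \<alpha> x v) = (\<lambda>b. c * M_letter_op s m h q \<alpha> x (M_letter_op s m h q \<alpha> y v) b)" for x y c
    using that v by (simp add: lo.wact_minus fmonom_carrier lo.wact_fmonom)
  have inv: "lo.wact v (fmonom 1 [x, y] \<ominus>\<^bsub>?F\<^esub> \<one>\<^bsub>?F\<^esub>) = (\<lambda>b. 0)"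
    if "x \<in> nf_letters n" "y \<in> nf_letters n" "M_letter_op s m h q \<alpha> y (M_letter_op s m h q \<alpha> x v) = v" for x y
    using that v by (simp add: lo.wact_minus fmonom_carrier lo.wact_fmonom)
  consider (1) k where "k \<in> {1..n}" "r = fmonom 1 [Tgen k, Tinv k] \<ominus>\<^bsub>?F\<^esub> \<one>\<^bsub>?F\<^esub>"
    | (2) k where "k \<in> {1..n}" "r = fmonom 1 [Tinv k, Tgen k] \<ominus>\<^bsub>?F\<^esub> \<one>\<^bsub>?F\<^esub>"
    | (3) i where "i \<in> {1..s}" "r = fmonom 1 [Tgen i, Tgen (i + s)] \<ominus>\<^bsub>?F\<^esub> fmonom (q ^ h i) [Tgen (i + s), Tgen i]"
    | (4) k l where "k \<in> {1..n}" "l \<in> {1..n}" "\<forall>i\<in>{1..s}. {k, l} \<noteq> {i, i + s}"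
        "r = fmonom 1 [Tgen k, Tgen l] \<ominus>\<^bsub>?F\<^esub> fmonom 1 [Tgen l, Tgen k]"
    using r unfolding nf_rels_def Let_def by blast
  then show "lo.wact v r = (\<lambda>b. 0)"
  proof cases
    case 1
    then show ?thesis
      unfolding 1(2) using v mop_bij[OF 1(1)] by (intro inv letters) (auto simp: bij_betw_def)
  next
    case 2
    then show ?thesis
      unfolding 2(2) using v mop_bij[OF 2(1)] by (intro inv letters) (auto simp: bij_betw_def f_inv_into_f)
  next
    case 3
    then show ?thesis
      unfolding 3(2) using ix[OF 3(1)] paired_commute[OF 3(1)]
      by (intro rel letters) (auto intro!: mop_qcomm)
  next
    case 4
    have "mop l (mop k v) = (\<lambda>b. 1 * mop k (mop l v) b)"
    proof (cases "k = l")
      case False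
      \<comment> \<open>Distinct generators with the same nonzero coordinate form a pair
        \<open>i\<close>, \<open>i + s\<close>, which this family of relations excludes.\<close>
      have "crd k \<noteq> crd l \<or> crd k = 0"
      proof (rule ccontr)
        assume *: "\<not> (crd k \<noteq> crd l \<or> crd k = 0)"
        then have "crd k \<in> {1..s}" "{k, l} = {crd k, crd k + s}"
          using False by (auto simp: crd_def split: if_splits)
        then show False using 4(3) by blast
      qed
      then show ?thesis
        using unpaired_commute[OF 4(1,2)] by (intro mop_qcomm[OF 4(1,2)]) auto
    qed simp
    then show ?thesis
      unfolding 4(4) using 4 by (intro rel letters) auto
  qed
qed

lemma M_right_module: "right_module T M"
  using lo.right_module_Mact[of undefined undefined]
  by (simp add: M_mod_def M_free_act_def lo.wact_def[abs_def] nf_torus_def)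

lemma M_simps: "carrier M = V" "\<zero>\<^bsub>M\<^esub> = (\<lambda>a. 0)" "v \<oplus>\<^bsub>M\<^esub> w = (\<lambda>a. v a + w a)"
  by (simp_all add: M_mod_def)

lemma M_ract_cl:
  assumes "v \<in> V" "f \<in> carrier (free_algebra (nf_letters n))"
  shows "v \<cdot>\<^bsub>M\<^esub> cl f = lo.wact v f"
  using lo.Mact_cls[OF assms(2,1)] by (simp add: M_mod_def M_free_act_def lo.wact_def)

lemma M_ract_X: "v \<in> V \<Longrightarrow> k \<in> {1..n} \<Longrightarrow> v \<cdot>\<^bsub>M\<^esub> gX k = mop k v"
  by (simp add: nf_gen_def M_ract_cl fmonom_carrier letters lo.wact_fmonom)

lemma M_ract_sc: "v \<in> V \<Longrightarrow> v \<cdot>\<^bsub>M\<^esub> sc c = (\<lambda>b. c * v b)"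
  by (simp add: nf_scalar_def M_ract_cl fmonom_carrier lo.wact_fmonom)

end

section \<open>Simplicity of \<open>M(\<alpha>)\<close>\<close>

context torus_M
begin

text \<open>Raising and then lowering the \<open>i\<close>-th coordinate returns to the same index,
  so only a product of two coefficients remains.\<close>

lemma D_action:
  assumes i: "i \<in> {1..s}" and v: "v \<in> V" and a: "a \<in> idx"
  shows "(v \<cdot>\<^bsub>M\<^esub> D i) a = \<alpha> (i + s) * (q ^ h i) ^ a i * v a"
proof -
  interpret M: right_module T M by (rule M_right_module)
  have ii: "i \<in> {1..n}" "i + s \<in> {1..n}" using ix[OF i] by auto
  have "v \<cdot>\<^bsub>M\<^esub> D i = mop (i + s) (mop i v)"
    using v ii M.ract_mult[of v "gX i" "gX (i + s)"]
    by (simp add: D_def M_ract_X mop_closed M_simps)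
  moreover have a_eq: "a = shiftv (i + s) (shiftv i a)"
    using i a by (simp add: shiftv_def M_shift_shift M_shift_0)
  moreover have "mop (i + s) (mop i v) (shiftv (i + s) (shiftv i a)) = co \<alpha> (i + s) (shiftv i a) * co \<alpha> i a * v a"
    using ii a shiftv_closed by (simp add: mop_shiftv)
  moreover have "co \<alpha> (i + s) (shiftv i a) * co \<alpha> i a = \<alpha> (i + s) * (q ^ h i) ^ a i"
  proof -
    have "co \<alpha> i (shiftv (i + s) a) * co \<alpha> (i + s) a = \<alpha> (i + s) * (q ^ h i) powi (int (a i) - 1)"
      using i alpha_nonzero[OF ii(1)] by (simp add: co_def)
    moreover have "q ^ h i * (q ^ h i) powi (int (a i) - 1) = (q ^ h i) ^ a i"
      using q_nonzero by (simp add: power_int_diff)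
    ultimately show ?thesis
      using paired_commute(2)[OF i a] by (simp add: mult.left_commute[of "q ^ h i"])
  qed
  ultimately show ?thesis by simp
qed

text \<open>\<open>q ^ h i\<close> has order \<open>m div h i\<close>. Hence \<open>D i\<close> has
  different eigenvalues on basis vectors whose \<open>i\<close>-th coordinates differ.\<close>

lemma q_h_inj:
  assumes i: "i \<in> {1..s}" and x: "x < m div h i" and y: "y < m div h i" and eq: "(q ^ h i) ^ x = (q ^ h i) ^ y"
  shows "x = y"
proof -
  have *: "x = y" if "x \<le> y" "y < m div h i" "(q ^ h i) ^ x = (q ^ h i) ^ y" for x y
  proof -
    have "(q ^ h i) ^ y = (q ^ h i) ^ x * (q ^ h i) ^ (y - x)"
      using that(1) by (simp flip: power_add)
    then have "(q ^ h i) ^ (y - x) = 1" using that q_nonzero by simp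
    then have "m div h i dvd y - x" using q_h_pow[OF i] by blast
    then show ?thesis using that by (auto dest: dvd_imp_le)
  qed
  show ?thesis using *[of x y] *[of y x] x y eq by (metis nat_le_linear)
qed

lemma basis_in_V: "a \<in> idx \<Longrightarrow> M_basis a \<in> V"
  by (auto simp: M_basis_def M_space_def)

lemma mop_basis:
  assumes k: "k \<in> {1..n}" and a: "a \<in> idx"
  shows "mop k (M_basis a) = (\<lambda>b. co \<alpha> k a * M_basis (shiftv k a) b)"
proof (rule V_eqI[OF mop_closed[OF k]])
  show "(\<lambda>b. co \<alpha> k a * M_basis (shiftv k a) b) \<in> V"
    using V_closed(3) basis_in_V shiftv_closed k a by blast
  fix b assume "b \<in> idx"
  then obtain b' where "b' \<in> idx" "b = shiftv k b'" using shiftv_surj[OF k] by blast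
  then show "mop k (M_basis a) b = co \<alpha> k a * M_basis (shiftv k a) b"
    using k a by (auto simp: mop_shiftv M_basis_def shiftv_inj)
qed

text \<open>A nonzero vector of smallest support in a submodule is supported at a single index,
  because the diagonal operators \<open>D i\<close> separate indices; from one basis vector the
  shifts reach all the others.\<close>

lemma M_simple: "simple_right_module T M"
  unfolding simple_right_module_def
proof (intro conjI allI impI)
  interpret M: right_module T M by (rule M_right_module)
  show "right_module T M" by (rule M_right_module)
  have "M_basis idx0 \<in> V" "M_basis idx0 \<noteq> (\<lambda>a. 0 :: 'k)"
    using basis_in_V[OF idx0_in] by (auto simp: M_basis_def fun_eq_iff)
  then show "carrier M \<noteq> {\<zero>\<^bsub>M\<^esub>}" unfolding M_simps by blast
  fix U assume "right_submodule U T M"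
  then have U: "additive_subgroup U M" and Ut: "\<And>v t. v \<in> U \<Longrightarrow> t \<in> carrier T \<Longrightarrow> v \<cdot>\<^bsub>M\<^esub> t \<in> U"
    by (auto simp: right_submodule_def)
  interpret U: additive_subgroup U M by (rule U)
  have UV: "U \<subseteq> V" using U.a_subset by (simp add: M_simps)
  have U0: "(\<lambda>b. 0) \<in> U" using U.zero_closed by (simp add: M_simps)
  have Uadd: "(\<lambda>b. v b + w b) \<in> U" if "v \<in> U" "w \<in> U" for v w
    using U.a_closed[OF that] by (simp add: M_simps)
  have Usc: "(\<lambda>b. c * v b) \<in> U" if "v \<in> U" for v c
    using Ut[OF that T.sc_closed, of c] that UV M_ract_sc by auto
  show "U = {\<zero>\<^bsub>M\<^esub>} \<or> U = carrier M"
  proof (cases "U \<subseteq> {\<lambda>b. 0}")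
    case True
    then show ?thesis using U0 by (auto simp: M_simps)
  next
    case False
    define supp where "supp v = {a. v a \<noteq> 0}" for v :: "(nat \<Rightarrow> nat) \<Rightarrow> 'k"
    have supp: "supp v \<subseteq> idx" "finite (supp v)" if "v \<in> U" for v
    proof -
      show "supp v \<subseteq> idx" using that UV by (auto simp: supp_def M_space_def)
      then show "finite (supp v)" using idx_finite finite_subset by blast
    qed
    obtain v0 where v0: "v0 \<in> U" "v0 \<noteq> (\<lambda>b. 0)" using False by auto
    obtain v where v: "v \<in> U" "v \<noteq> (\<lambda>b. 0)" and v_min: "\<And>w. w \<in> U \<Longrightarrow> w \<noteq> (\<lambda>b. 0) \<Longrightarrow> card (supp v) \<le> card (supp w)"
      using ex_has_least_nat[of "\<lambda>v. v \<in> U \<and> v \<noteq> (\<lambda>b. 0)" v0 "\<lambda>v. card (supp v)"] v0 by blast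
    obtain a where a: "v a \<noteq> 0" using v by auto
    have a_idx: "a \<in> idx" using supp[OF v(1)] a by (auto simp: supp_def)
    have only: "b = a" if b: "v b \<noteq> 0" for b
    proof (rule ccontr)
      assume "b \<noteq> a"
      have b_idx: "b \<in> idx" using supp[OF v(1)] b by (auto simp: supp_def)
      then obtain i where i: "i \<in> {1..s}" "b i \<noteq> a i"
        using a_idx \<open>b \<noteq> a\<close> unfolding M_index_def by (metis PiE_ext)
      \<comment> \<open>\<open>D i\<close> minus its eigenvalue at \<open>a\<close> removes
        \<open>a\<close> from the support, adds no index and keeps \<open>b\<close>: the support
        shrinks without becoming empty.\<close>
      let ?w = "\<lambda>c. (v \<cdot>\<^bsub>M\<^esub> D i) c + (- (\<alpha> (i + s) * (q ^ h i) ^ a i)) * v c"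
      have w: "?w \<in> U" by (intro Uadd Ut Usc v D_closed i)
      have w_eq: "?w c = \<alpha> (i + s) * ((q ^ h i) ^ c i - (q ^ h i) ^ a i) * v c" if "c \<in> idx" for c
        using D_action[OF i(1) _ that, of v] v UV by (auto simp: algebra_simps)
      have "(q ^ h i) ^ b i \<noteq> (q ^ h i) ^ a i"
        using q_h_inj[OF i(1) idx_less[OF b_idx i(1)] idx_less[OF a_idx i(1)]] i(2) by blast
      then have "?w b \<noteq> 0"
        unfolding w_eq[OF b_idx] using b alpha_nonzero[of "i + s"] ix[OF i(1)] by simp
      then have "card (supp v) \<le> card (supp ?w)"
        by (intro v_min w) (auto simp: fun_eq_iff)
      moreover have "supp ?w \<subset> supp v"
      proof
        show "supp ?w \<subseteq> supp v"
        proof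
          fix c assume c: "c \<in> supp ?w"
          then have "c \<in> idx" using supp[OF w] by blast
          with c show "c \<in> supp v" unfolding supp_def mem_Collect_eq w_eq[OF \<open>c \<in> idx\<close>] by simp
        qed
        have "a \<notin> supp ?w" using w_eq[OF a_idx] by (simp add: supp_def)
        moreover have "a \<in> supp v" using a by (simp add: supp_def)
        ultimately show "supp ?w \<noteq> supp v" by blast
      qed
      ultimately show False
        using psubset_card_mono[OF supp(2)[OF v(1)]] by (meson leD)
    qed
    have "M_basis a = (\<lambda>b. inverse (v a) * v b)"
    proof
      fix b show "M_basis a b = inverse (v a) * v b"
        using a only[of b] by (cases "b = a") (auto simp: M_basis_def)
    qed
    then have basis_a: "M_basis a \<in> U" using Usc[OF v(1)] by simp
    have shift: "M_basis (M_shift m h i (int r) b) \<in> U" if i: "i \<in> {1..s}" and b: "b \<in> idx" "M_basis b \<in> U" for i r b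
    proof (induction r)
      case 0
      then show ?case using that by (simp add: M_shift_0)
    next
      case (Suc r)
      let ?b = "M_shift m h i (int r) b"
      have i': "i \<in> {1..n}" using ix[OF i] by blast
      have b': "?b \<in> idx" by (rule M_shift_closed[OF b(1) i])
      have "M_basis ?b \<cdot>\<^bsub>M\<^esub> gX i \<in> U" using Ut[OF Suc X_closed[OF i']] .
      then have "(\<lambda>c. co \<alpha> i ?b * M_basis (shiftv i ?b) c) \<in> U"
        using basis_in_V[OF b'] i' b' by (simp add: M_ract_X mop_basis)
      then have "(\<lambda>c. inverse (co \<alpha> i ?b) * (co \<alpha> i ?b * M_basis (shiftv i ?b) c)) \<in> U"
        by (rule Usc)
      moreover have "(\<lambda>c. inverse (co \<alpha> i ?b) * (co \<alpha> i ?b * M_basis (shiftv i ?b) c)) = M_basis (shiftv i ?b)"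
        using co_nonzero[OF i', of ?b] by (auto simp: fun_eq_iff)
      moreover have "shiftv i ?b = M_shift m h i (int (Suc r)) b"
        using i b by (simp add: shiftv_def M_shift_shift)
      ultimately show ?case by simp
    qed
    have basis: "M_basis b \<in> U" if b: "b \<in> idx" for b
    proof -
      \<comment> \<open>An interpolation from \<open>a\<close> to \<open>b\<close>, correcting one
        coordinate at a time.\<close>
      define c where "c j = (\<lambda>i. if i \<in> {1..j} then b i else a i)" for j
      have "c j \<in> idx \<and> M_basis (c j) \<in> U" if "j \<le> s" for j
        using that
      proof (induction j)
        case 0
        have "c 0 = a" by (auto simp: c_def)
        then show ?case using a_idx basis_a by simp
      next
        case (Suc j)
        have i: "Suc j \<in> {1..s}" using Suc.prems by simp
        let ?K = "m div h (Suc j)"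
        \<comment> \<open>Only nonnegative powers of a generator are applied; the added
          \<open>?K\<close> keeps \<open>r\<close> nonnegative and vanishes modulo
          \<open>?K\<close>.\<close>
        define r where "r = b (Suc j) + ?K - a (Suc j)"
        have lt: "a (Suc j) < ?K" "b (Suc j) < ?K" using idx_less i a_idx b by blast+
        then have "int (a (Suc j)) + int r = int (b (Suc j)) + int ?K" by (simp add: r_def)
        then have "nat ((int (a (Suc j)) + int r) mod int ?K) = b (Suc j)"
          using lt by simp
        then have "c (Suc j) = M_shift m h (Suc j) (int r) (c j)"
          by (auto simp: M_shift_def c_def fun_eq_iff)
        then show ?case using shift[OF i, of "c j" r] M_shift_closed[OF _ i] Suc by simp
      qed
      moreover have "c s = b"
      proof
        fix i show "c s i = b i"
          using a_idx b by (cases "i \<in> {1..s}") (auto simp: c_def M_index_def PiE_def extensional_def)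
      qed
      ultimately show ?thesis by (metis order.refl)
    qed
    have "v \<in> U" if v: "v \<in> V" for v
    proof -
      have "(\<lambda>b. if b \<in> A then v b else 0) \<in> U" if "finite A" "A \<subseteq> idx" for A
        using that
      proof (induction A rule: finite_induct)
        case empty
        then show ?case using U0 by simp
      next
        case (insert a A)
        have "(\<lambda>b. (if b \<in> A then v b else 0) + v a * M_basis a b) \<in> U"
          using insert by (intro Uadd Usc basis) auto
        moreover have "(\<lambda>b. (if b \<in> A then v b else 0) + v a * M_basis a b) = (\<lambda>b. if b \<in> insert a A then v b else 0)"
          using insert.hyps by (auto simp: M_basis_def)
        ultimately show ?case by simp
      qed
      moreover have "v = (\<lambda>b. if b \<in> idx then v b else 0)"
        using v by (auto simp: M_space_def)
      ultimately show ?thesis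
        using idx_finite by (metis order.refl)
    qed
    then show ?thesis using UV by (auto simp: M_simps)
  qed
qed

text \<open>Being simple, \<open>M(\<alpha>)\<close> is itself an instance of the general theory, so
  the centre of the torus acts on it by scalars; the restriction to \<open>Oq\<close> relies on
  this.\<close>

sublocale Mm: torus_module n s m h q M
  by (intro torus_module.intro torus_axioms simple_module_alg_closed.intro simple_module.intro
      T.scalar_algebra_axioms M_right_module simple_module_axioms.intro M_simple)

end

text \<open>Image and kernel are submodules; the vector \<open>u\<close> shows that the image is not
  zero and the kernel is not everything.\<close>

lemma schur_iso:
  assumes M: "simple_right_module A M" and N: "simple_right_module A N"
    and f: "\<And>v. v \<in> carrier M \<Longrightarrow> f v \<in> carrier N"
    and add: "\<And>v w. v \<in> carrier M \<Longrightarrow> w \<in> carrier M \<Longrightarrow> f (v \<oplus>\<^bsub>M\<^esub> w) = f v \<oplus>\<^bsub>N\<^esub> f w"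
    and act: "\<And>v r. v \<in> carrier M \<Longrightarrow> r \<in> carrier A \<Longrightarrow> f (v \<cdot>\<^bsub>M\<^esub> r) = f v \<cdot>\<^bsub>N\<^esub> r"
    and u: "u \<in> carrier M" "f u \<noteq> \<zero>\<^bsub>N\<^esub>"
  shows "f \<in> rmodule_iso A M N"
proof -
  interpret M: right_module A M using M by (simp add: simple_right_module_def)
  interpret N: right_module A N using N by (simp add: simple_right_module_def)
  have f0: "f \<zero>\<^bsub>M\<^esub> = \<zero>\<^bsub>N\<^esub>"
    using add[of "\<zero>\<^bsub>M\<^esub>" "\<zero>\<^bsub>M\<^esub>"] f[of "\<zero>\<^bsub>M\<^esub>"] by (metis M.M.l_zero M.M.zero_closed N.M.add.r_cancel_one)
  have fm: "f (\<ominus>\<^bsub>M\<^esub> v) = \<ominus>\<^bsub>N\<^esub> f v" if "v \<in> carrier M" for v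
    using add[of "\<ominus>\<^bsub>M\<^esub> v" v] f that f0 by (metis M.M.a_inv_closed M.M.l_neg N.M.minus_equality)
  have "right_submodule (f ` carrier M) A N"
    unfolding right_submodule_def
  proof (intro conjI ballI)
    show "additive_subgroup (f ` carrier M) N"
    proof (intro additive_subgroupI N.M.add.subgroupI)
      fix x y assume "x \<in> f ` carrier M" "y \<in> f ` carrier M"
      then obtain v w where "v \<in> carrier M" "w \<in> carrier M" "x = f v" "y = f w" by blast
      then show "x \<oplus>\<^bsub>N\<^esub> y \<in> f ` carrier M" "\<ominus>\<^bsub>N\<^esub> x \<in> f ` carrier M"
        using add[of v w] fm[of v] by (metis M.M.a_closed imageI, metis M.M.a_inv_closed imageI)
    qed (use f u in auto)
    fix x r assume "x \<in> f ` carrier M" "r \<in> carrier A"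
    then show "x \<cdot>\<^bsub>N\<^esub> r \<in> f ` carrier M"
      using act M.ract_closed by (auto simp: image_iff) (metis)
  qed
  then have surj: "f ` carrier M = carrier N"
    using N u unfolding simple_right_module_def by blast
  have "right_submodule {v\<in>carrier M. f v = \<zero>\<^bsub>N\<^esub>} A M"
    unfolding right_submodule_def
  proof (intro conjI ballI)
    show "additive_subgroup {v\<in>carrier M. f v = \<zero>\<^bsub>N\<^esub>} M"
      by (intro additive_subgroupI M.M.add.subgroupI) (use f0 fm add in auto)
    fix v r assume "v \<in> {v\<in>carrier M. f v = \<zero>\<^bsub>N\<^esub>}" "r \<in> carrier A"
    then show "v \<cdot>\<^bsub>M\<^esub> r \<in> {v\<in>carrier M. f v = \<zero>\<^bsub>N\<^esub>}"
      using act M.ract_closed N.ract_zero_left by auto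
  qed
  then have ker: "{v\<in>carrier M. f v = \<zero>\<^bsub>N\<^esub>} = {\<zero>\<^bsub>M\<^esub>}"
    using M u unfolding simple_right_module_def by blast
  have "inj_on f (carrier M)"
  proof (rule inj_onI)
    fix v w assume vw: "v \<in> carrier M" "w \<in> carrier M" "f v = f w"
    then have "f (v \<oplus>\<^bsub>M\<^esub> \<ominus>\<^bsub>M\<^esub> w) = \<zero>\<^bsub>N\<^esub>"
      using f[of w] by (simp add: add fm N.M.r_neg)
    then have "v \<oplus>\<^bsub>M\<^esub> \<ominus>\<^bsub>M\<^esub> w = \<zero>\<^bsub>M\<^esub>" using ker vw by blast
    then show "v = w" using vw by (metis M.M.a_inv_closed M.M.minus_equality M.M.minus_minus)
  qed
  then show ?thesis
    using surj add act by (simp add: rmodule_iso_def bij_betw_def)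
qed

text \<open>The linear map sending the basis vector of index \<open>a\<close> to \<open>E a\<close>
  respects the generators and is nonzero at \<open>idx0\<close>. As both modules are simple, Schur's
  lemma gives bijectivity, and with it that the \<open>E a\<close> form a basis.\<close>

lemma (in torus_module) iso_M:
  "\<exists>\<alpha>\<in>Kstar n. \<exists>f. f \<in> rmodule_iso T (M_mod s m h q \<alpha>) N"
proof -
  obtain \<alpha> E where \<alpha>: "\<alpha> \<in> Kstar n" and E: "\<And>a. E a \<in> carrier N" and E0: "E idx0 \<noteq> \<zero>\<^bsub>N\<^esub>"
    and EX: "\<And>k a. k \<in> {1..n} \<Longrightarrow> a \<in> idx \<Longrightarrow> E a \<cdot>\<^bsub>N\<^esub> gX k = E (shiftv k a) \<cdot>\<^bsub>N\<^esub> sc (co \<alpha> k a)"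
    by (rule exists_M_basis) blast
  interpret torus_M n s m h q \<alpha> by unfold_locales (rule \<alpha>)
  define f where "f v = (\<Oplus>\<^bsub>N\<^esub>a\<in>idx. E a \<cdot>\<^bsub>N\<^esub> sc (v a))" for v
  have tm: "E a \<cdot>\<^bsub>N\<^esub> sc c \<in> carrier N" for a c using E N.N.ract_closed by simp
  have f_closed: "f v \<in> carrier N" for v
    unfolding f_def by (intro N.N.M.finsum_closed) (auto simp: tm)
  have f_add: "f (\<lambda>a. v a + w a) = f v \<oplus>\<^bsub>N\<^esub> f w" for v w
  proof -
    have "f (\<lambda>a. v a + w a) = (\<Oplus>\<^bsub>N\<^esub>a\<in>idx. E a \<cdot>\<^bsub>N\<^esub> sc (v a) \<oplus>\<^bsub>N\<^esub> E a \<cdot>\<^bsub>N\<^esub> sc (w a))"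
      unfolding f_def by (intro N.N.M.finsum_cong') (simp_all add: tm T.sc_add N.N.ract_add_right E)
    also have "\<dots> = f v \<oplus>\<^bsub>N\<^esub> f w"
      unfolding f_def by (rule N.N.M.finsum_addf) (auto simp: tm)
    finally show ?thesis .
  qed
  have sum_ract: "(\<Oplus>\<^bsub>N\<^esub>a\<in>A. g a) \<cdot>\<^bsub>N\<^esub> t = (\<Oplus>\<^bsub>N\<^esub>a\<in>A. g a \<cdot>\<^bsub>N\<^esub> t)" if "finite A" "g \<in> A \<rightarrow> carrier N" "t \<in> carrier T"
    for A t and g :: "(nat \<Rightarrow> nat) \<Rightarrow> 'v"
    using that
  proof (induction A rule: finite_induct)
    case empty
    then show ?case by (simp add: N.N.ract_zero_left)
  next
    case (insert a A)
    have "(\<lambda>a. g a \<cdot>\<^bsub>N\<^esub> t) \<in> A \<rightarrow> carrier N" "g a \<cdot>\<^bsub>N\<^esub> t \<in> carrier N"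
      using insert N.N.ract_closed by auto
    then show ?case
      using insert by (simp add: N.N.M.finsum_insert N.N.ract_add_left N.N.M.finsum_closed)
  qed
  have f_sc: "f (\<lambda>b. c * v b) = f v \<cdot>\<^bsub>N\<^esub> sc c" for v c
  proof -
    have "f v \<cdot>\<^bsub>N\<^esub> sc c = (\<Oplus>\<^bsub>N\<^esub>a\<in>idx. E a \<cdot>\<^bsub>N\<^esub> sc (v a) \<cdot>\<^bsub>N\<^esub> sc c)"
      unfolding f_def by (rule sum_ract) (auto simp: idx_finite tm)
    also have "\<dots> = f (\<lambda>b. c * v b)"
      unfolding f_def
      by (intro N.N.M.finsum_cong') (simp_all add: tm mult.commute[of c] T.sc_mult N.N.ract_mult N.N.ract_closed E)
    finally show ?thesis by simp
  qed
  have f_X: "f (mop k v) = f v \<cdot>\<^bsub>N\<^esub> gX k" if k: "k \<in> {1..n}" for k v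
  proof -
    have inj: "inj_on (shiftv k) idx" and im: "shiftv k ` idx = idx"
      using shiftv_bij[OF k] by (auto simp: bij_betw_def)
    have "f v \<cdot>\<^bsub>N\<^esub> gX k = (\<Oplus>\<^bsub>N\<^esub>a\<in>idx. E a \<cdot>\<^bsub>N\<^esub> sc (v a) \<cdot>\<^bsub>N\<^esub> gX k)"
      unfolding f_def by (rule sum_ract) (use k in \<open>auto simp: idx_finite tm\<close>)
    also have "\<dots> = (\<Oplus>\<^bsub>N\<^esub>a\<in>idx. E (shiftv k a) \<cdot>\<^bsub>N\<^esub> sc (mop k v (shiftv k a)))"
    proof (intro N.N.M.finsum_cong' refl)
      fix a assume a: "a \<in> idx"
      have "E a \<cdot>\<^bsub>N\<^esub> sc (v a) \<cdot>\<^bsub>N\<^esub> gX k = E a \<cdot>\<^bsub>N\<^esub> gX k \<cdot>\<^bsub>N\<^esub> sc (v a)"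
        using N.N.ract_mult[OF E T.sc_closed X_closed[OF k]] N.N.ract_mult[OF E X_closed[OF k] T.sc_closed]
          T.sc_comm[OF X_closed[OF k]] by simp
      then show "E a \<cdot>\<^bsub>N\<^esub> sc (v a) \<cdot>\<^bsub>N\<^esub> gX k = E (shiftv k a) \<cdot>\<^bsub>N\<^esub> sc (mop k v (shiftv k a))"
        using E by (simp add: EX[OF k a] mop_shiftv[OF k a] T.sc_mult N.N.ract_mult)
    qed (auto simp: tm)
    also have "\<dots> = (\<Oplus>\<^bsub>N\<^esub>a\<in>shiftv k ` idx. E a \<cdot>\<^bsub>N\<^esub> sc (mop k v a))"
      by (rule N.N.M.finsum_reindex[symmetric, OF _ inj]) (auto simp: tm)
    finally show ?thesis by (simp add: im f_def)
  qed
  have f_gX: "f (v \<cdot>\<^bsub>M\<^esub> gX k) = f v \<cdot>\<^bsub>N\<^esub> gX k" if "k \<in> {1..n}" "v \<in> carrier M" for k v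
    using that f_X by (simp add: M_simps M_ract_X)
  have "f \<in> rmodule_iso T M N"
  proof (rule schur_iso[OF M_simple N.simple])
    show "M_basis idx0 \<in> carrier M" using basis_in_V[OF idx0_in] by (simp add: M_simps)
    have "f (M_basis idx0) = (\<Oplus>\<^bsub>N\<^esub>a\<in>idx. if idx0 = a then E a else \<zero>\<^bsub>N\<^esub>)"
      unfolding f_def using E
      by (intro N.N.M.finsum_cong') (auto simp: M_basis_def T.sc_one T.sc_zero N.N.ract_one N.N.ract_zero_right)
    also have "\<dots> = E idx0"
      using idx0_in idx_finite E by (intro N.N.M.finsum_singleton) auto
    finally show "f (M_basis idx0) \<noteq> \<zero>\<^bsub>N\<^esub>" using E0 by simp
    show "f v \<in> carrier N" for v by (rule f_closed)
    show addM: "f (v \<oplus>\<^bsub>M\<^esub> w) = f v \<oplus>\<^bsub>N\<^esub> f w" for v w by (simp add: M_simps f_add)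
    fix v t assume v: "v \<in> carrier M" and t: "t \<in> carrier T"
    show "f (v \<cdot>\<^bsub>M\<^esub> t) = f v \<cdot>\<^bsub>N\<^esub> t"
    proof (rule T.hom_if_gen[OF M_right_module N.N.right_module_axioms f_closed addM _ _ v t])
      fix v c assume "v \<in> carrier M"
      then show "f (v \<cdot>\<^bsub>M\<^esub> sc c) = f v \<cdot>\<^bsub>N\<^esub> sc c"
        by (simp add: M_simps M_ract_sc f_sc)
    next
      fix v l assume v: "v \<in> carrier M" and "l \<in> nf_letters n"
      then consider k where "k \<in> {1..n}" "l = Tgen k" | k where "k \<in> {1..n}" "l = Tinv k"
        by (auto simp: nf_letters_def)
      then show "f (v \<cdot>\<^bsub>M\<^esub> cl (fmonom 1 [l])) = f v \<cdot>\<^bsub>N\<^esub> cl (fmonom 1 [l])"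
      proof cases
        case 1
        then show ?thesis using f_gX[OF 1(1) v] by (simp add: nf_gen_def)
      next
        case 2
        have c: "gX k \<in> carrier T" "gXi k \<in> carrier T" using 2 by simp_all
        have u: "v \<cdot>\<^bsub>M\<^esub> gXi k \<in> carrier M" using v c Mm.N.N.ract_closed by blast
        \<comment> \<open>Compatibility with a generator carries over to its inverse:
          \<open>v\<close> is the image of its translate by the inverse.\<close>
        have "f v = f (v \<cdot>\<^bsub>M\<^esub> gXi k \<cdot>\<^bsub>M\<^esub> gX k)"
          using Mm.N.N.ract_mult[OF v c(2,1)] X_Xi(2)[OF 2(1)] Mm.N.N.ract_one[OF v] by simp
        also have "\<dots> = f (v \<cdot>\<^bsub>M\<^esub> gXi k) \<cdot>\<^bsub>N\<^esub> gX k" by (rule f_gX[OF 2(1) u])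
        finally have "f v \<cdot>\<^bsub>N\<^esub> gXi k = f (v \<cdot>\<^bsub>M\<^esub> gXi k) \<cdot>\<^bsub>N\<^esub> (gX k \<otimes>\<^bsub>T\<^esub> gXi k)"
          using f_closed c by (simp add: N.N.ract_mult)
        then have "f v \<cdot>\<^bsub>N\<^esub> gXi k = f (v \<cdot>\<^bsub>M\<^esub> gXi k)"
          using 2 f_closed by (simp add: X_Xi N.N.ract_one)
        then show ?thesis
          using 2 by (simp add: gXi_def)
      qed
    qed
  qed
  then show ?thesis using \<alpha> by blast
qed

section \<open>Localization at normal elements with central multiples\<close>

text \<open>Restricting or extending the action yields a module record over another ring; this
  carries additive subgroups across.\<close>

lemma additive_subgroup_cong:
  assumes "carrier M = carrier N" "add M = add N" "\<zero>\<^bsub>M\<^esub> = \<zero>\<^bsub>N\<^esub>"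
  shows "additive_subgroup U M \<longleftrightarrow> additive_subgroup U N"
  using assms by (simp add: additive_subgroup_def subgroup_def m_inv_def)

lemma abelian_group_cong:
  assumes "abelian_group M" and eq: "carrier N = carrier M" "add N = add M" "\<zero>\<^bsub>N\<^esub> = \<zero>\<^bsub>M\<^esub>"
  shows "abelian_group N"
proof -
  interpret M: abelian_group M by fact
  show ?thesis
  proof (rule abelian_groupI)
    fix x assume "x \<in> carrier N"
    then show "\<exists>y\<in>carrier N. y \<oplus>\<^bsub>N\<^esub> x = \<zero>\<^bsub>N\<^esub>"
      using M.l_neg[of x] M.a_inv_closed[of x] by (auto simp: eq)
  qed (simp_all add: eq M.a_ac)
qed

text \<open>\<open>central_multiple\<close> takes the place of Ore manipulations: every denominator
  divides a central one in \<open>S\<close>, so common denominators are plain products.\<close>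

locale central_localization = R: ring R + T: ring T
  for R :: "('r, 'x) ring_scheme" and T :: "('t, 'y) ring_scheme" +
  fixes S :: "'r set" and j :: "'r \<Rightarrow> 't"
  assumes loc: "is_localization R S T j"
    and S_carrier: "S \<subseteq> carrier R" and S_one: "\<one>\<^bsub>R\<^esub> \<in> S"
    and S_mult: "\<And>t u. t \<in> S \<Longrightarrow> u \<in> S \<Longrightarrow> t \<otimes>\<^bsub>R\<^esub> u \<in> S"
    and central_multiple: "\<And>t. t \<in> S \<Longrightarrow> \<exists>u\<in>carrier R. t \<otimes>\<^bsub>R\<^esub> u \<in> S \<and>
          (\<forall>x\<in>carrier R. (t \<otimes>\<^bsub>R\<^esub> u) \<otimes>\<^bsub>R\<^esub> x = x \<otimes>\<^bsub>R\<^esub> (t \<otimes>\<^bsub>R\<^esub> u))"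
begin

lemma j_hom: "j \<in> ring_hom R T"
  using loc by (simp add: is_localization_def)

lemma j_closed [simp]: "r \<in> carrier R \<Longrightarrow> j r \<in> carrier T"
  using ring_hom_closed[OF j_hom] .

lemma j_mult: "r \<in> carrier R \<Longrightarrow> r' \<in> carrier R \<Longrightarrow> j (r \<otimes>\<^bsub>R\<^esub> r') = j r \<otimes>\<^bsub>T\<^esub> j r'"
  using ring_hom_mult[OF j_hom] .

lemma j_add: "r \<in> carrier R \<Longrightarrow> r' \<in> carrier R \<Longrightarrow> j (r \<oplus>\<^bsub>R\<^esub> r') = j r \<oplus>\<^bsub>T\<^esub> j r'"
  using ring_hom_add[OF j_hom] .

lemma j_one: "j \<one>\<^bsub>R\<^esub> = \<one>\<^bsub>T\<^esub>"
  using ring_hom_one[OF j_hom] .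

lemma j_unit: "t \<in> S \<Longrightarrow> j t \<in> Units T"
  using loc by (simp add: is_localization_def)

text \<open>The kernel of the localization map consists of the elements killed by some
  denominator.\<close>

lemma j_eq_cancel:
  assumes "r \<in> carrier R" "r' \<in> carrier R" "j r = j r'"
  shows "\<exists>t\<in>S. r \<otimes>\<^bsub>R\<^esub> t = r' \<otimes>\<^bsub>R\<^esub> t"
proof -
  interpret j: ring_hom_ring R T j
    by (intro ring_hom_ringI2 R.ring_axioms T.ring_axioms j_hom)
  have "j (r \<ominus>\<^bsub>R\<^esub> r') = \<zero>\<^bsub>T\<^esub>"
    using assms by (simp add: a_minus_def T.r_neg)
  then obtain t where t: "t \<in> S" "(r \<ominus>\<^bsub>R\<^esub> r') \<otimes>\<^bsub>R\<^esub> t = \<zero>\<^bsub>R\<^esub>"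
    using loc assms by (auto simp: is_localization_def)
  then have tR: "t \<in> carrier R" using S_carrier by auto
  have "r \<otimes>\<^bsub>R\<^esub> t \<ominus>\<^bsub>R\<^esub> r' \<otimes>\<^bsub>R\<^esub> t = \<zero>\<^bsub>R\<^esub>"
    using t assms tR by (simp add: a_minus_def R.l_distr R.l_minus)
  then show ?thesis using t assms tR R.r_right_minus_eq by auto
qed

definition Z :: "'r set" where
  "Z = {z\<in>S. \<forall>x\<in>carrier R. z \<otimes>\<^bsub>R\<^esub> x = x \<otimes>\<^bsub>R\<^esub> z}"

lemma Z_carrier: "z \<in> Z \<Longrightarrow> z \<in> carrier R"
  using S_carrier by (auto simp: Z_def)

lemma Z_comm: "z \<in> Z \<Longrightarrow> x \<in> carrier R \<Longrightarrow> z \<otimes>\<^bsub>R\<^esub> x = x \<otimes>\<^bsub>R\<^esub> z"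
  by (simp add: Z_def)

lemma Z_one: "\<one>\<^bsub>R\<^esub> \<in> Z"
  by (simp add: Z_def S_one)

lemma Z_mult: "z \<in> Z \<Longrightarrow> z' \<in> Z \<Longrightarrow> z \<otimes>\<^bsub>R\<^esub> z' \<in> Z"
proof -
  assume z: "z \<in> Z" and z': "z' \<in> Z"
  have c: "z \<in> carrier R" "z' \<in> carrier R" using z z' Z_carrier by auto
  have "z \<otimes>\<^bsub>R\<^esub> z' \<otimes>\<^bsub>R\<^esub> x = x \<otimes>\<^bsub>R\<^esub> (z \<otimes>\<^bsub>R\<^esub> z')" if x: "x \<in> carrier R" for x
  proof -
    have "z \<otimes>\<^bsub>R\<^esub> z' \<otimes>\<^bsub>R\<^esub> x = z \<otimes>\<^bsub>R\<^esub> (x \<otimes>\<^bsub>R\<^esub> z')"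
      using c x by (simp only: R.m_assoc Z_comm[OF z' x])
    also have "\<dots> = x \<otimes>\<^bsub>R\<^esub> (z \<otimes>\<^bsub>R\<^esub> z')"
      using c x by (simp only: R.m_assoc[symmetric] Z_comm[OF z x])
    finally show ?thesis .
  qed
  then show ?thesis using z z' S_mult by (simp add: Z_def)
qed

lemma Z_unit: "z \<in> Z \<Longrightarrow> j z \<in> Units T"
  using j_unit by (simp add: Z_def)

text \<open>Expand a fraction with denominator \<open>t\<close> by a factor \<open>u\<close> for
  which \<open>t u\<close> is central.\<close>

lemma fraction:
  assumes "a \<in> carrier T"
  obtains r z where "r \<in> carrier R" "z \<in> Z" "a \<otimes>\<^bsub>T\<^esub> j z = j r"
proof -
  obtain r t where r: "r \<in> carrier R" "t \<in> S" "a = j r \<otimes>\<^bsub>T\<^esub> inv\<^bsub>T\<^esub> (j t)"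
    using loc assms by (auto simp: is_localization_def)
  obtain u where u: "u \<in> carrier R" "t \<otimes>\<^bsub>R\<^esub> u \<in> Z"
    using central_multiple[OF r(2)] by (auto simp: Z_def)
  have t: "t \<in> carrier R" "j t \<in> Units T" using r S_carrier j_unit by auto
  note c = j_closed[OF r(1)] j_closed[OF u(1)] T.Units_closed[OF t(2)] T.Units_inv_closed[OF t(2)]
  have "a \<otimes>\<^bsub>T\<^esub> j (t \<otimes>\<^bsub>R\<^esub> u) = j r \<otimes>\<^bsub>T\<^esub> (inv\<^bsub>T\<^esub> (j t) \<otimes>\<^bsub>T\<^esub> j t) \<otimes>\<^bsub>T\<^esub> j u"
    using c by (simp only: r(3) j_mult[OF t(1) u(1)] T.m_assoc T.m_closed)
  also have "\<dots> = j (r \<otimes>\<^bsub>R\<^esub> u)"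
    using c by (simp only: T.Units_l_inv[OF t(2)] T.r_one j_mult[OF r(1) u(1)])
  finally show ?thesis using that r u by blast
qed

text \<open>Elements of \<open>Z\<close> are central in \<open>R\<close> by definition. Multiplied
  by a central denominator of \<open>a\<close>, the claim becomes one about \<open>R\<close>, and
  the denominator is a unit.\<close>

lemma j_Z_comm:
  assumes z: "z \<in> Z" and a: "a \<in> carrier T"
  shows "j z \<otimes>\<^bsub>T\<^esub> a = a \<otimes>\<^bsub>T\<^esub> j z"
proof -
  obtain r z' where r: "r \<in> carrier R" "z' \<in> Z" "a \<otimes>\<^bsub>T\<^esub> j z' = j r" by (rule fraction[OF a])
  have c: "j z \<in> carrier T" "j z' \<in> carrier T" using Z_carrier z r by auto
  have "j z \<otimes>\<^bsub>T\<^esub> a \<otimes>\<^bsub>T\<^esub> j z' = j (z \<otimes>\<^bsub>R\<^esub> r)"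
    using c a r Z_carrier[OF z] by (simp add: T.m_assoc j_mult)
  also have "\<dots> = a \<otimes>\<^bsub>T\<^esub> (j z' \<otimes>\<^bsub>T\<^esub> j z)"
    using c a r Z_carrier z Z_comm[OF z r(1)] by (simp add: j_mult flip: T.m_assoc r(3))
  also have "j z' \<otimes>\<^bsub>T\<^esub> j z = j z \<otimes>\<^bsub>T\<^esub> j z'"
    using Z_comm[OF z Z_carrier[OF r(2)]] Z_carrier z r by (simp flip: j_mult)
  finally have "j z \<otimes>\<^bsub>T\<^esub> a \<otimes>\<^bsub>T\<^esub> j z' = a \<otimes>\<^bsub>T\<^esub> j z \<otimes>\<^bsub>T\<^esub> j z'"
    using c a by (simp add: T.m_assoc)
  then have "j z \<otimes>\<^bsub>T\<^esub> a \<otimes>\<^bsub>T\<^esub> j z' \<otimes>\<^bsub>T\<^esub> inv\<^bsub>T\<^esub> (j z') = a \<otimes>\<^bsub>T\<^esub> j z \<otimes>\<^bsub>T\<^esub> j z' \<otimes>\<^bsub>T\<^esub> inv\<^bsub>T\<^esub> (j z')"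
    by simp
  then show ?thesis
    using c a Z_unit[OF r(2)] by (simp add: T.m_assoc)
qed

text \<open>Every element of \<open>T\<close> is some \<open>j r\<close> times the inverse of a
  central denominator, and by \<open>inv\<close> such inverses act on this module like elements of
  \<open>R\<close>.\<close>

lemma restrict_submodule:
  assumes M: "right_module T M" and U: "right_submodule U R (restrict_along j M)"
    and inv: "\<And>z. z \<in> Z \<Longrightarrow> \<exists>r\<in>carrier R. \<forall>v\<in>carrier M. v \<cdot>\<^bsub>M\<^esub> inv\<^bsub>T\<^esub> (j z) = v \<cdot>\<^bsub>M\<^esub> j r"
  shows "right_submodule U T M"
proof -
  interpret M: right_module T M by (rule M)
  have Us: "additive_subgroup U M"
    using U additive_subgroup_cong[of "restrict_along j M" M U]
    by (simp add: right_submodule_def restrict_along_def)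
  have Uj: "v \<cdot>\<^bsub>M\<^esub> j r \<in> U" if "v \<in> U" "r \<in> carrier R" for v r
    using U that by (simp add: right_submodule_def restrict_along_def)
  show ?thesis
    unfolding right_submodule_def
  proof (intro conjI ballI Us)
    fix v a assume v: "v \<in> U" and a: "a \<in> carrier T"
    have vM: "v \<in> carrier M" using v additive_subgroup.a_subset[OF Us] by auto
    obtain r z where r: "r \<in> carrier R" "z \<in> Z" "a \<otimes>\<^bsub>T\<^esub> j z = j r" by (rule fraction[OF a])
    have u: "j z \<in> Units T" by (rule Z_unit[OF r(2)])
    have "a = j r \<otimes>\<^bsub>T\<^esub> inv\<^bsub>T\<^esub> (j z)"
      using a u by (simp add: T.m_assoc T.Units_closed flip: r(3))
    then have "v \<cdot>\<^bsub>M\<^esub> a = v \<cdot>\<^bsub>M\<^esub> j r \<cdot>\<^bsub>M\<^esub> inv\<^bsub>T\<^esub> (j z)"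
      using vM r u by (simp add: M.ract_mult)
    moreover obtain r' where "r' \<in> carrier R" "\<forall>v\<in>carrier M. v \<cdot>\<^bsub>M\<^esub> inv\<^bsub>T\<^esub> (j z) = v \<cdot>\<^bsub>M\<^esub> j r'"
      using inv[OF r(2)] by blast
    ultimately show "v \<cdot>\<^bsub>M\<^esub> a \<in> U"
      using Uj[OF Uj[OF v r(1)], of r'] vM r M.ract_closed by simp
  qed
qed

text \<open>If \<open>a\<close> is the fraction of \<open>r\<close> by a central \<open>z\<close>,
  then \<open>v a\<close> can only be the unique \<open>w\<close> with \<open>w z = v r\<close>;
  bijectivity of the denominators makes this a definition.\<close>

lemma extend_module:
  fixes N :: "('r, 'v) rmodule"
  assumes N: "right_module R N" and bij: "\<And>t. t \<in> S \<Longrightarrow> bij_betw (\<lambda>v. v \<cdot>\<^bsub>N\<^esub> t) (carrier N) (carrier N)"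
  obtains N' :: "('t, 'v) rmodule" where "right_module T N'" "carrier N' = carrier N" "add N' = add N"
    "\<zero>\<^bsub>N'\<^esub> = \<zero>\<^bsub>N\<^esub>" "\<And>v r. v \<in> carrier N \<Longrightarrow> r \<in> carrier R \<Longrightarrow> v \<cdot>\<^bsub>N'\<^esub> j r = v \<cdot>\<^bsub>N\<^esub> r"
proof -
  interpret N: right_module R N by (rule N)
  define act where "act v a = (THE w. w \<in> carrier N \<and>
    (\<exists>r\<in>carrier R. \<exists>z\<in>Z. a \<otimes>\<^bsub>T\<^esub> j z = j r \<and> w \<cdot>\<^bsub>N\<^esub> z = v \<cdot>\<^bsub>N\<^esub> r))" for v a
  have inj: "v = w" if "t \<in> S" "v \<in> carrier N" "w \<in> carrier N" "v \<cdot>\<^bsub>N\<^esub> t = w \<cdot>\<^bsub>N\<^esub> t" for t v w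
    using bij[OF that(1)] that by (auto simp: bij_betw_def inj_on_def)
  have ZS: "z \<in> S" if "z \<in> Z" for z using that by (simp add: Z_def)
  have swap: "v \<cdot>\<^bsub>N\<^esub> z \<cdot>\<^bsub>N\<^esub> r = v \<cdot>\<^bsub>N\<^esub> r \<cdot>\<^bsub>N\<^esub> z" if "v \<in> carrier N" "z \<in> Z" "r \<in> carrier R" for v z r
    using N.ract_mult[of v z r] N.ract_mult[of v r z] that Z_carrier Z_comm by simp
  \<comment> \<open>Independence of the chosen fraction: \<open>r z'\<close> and \<open>r' z\<close>
    have equal images in \<open>T\<close>, so they agree after multiplication by some
    \<open>t\<close>, and \<open>t\<close>, \<open>z\<close> and \<open>z'\<close> all act
    injectively.\<close>
  have uniq: "w = w'" if v: "v \<in> carrier N" and a: "a \<in> carrier T"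
    and w: "w \<in> carrier N" "r \<in> carrier R" "z \<in> Z" "a \<otimes>\<^bsub>T\<^esub> j z = j r" "w \<cdot>\<^bsub>N\<^esub> z = v \<cdot>\<^bsub>N\<^esub> r"
    and w': "w' \<in> carrier N" "r' \<in> carrier R" "z' \<in> Z" "a \<otimes>\<^bsub>T\<^esub> j z' = j r'" "w' \<cdot>\<^bsub>N\<^esub> z' = v \<cdot>\<^bsub>N\<^esub> r'"
    for v a w r z w' r' z'
  proof -
    have zc: "z \<in> carrier R" "z' \<in> carrier R" using w w' Z_carrier by auto
    have "j (r \<otimes>\<^bsub>R\<^esub> z') = a \<otimes>\<^bsub>T\<^esub> (j z \<otimes>\<^bsub>T\<^esub> j z')"
      using w zc a by (simp add: j_mult T.m_assoc flip: w(4))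
    also have "j z \<otimes>\<^bsub>T\<^esub> j z' = j z' \<otimes>\<^bsub>T\<^esub> j z"
      using zc Z_comm[OF w(3) zc(2)] by (simp flip: j_mult)
    also have "a \<otimes>\<^bsub>T\<^esub> (j z' \<otimes>\<^bsub>T\<^esub> j z) = j (r' \<otimes>\<^bsub>R\<^esub> z)"
      using w' zc a by (simp add: j_mult T.m_assoc flip: w'(4))
    finally obtain t where t: "t \<in> S" "r \<otimes>\<^bsub>R\<^esub> z' \<otimes>\<^bsub>R\<^esub> t = r' \<otimes>\<^bsub>R\<^esub> z \<otimes>\<^bsub>R\<^esub> t"
      using j_eq_cancel[of "r \<otimes>\<^bsub>R\<^esub> z'" "r' \<otimes>\<^bsub>R\<^esub> z"] w w' zc by auto
    have tc: "t \<in> carrier R" using t S_carrier by auto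
    have "v \<cdot>\<^bsub>N\<^esub> r \<cdot>\<^bsub>N\<^esub> z' \<cdot>\<^bsub>N\<^esub> t = v \<cdot>\<^bsub>N\<^esub> (r \<otimes>\<^bsub>R\<^esub> z' \<otimes>\<^bsub>R\<^esub> t)"
      using v w zc tc by (simp only: N.ract_mult R.m_closed)
    also have "\<dots> = v \<cdot>\<^bsub>N\<^esub> r' \<cdot>\<^bsub>N\<^esub> z \<cdot>\<^bsub>N\<^esub> t"
      using v w' zc tc by (simp only: t(2) N.ract_mult R.m_closed)
    finally have "v \<cdot>\<^bsub>N\<^esub> r \<cdot>\<^bsub>N\<^esub> z' = v \<cdot>\<^bsub>N\<^esub> r' \<cdot>\<^bsub>N\<^esub> z"
      using inj[OF t(1)] v w w' zc N.ract_closed by simp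
    then have "w \<cdot>\<^bsub>N\<^esub> z \<cdot>\<^bsub>N\<^esub> z' = w' \<cdot>\<^bsub>N\<^esub> z \<cdot>\<^bsub>N\<^esub> z'"
      using swap[OF w'(1) w(3) zc(2)] by (simp add: w(5) w'(5))
    then have "w \<cdot>\<^bsub>N\<^esub> z = w' \<cdot>\<^bsub>N\<^esub> z"
      by (rule inj[OF ZS[OF w'(3)] N.ract_closed[OF w(1) zc(1)] N.ract_closed[OF w'(1) zc(1)]])
    then show ?thesis by (rule inj[OF ZS[OF w(3)] w(1) w'(1)])
  qed
  have actI: "act v a = w" if "v \<in> carrier N" "a \<in> carrier T" "w \<in> carrier N" "r \<in> carrier R" "z \<in> Z"
      "a \<otimes>\<^bsub>T\<^esub> j z = j r" "w \<cdot>\<^bsub>N\<^esub> z = v \<cdot>\<^bsub>N\<^esub> r" for v a w r z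
    unfolding act_def
  proof (rule the_equality)
    show "w \<in> carrier N \<and> (\<exists>r\<in>carrier R. \<exists>z\<in>Z. a \<otimes>\<^bsub>T\<^esub> j z = j r \<and> w \<cdot>\<^bsub>N\<^esub> z = v \<cdot>\<^bsub>N\<^esub> r)"
      using that by blast
    fix w' assume "w' \<in> carrier N \<and> (\<exists>r\<in>carrier R. \<exists>z\<in>Z. a \<otimes>\<^bsub>T\<^esub> j z = j r \<and> w' \<cdot>\<^bsub>N\<^esub> z = v \<cdot>\<^bsub>N\<^esub> r)"
    then obtain r' z' where "w' \<in> carrier N" "r' \<in> carrier R" "z' \<in> Z" "a \<otimes>\<^bsub>T\<^esub> j z' = j r'" "w' \<cdot>\<^bsub>N\<^esub> z' = v \<cdot>\<^bsub>N\<^esub> r'" by blast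
    then show "w' = w" using uniq[OF that(1,2) _ _ _ _ _ that(3-7)] by blast
  qed
  have actE: "act v a \<in> carrier N" "act v a \<cdot>\<^bsub>N\<^esub> z = v \<cdot>\<^bsub>N\<^esub> r"
    if v: "v \<in> carrier N" and a: "a \<in> carrier T" and r: "r \<in> carrier R" and z: "z \<in> Z" and eq: "a \<otimes>\<^bsub>T\<^esub> j z = j r" for v a r z
  proof -
    have "v \<cdot>\<^bsub>N\<^esub> r \<in> (\<lambda>v. v \<cdot>\<^bsub>N\<^esub> z) ` carrier N"
      using bij[OF ZS[OF z]] N.ract_closed[OF v r] by (simp add: bij_betw_def)
    then obtain w where w: "w \<in> carrier N" "w \<cdot>\<^bsub>N\<^esub> z = v \<cdot>\<^bsub>N\<^esub> r" by auto
    have "act v a = w" by (rule actI[OF v a w(1) r z eq w(2)])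
    then show "act v a \<in> carrier N" "act v a \<cdot>\<^bsub>N\<^esub> z = v \<cdot>\<^bsub>N\<^esub> r" using w by auto
  qed
  define N' :: "('t, 'v) rmodule" where
    "N' = \<lparr>carrier = carrier N, monoid.mult = monoid.mult N, one = \<one>\<^bsub>N\<^esub>, zero = \<zero>\<^bsub>N\<^esub>, add = add N, ract = act\<rparr>"
  have N'_simps: "carrier N' = carrier N" "add N' = add N" "\<zero>\<^bsub>N'\<^esub> = \<zero>\<^bsub>N\<^esub>" "ract N' = act"
    by (simp_all add: N'_def)
  have closed: "act v a \<in> carrier N" if "v \<in> carrier N" "a \<in> carrier T" for v a
    using fraction[OF that(2)] actE(1)[OF that] by metis
  have jr: "act v (j r) = v \<cdot>\<^bsub>N\<^esub> r" if "v \<in> carrier N" "r \<in> carrier R" for v r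
    by (rule actI[OF _ _ _ that(2) Z_one]) (use that in \<open>simp_all add: j_one N.ract_closed N.ract_one\<close>)
  have "right_module T N'"
  proof (intro right_module.intro right_module_axioms.intro T.ring_axioms)
    show "abelian_group N'"
      using abelian_group_cong[OF N.M.abelian_group_axioms] N'_simps by blast
  next
    fix v a assume v: "v \<in> carrier N'" and a: "a \<in> carrier T"
    then have vN: "v \<in> carrier N" by (simp add: N'_simps)
    obtain r z where r: "r \<in> carrier R" "z \<in> Z" "a \<otimes>\<^bsub>T\<^esub> j z = j r" by (rule fraction[OF a])
    note va = actE[OF vN a r]
    have zc: "z \<in> carrier R" using r Z_carrier by blast
    show "v \<cdot>\<^bsub>N'\<^esub> a \<in> carrier N'" using va by (simp add: N'_simps)
    show "(v \<oplus>\<^bsub>N'\<^esub> w) \<cdot>\<^bsub>N'\<^esub> a = v \<cdot>\<^bsub>N'\<^esub> a \<oplus>\<^bsub>N'\<^esub> w \<cdot>\<^bsub>N'\<^esub> a" if "w \<in> carrier N'" for w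
    proof -
      have wN: "w \<in> carrier N" using that by (simp add: N'_simps)
      note wa = actE[OF wN a r]
      have "act (v \<oplus>\<^bsub>N\<^esub> w) a = act v a \<oplus>\<^bsub>N\<^esub> act w a"
        by (rule actI[OF _ a _ r]) (use va wa vN wN zc r in \<open>simp_all add: N.ract_add_left\<close>)
      then show ?thesis by (simp add: N'_simps)
    qed
    fix b assume b: "b \<in> carrier T"
    obtain r' z' where r': "r' \<in> carrier R" "z' \<in> Z" "b \<otimes>\<^bsub>T\<^esub> j z' = j r'" by (rule fraction[OF b])
    have zc': "z' \<in> carrier R" using r' Z_carrier by blast
    have jz: "j z \<in> carrier T" "j z' \<in> carrier T" using zc zc' by auto
    note vb = actE[OF vN b r']
    \<comment> \<open>\<open>z z'\<close> is a common denominator of \<open>a\<close> and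
      \<open>b\<close>; centrality of \<open>z\<close> allows either order.\<close>
    have eq_add: "(a \<oplus>\<^bsub>T\<^esub> b) \<otimes>\<^bsub>T\<^esub> j (z \<otimes>\<^bsub>R\<^esub> z') = j (r \<otimes>\<^bsub>R\<^esub> z' \<oplus>\<^bsub>R\<^esub> r' \<otimes>\<^bsub>R\<^esub> z)"
    proof -
      have "j (z \<otimes>\<^bsub>R\<^esub> z') = j z \<otimes>\<^bsub>T\<^esub> j z'" "j (z \<otimes>\<^bsub>R\<^esub> z') = j z' \<otimes>\<^bsub>T\<^esub> j z"
        by (rule j_mult[OF zc zc'], simp only: Z_comm[OF r(2) zc'] j_mult[OF zc' zc])
      then have "a \<otimes>\<^bsub>T\<^esub> j (z \<otimes>\<^bsub>R\<^esub> z') = j (r \<otimes>\<^bsub>R\<^esub> z')" "b \<otimes>\<^bsub>T\<^esub> j (z \<otimes>\<^bsub>R\<^esub> z') = j (r' \<otimes>\<^bsub>R\<^esub> z)"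
        using a b jz r r' zc zc' by (metis T.m_assoc j_mult)+
      then show ?thesis
        using a b r r' zc zc' by (simp add: T.l_distr j_add)
    qed
    have "act v (a \<oplus>\<^bsub>T\<^esub> b) = act v a \<oplus>\<^bsub>N\<^esub> act v b"
    proof (rule actI[OF vN _ _ _ Z_mult[OF r(2) r'(2)] eq_add])
      have "(act v a \<oplus>\<^bsub>N\<^esub> act v b) \<cdot>\<^bsub>N\<^esub> (z \<otimes>\<^bsub>R\<^esub> z') = act v a \<cdot>\<^bsub>N\<^esub> z \<cdot>\<^bsub>N\<^esub> z' \<oplus>\<^bsub>N\<^esub> act v b \<cdot>\<^bsub>N\<^esub> z \<cdot>\<^bsub>N\<^esub> z'"
        using va(1) vb(1) zc zc' N.ract_closed by (simp add: N.ract_add_left N.ract_mult)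
      also have "act v b \<cdot>\<^bsub>N\<^esub> z \<cdot>\<^bsub>N\<^esub> z' = act v b \<cdot>\<^bsub>N\<^esub> z' \<cdot>\<^bsub>N\<^esub> z"
        by (rule swap[OF vb(1) r(2) zc'])
      finally show "(act v a \<oplus>\<^bsub>N\<^esub> act v b) \<cdot>\<^bsub>N\<^esub> (z \<otimes>\<^bsub>R\<^esub> z') = v \<cdot>\<^bsub>N\<^esub> (r \<otimes>\<^bsub>R\<^esub> z' \<oplus>\<^bsub>R\<^esub> r' \<otimes>\<^bsub>R\<^esub> z)"
        using va vb vN r r' zc zc' by (simp add: N.ract_add_right N.ract_mult)
    qed (use va vb a b r r' zc zc' in auto)
    then show "v \<cdot>\<^bsub>N'\<^esub> (a \<oplus>\<^bsub>T\<^esub> b) = v \<cdot>\<^bsub>N'\<^esub> a \<oplus>\<^bsub>N'\<^esub> v \<cdot>\<^bsub>N'\<^esub> b" by (simp add: N'_simps)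
    note vab = actE[OF va(1) b r']
    \<comment> \<open>The central denominator of \<open>a\<close> is moved past \<open>b\<close>, so
      numerators and denominators multiply separately.\<close>
    have eq_mult: "(a \<otimes>\<^bsub>T\<^esub> b) \<otimes>\<^bsub>T\<^esub> j (z \<otimes>\<^bsub>R\<^esub> z') = j (r \<otimes>\<^bsub>R\<^esub> r')"
    proof -
      have "(a \<otimes>\<^bsub>T\<^esub> b) \<otimes>\<^bsub>T\<^esub> j (z \<otimes>\<^bsub>R\<^esub> z') = a \<otimes>\<^bsub>T\<^esub> (b \<otimes>\<^bsub>T\<^esub> j z) \<otimes>\<^bsub>T\<^esub> j z'"
        using a b jz zc zc' by (simp add: j_mult T.m_assoc)
      also have "b \<otimes>\<^bsub>T\<^esub> j z = j z \<otimes>\<^bsub>T\<^esub> b" using j_Z_comm[OF r(2) b] by simp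
      also have "a \<otimes>\<^bsub>T\<^esub> (j z \<otimes>\<^bsub>T\<^esub> b) \<otimes>\<^bsub>T\<^esub> j z' = (a \<otimes>\<^bsub>T\<^esub> j z) \<otimes>\<^bsub>T\<^esub> (b \<otimes>\<^bsub>T\<^esub> j z')"
        using a b jz by (simp add: T.m_assoc)
      finally show ?thesis using r r' by (simp add: j_mult)
    qed
    have "act v (a \<otimes>\<^bsub>T\<^esub> b) = act (act v a) b"
    proof (rule actI[OF vN _ vab(1) _ Z_mult[OF r(2) r'(2)] eq_mult])
      have "act (act v a) b \<cdot>\<^bsub>N\<^esub> (z \<otimes>\<^bsub>R\<^esub> z') = act (act v a) b \<cdot>\<^bsub>N\<^esub> z' \<cdot>\<^bsub>N\<^esub> z"
        using N.ract_mult[OF vab(1) zc zc'] swap[OF vab(1) r(2) zc'] by simp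
      also have "\<dots> = act v a \<cdot>\<^bsub>N\<^esub> z \<cdot>\<^bsub>N\<^esub> r'"
        using swap[OF va(1) r(2) r'(1)] by (simp add: vab)
      also have "\<dots> = v \<cdot>\<^bsub>N\<^esub> (r \<otimes>\<^bsub>R\<^esub> r')"
        using vN r r' by (simp add: va N.ract_mult)
      finally show "act (act v a) b \<cdot>\<^bsub>N\<^esub> (z \<otimes>\<^bsub>R\<^esub> z') = v \<cdot>\<^bsub>N\<^esub> (r \<otimes>\<^bsub>R\<^esub> r')" .
    qed (use a b r r' in auto)
    then show "v \<cdot>\<^bsub>N'\<^esub> (a \<otimes>\<^bsub>T\<^esub> b) = v \<cdot>\<^bsub>N'\<^esub> a \<cdot>\<^bsub>N'\<^esub> b" by (simp add: N'_simps)
  next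
    fix v assume "v \<in> carrier N'"
    then show "v \<cdot>\<^bsub>N'\<^esub> \<one>\<^bsub>T\<^esub> = v"
      using jr[of v "\<one>\<^bsub>R\<^esub>"] by (simp add: N'_simps j_one N.ract_one)
  qed
  then show ?thesis
    using that[of N'] N'_simps jr by simp
qed

end

section \<open>The algebra \<open>O\<^sub>q(K\<^sup>n)\<close>\<close>

abbreviation Kring :: "'k::field ring" where
  "Kring \<equiv> ring_of_type_algebra"

lemma Kring_simps: "x \<otimes>\<^bsub>Kring\<^esub> y = x * y" "\<one>\<^bsub>Kring\<^esub> = 1" "carrier Kring = UNIV"
  by (simp_all add: ring_of_type_algebra_def)

lemma Kmult_group: "group (Kmult :: 'k::field monoid)"
proof -
  interpret ring "Kring :: 'k ring" by (rule ring_from_type_algebra)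
  show ?thesis by (rule units_group)
qed

lemma Kmult_simps: "x \<otimes>\<^bsub>Kmult\<^esub> y = x * y" "\<one>\<^bsub>Kmult\<^esub> = 1" "carrier (Kmult :: 'k::field monoid) = - {0}"
proof -
  have "x \<in> Units Kring \<longleftrightarrow> x \<noteq> 0" for x :: 'k
  proof
    assume "x \<noteq> 0"
    then show "x \<in> Units Kring"
      by (auto simp: Units_def Kring_simps intro!: exI[of _ "inverse x"])
  qed (auto simp: Units_def Kring_simps)
  then show "carrier (Kmult :: 'k monoid) = - {0}"
    by (auto simp: units_of_carrier)
qed (simp_all add: units_of_mult units_of_one Kring_simps)

lemma Kmult_pow: "x [^]\<^bsub>Kmult\<^esub> (n::nat) = x ^ n"
  by (induction n) (simp_all add: nat_pow_def Kmult_simps mult.commute)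

lemma Kmult_inv: "x \<noteq> 0 \<Longrightarrow> inv\<^bsub>Kmult\<^esub> x = inverse x" for x :: "'k::field"
  by (rule group.inv_equality[OF Kmult_group]) (auto simp: Kmult_simps)

text \<open>The order of \<open>q\<close> is the size of the cyclic group it generates. Some power
  being 1 makes this group finite, which matters because \<open>card\<close> of an infinite set is
  0.\<close>

lemma power_eq_1_iff_card_generate:
  fixes q :: "'k::field"
  assumes "q \<noteq> 0" and d: "d > 0" "q ^ d = 1"
  shows "card (generate Kmult {q}) > 0" "q ^ i = 1 \<longleftrightarrow> card (generate Kmult {q}) dvd i"
proof -
  interpret group "Kmult :: 'k monoid" by (rule Kmult_group)
  have q: "q \<in> carrier Kmult" using assms by (simp add: Kmult_simps)
  have eq_id: "q ^ i = 1 \<longleftrightarrow> ord q dvd i" for i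
    using pow_eq_id[OF q, of i] by (simp add: Kmult_pow Kmult_simps)
  have "ord q \<noteq> 0" using eq_id[of d] d by (metis dvd_0_left gr_implies_not0)
  then show "card (generate Kmult {q}) > 0" "q ^ i = 1 \<longleftrightarrow> card (generate Kmult {q}) dvd i"
    using generate_pow_card[OF q] eq_id by simp_all
qed

lemma generate_power_eq_1:
  fixes q :: "'k::field"
  assumes "q \<noteq> 0" "q ^ m = 1" "x \<in> generate Kmult {q}"
  shows "x ^ m = 1"
  using assms(3)
proof (induction rule: generate.induct)
  case (inv h)
  then show ?case using assms by (simp add: Kmult_inv power_inverse)
next
  case (eng x y)
  then show ?case by (simp add: Kmult_simps power_mult_distrib)
qed (use assms in \<open>auto simp: Kmult_simps\<close>)

locale quantum_space =
  fixes n m :: nat and Q :: "nat \<Rightarrow> nat \<Rightarrow> 'k::alg_closed_field"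
  assumes antisym: "mult_antisym n Q" and m_pos: "m > 0"
    and Q_root: "\<And>i j. i \<in> {1..n} \<Longrightarrow> j \<in> {1..n} \<Longrightarrow> Q i j ^ m = 1"
begin

sublocale pres: presentation "{1..n}" "Oq_rels n Q"
proof
  interpret F: ring "free_algebra {1..n} :: (nat list \<Rightarrow> 'k) ring" by (rule free_algebra_ring)
  show "Oq_rels n Q \<subseteq> carrier (free_algebra {1..n})"
  proof
    fix r assume "r \<in> Oq_rels n Q"
    then obtain i j where ij: "i \<in> {1..n}" "j \<in> {1..n}"
        "r = fmonom 1 [i, j] \<ominus>\<^bsub>free_algebra {1..n}\<^esub> fmonom (Q i j) [j, i]"
      unfolding Oq_rels_def by blast
    show "r \<in> carrier (free_algebra {1..n})"
      unfolding ij(3) by (intro F.minus_closed fmonom_carrier) (use ij in auto)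
  qed
qed

abbreviation "Oa \<equiv> Oq n Q"
abbreviation "x \<equiv> Oq_var n Q"

lemma Oq_algebra: "scalar_algebra Oa (Oq_scalar n Q) {1..n} x"
proof -
  have sc: "Oq_scalar n Q = (\<lambda>c. pres.cls (fmonom c []))"
    by (rule ext) (simp add: Oq_scalar_def)
  have x: "x = (\<lambda>j. pres.cls (fmonom 1 [j]))"
    by (rule ext) (simp add: Oq_var_def)
  have Oa: "Oa = pres.A"
    by (simp add: Oq_def)
  show ?thesis
    unfolding sc x Oa by (rule pres.A.scalar_algebra_axioms)
qed

sublocale Oa: scalar_algebra Oa "Oq_scalar n Q" "{1..n}" x
  by (rule Oq_algebra)

lemma Q_nonzero: "i \<in> {1..n} \<Longrightarrow> j \<in> {1..n} \<Longrightarrow> Q i j \<noteq> 0"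
  using antisym unfolding mult_antisym_def by blast

lemma x_qcomm:
  assumes "i \<in> {1..n}" "j \<in> {1..n}"
  shows "Oa.qcomm (Q i j) (x i) (x j)"
proof -
  have "pres.cls (fmonom 1 [i, j]) = pres.cls (fmonom (Q i j) [j, i])"
  proof (intro pres.cls_minus fmonom_carrier)
    show "fmonom 1 [i, j] \<ominus>\<^bsub>pres.F\<^esub> fmonom (Q i j) [j, i] \<in> Oq_rels n Q"
      unfolding Oq_rels_def using assms by blast
  qed (use assms in auto)
  then show ?thesis
    unfolding Oa.qcomm_def using assms
    by (simp add: Oq_var_def Oq_scalar_def Oq_def pres.cls_monom_mult del: One_nat_def)
qed

lemma x_pow_m_central:
  assumes "i \<in> {1..n}" shows "Oa.central (x i [^]\<^bsub>Oa\<^esub> m)"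
proof (rule Oa.central_if_commutes_gen)
  show "x i [^]\<^bsub>Oa\<^esub> m \<in> carrier Oa" using assms by simp
  fix l assume "l \<in> {1..n}"
  then show "x i [^]\<^bsub>Oa\<^esub> m \<otimes>\<^bsub>Oa\<^esub> x l = x l \<otimes>\<^bsub>Oa\<^esub> x i [^]\<^bsub>Oa\<^esub> m"
    using assms by (intro Oa.qcomm_pow_commute[OF Oa.gen_closed Oa.gen_closed x_qcomm Q_root])
qed

abbreviation "S \<equiv> mult_closure Oa (x ` {1..n})"

lemma S_carrier: "S \<subseteq> carrier Oa"
proof
  fix t assume "t \<in> S"
  then show "t \<in> carrier Oa" by induction auto
qed

lemma S_mult:
  assumes "t \<in> S" "u \<in> S"
  shows "t \<otimes>\<^bsub>Oa\<^esub> u \<in> S"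
  using assms(2)
proof induction
  case one
  then show ?case using assms(1) S_carrier by auto
next
  case (mult u g)
  have "t \<in> carrier Oa" "u \<in> carrier Oa" "g \<in> carrier Oa" using assms(1) mult S_carrier by auto
  then have "t \<otimes>\<^bsub>Oa\<^esub> (u \<otimes>\<^bsub>Oa\<^esub> g) = t \<otimes>\<^bsub>Oa\<^esub> u \<otimes>\<^bsub>Oa\<^esub> g" by (simp add: Oa.m_assoc)
  then show ?case using mult_closure.mult[OF mult.IH mult.hyps(2)] by simp
qed

lemma S_x_pow: "i \<in> {1..n} \<Longrightarrow> x i [^]\<^bsub>Oa\<^esub> (k::nat) \<in> S"
proof (induction k)
  case 0
  show ?case by (simp add: mult_closure.one)
next
  case (Suc k)
  then show ?case using mult_closure.mult[of "x i [^]\<^bsub>Oa\<^esub> k" Oa "x ` {1..n}" "x i"] by simp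
qed

text \<open>If \<open>t u\<close> is central, then \<open>t x\<^sub>i\<close> is completed by
  \<open>x\<^sub>i^(m - 1) u\<close> to the central product of \<open>t u\<close> and
  \<open>x\<^sub>i^m\<close>.\<close>

lemma S_central_multiple:
  assumes "t \<in> S"
  shows "\<exists>u\<in>carrier Oa. t \<otimes>\<^bsub>Oa\<^esub> u \<in> S \<and> Oa.central (t \<otimes>\<^bsub>Oa\<^esub> u)"
  using assms
proof induction
  case one
  show ?case
    by (intro bexI[of _ "\<one>\<^bsub>Oa\<^esub>"]) (auto simp: Oa.central_one mult_closure.one)
next
  case (mult t g)
  obtain i where i: "i \<in> {1..n}" "g = x i" using mult by auto
  obtain u where u: "u \<in> carrier Oa" "t \<otimes>\<^bsub>Oa\<^esub> u \<in> S" "Oa.central (t \<otimes>\<^bsub>Oa\<^esub> u)" using mult by blast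
  have c: "t \<in> carrier Oa" "g \<in> carrier Oa" using mult S_carrier i by auto
  have gm: "g \<otimes>\<^bsub>Oa\<^esub> g [^]\<^bsub>Oa\<^esub> (m - 1) = g [^]\<^bsub>Oa\<^esub> m"
    using Oa.nat_pow_Suc2[OF c(2), of "m - 1"] m_pos by simp
  have cen: "Oa.central (g [^]\<^bsub>Oa\<^esub> m)" using x_pow_m_central i by simp
  have "t \<otimes>\<^bsub>Oa\<^esub> g \<otimes>\<^bsub>Oa\<^esub> (g [^]\<^bsub>Oa\<^esub> (m - 1) \<otimes>\<^bsub>Oa\<^esub> u) = t \<otimes>\<^bsub>Oa\<^esub> (g [^]\<^bsub>Oa\<^esub> m \<otimes>\<^bsub>Oa\<^esub> u)"
    using c u by (simp add: Oa.m_assoc flip: gm)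
  also have "\<dots> = t \<otimes>\<^bsub>Oa\<^esub> u \<otimes>\<^bsub>Oa\<^esub> g [^]\<^bsub>Oa\<^esub> m"
    using c u Oa.centralD(2)[OF cen u(1)] by (simp add: Oa.m_assoc)
  finally have eq: "t \<otimes>\<^bsub>Oa\<^esub> g \<otimes>\<^bsub>Oa\<^esub> (g [^]\<^bsub>Oa\<^esub> (m - 1) \<otimes>\<^bsub>Oa\<^esub> u) = t \<otimes>\<^bsub>Oa\<^esub> u \<otimes>\<^bsub>Oa\<^esub> g [^]\<^bsub>Oa\<^esub> m" .
  show ?case
  proof (intro bexI[of _ "g [^]\<^bsub>Oa\<^esub> (m - 1) \<otimes>\<^bsub>Oa\<^esub> u"], unfold eq, intro conjI)
    show "t \<otimes>\<^bsub>Oa\<^esub> u \<otimes>\<^bsub>Oa\<^esub> g [^]\<^bsub>Oa\<^esub> m \<in> S" using S_mult[OF u(2) S_x_pow[OF i(1), of m]] i by simp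
    show "Oa.central (t \<otimes>\<^bsub>Oa\<^esub> u \<otimes>\<^bsub>Oa\<^esub> g [^]\<^bsub>Oa\<^esub> m)" by (rule Oa.central_mult[OF u(3) cen])
  qed (use c u in simp)
qed

text \<open>Each variable commutes with the others up to nonzero scalars and does not act as zero,
  so \<open>normal_zero_or_bij\<close> leaves only bijectivity; members of \<open>S\<close> are
  products of variables.\<close>

lemma S_bij:
  assumes N: "nontrivial_simple n Q N" and t: "t \<in> S"
  shows "bij_betw (\<lambda>v. v \<cdot>\<^bsub>N\<^esub> t) (carrier N) (carrier N)"
proof -
  have simple: "simple_right_module Oa N" using N by (simp add: nontrivial_simple_def)
  then interpret N: right_module Oa N by (simp add: simple_right_module_def)
  interpret N: simple_module Oa "Oq_scalar n Q" "{1..n}" x N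
    by (intro simple_module.intro Oa.scalar_algebra_axioms N.right_module_axioms simple_module_axioms.intro simple)
  have x: "bij_betw (\<lambda>v. v \<cdot>\<^bsub>N\<^esub> x i) (carrier N) (carrier N)" if i: "i \<in> {1..n}" for i
  proof -
    have "\<exists>c\<noteq>0. x i \<otimes>\<^bsub>Oa\<^esub> x l = x l \<otimes>\<^bsub>Oa\<^esub> x i \<otimes>\<^bsub>Oa\<^esub> Oq_scalar n Q c" if l: "l \<in> {1..n}" for l
    proof (intro exI[of _ "Q i l"] conjI Q_nonzero i l)
      have "x l \<otimes>\<^bsub>Oa\<^esub> x i \<in> carrier Oa" using i l by simp
      then show "x i \<otimes>\<^bsub>Oa\<^esub> x l = x l \<otimes>\<^bsub>Oa\<^esub> x i \<otimes>\<^bsub>Oa\<^esub> Oq_scalar n Q (Q i l)"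
        using x_qcomm[OF i l] Oa.sc_comm by (simp add: Oa.qcomm_def)
    qed
    then have "(\<forall>v\<in>carrier N. v \<cdot>\<^bsub>N\<^esub> x i = \<zero>\<^bsub>N\<^esub>) \<or> ?thesis"
      using i by (intro N.normal_zero_or_bij) auto
    then show ?thesis using N i by (auto simp: nontrivial_simple_def)
  qed
  from t show ?thesis
  proof induction
    case one
    have "bij_betw (\<lambda>v. v) (carrier N) (carrier N)" by (simp add: bij_betw_def)
    then show ?case by (rule bij_betw_cong[THEN iffD1, rotated]) (simp add: N.ract_one)
  next
    case (mult t g)
    obtain i where i: "i \<in> {1..n}" "g = x i" using mult by auto
    have "bij_betw ((\<lambda>v. v \<cdot>\<^bsub>N\<^esub> g) \<circ> (\<lambda>v. v \<cdot>\<^bsub>N\<^esub> t)) (carrier N) (carrier N)"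
      using bij_betw_trans[OF mult.IH x[OF i(1)]] i by simp
    moreover have "t \<in> carrier Oa" "g \<in> carrier Oa" using mult S_carrier i by auto
    ultimately show ?case
      by (elim bij_betw_cong[THEN iffD1, rotated]) (simp add: N.ract_mult)
  qed
qed

end

text \<open>Absorbs the fixed isomorphism: the normal form torus itself becomes a localization of
  \<open>Oq\<close>, along \<open>\<psi> \<circ> \<iota>\<close>.\<close>

lemma localization_iso:
  assumes "is_localization R S A \<iota>" "\<psi> \<in> ring_iso A T" "ring T" "ring R" "S \<subseteq> carrier R"
  shows "is_localization R S T (\<psi> \<circ> \<iota>)"
proof -
  interpret A: ring A using assms by (simp add: is_localization_def)
  interpret T: ring T by fact
  have \<psi>: "\<psi> \<in> ring_hom A T" "bij_betw \<psi> (carrier A) (carrier T)"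
    using assms by (auto simp: ring_iso_def)
  have \<iota>: "\<iota> \<in> ring_hom R A" using assms by (simp add: is_localization_def)
  interpret \<psi>: ring_hom_ring A T \<psi>
    by (intro ring_hom_ringI2 A.ring_axioms T.ring_axioms \<psi>)
  have units: "\<psi> u \<in> Units T \<and> \<psi> (inv\<^bsub>A\<^esub> u) = inv\<^bsub>T\<^esub> (\<psi> u)" if u: "u \<in> Units A" for u
  proof -
    have c: "u \<in> carrier A" "inv\<^bsub>A\<^esub> u \<in> carrier A" using u by auto
    have e: "\<psi> u \<otimes>\<^bsub>T\<^esub> \<psi> (inv\<^bsub>A\<^esub> u) = \<one>\<^bsub>T\<^esub>" "\<psi> (inv\<^bsub>A\<^esub> u) \<otimes>\<^bsub>T\<^esub> \<psi> u = \<one>\<^bsub>T\<^esub>"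
      using c u by (simp_all flip: \<psi>.hom_mult)
    then have "\<psi> u \<in> Units T" using c by (auto simp: Units_def)
    moreover have "\<psi> (inv\<^bsub>A\<^esub> u) = inv\<^bsub>T\<^esub> (\<psi> u)"
      using T.inv_unique'[OF _ _ e] c by simp
    ultimately show ?thesis ..
  qed
  have zero: "\<psi> a = \<zero>\<^bsub>T\<^esub> \<longleftrightarrow> a = \<zero>\<^bsub>A\<^esub>" if "a \<in> carrier A" for a
    using \<psi>(2) that \<psi>.hom_zero A.zero_closed unfolding bij_betw_def inj_on_def by metis
  show ?thesis
    unfolding is_localization_def
  proof (intro conjI ballI assms)
    show "\<psi> \<circ> \<iota> \<in> ring_hom R T" using ring_hom_trans[OF \<iota> \<psi>(1)] .
    show "(\<psi> \<circ> \<iota>) t \<in> Units T" if "t \<in> S" for t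
      using that units assms(1) by (simp add: is_localization_def)
    fix b assume "b \<in> carrier T"
    then obtain a where a: "a \<in> carrier A" "b = \<psi> a" using \<psi>(2) by (auto simp: bij_betw_def)
    then obtain r t where r: "r \<in> carrier R" "t \<in> S" "a = \<iota> r \<otimes>\<^bsub>A\<^esub> inv\<^bsub>A\<^esub> (\<iota> t)"
      using assms(1) by (auto simp: is_localization_def)
    have t: "\<iota> t \<in> Units A" using r assms(1) by (simp add: is_localization_def)
    have "b = (\<psi> \<circ> \<iota>) r \<otimes>\<^bsub>T\<^esub> inv\<^bsub>T\<^esub> ((\<psi> \<circ> \<iota>) t)"
      using a r t units[OF t] ring_hom_closed[OF \<iota> r(1)] by simp
    then show "\<exists>r\<in>carrier R. \<exists>t\<in>S. b = (\<psi> \<circ> \<iota>) r \<otimes>\<^bsub>T\<^esub> inv\<^bsub>T\<^esub> ((\<psi> \<circ> \<iota>) t)"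
      using r by blast
  next
    fix r assume r: "r \<in> carrier R"
    then show "(\<psi> \<circ> \<iota>) r = \<zero>\<^bsub>T\<^esub> \<longleftrightarrow> (\<exists>t\<in>S. r \<otimes>\<^bsub>R\<^esub> t = \<zero>\<^bsub>R\<^esub>)"
      using zero[OF ring_hom_closed[OF \<iota> r]] assms(1) by (simp add: is_localization_def)
  qed
qed

lemma restrict_along_right_module:
  assumes "right_module T M" "j \<in> ring_hom R T" "ring R"
  shows "right_module R (restrict_along j M)"
proof -
  interpret M: right_module T M by fact
  interpret R: ring R by fact
  have eq: "carrier (restrict_along j M) = carrier M" "add (restrict_along j M) = add M"
    "\<zero>\<^bsub>restrict_along j M\<^esub> = \<zero>\<^bsub>M\<^esub>" "\<And>v r. v \<cdot>\<^bsub>restrict_along j M\<^esub> r = v \<cdot>\<^bsub>M\<^esub> j r"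
    by (simp_all add: restrict_along_def)
  show ?thesis
    by (intro right_module.intro right_module_axioms.intro R.ring_axioms
          abelian_group_cong[OF M.M.abelian_group_axioms])
       (simp_all add: eq ring_hom_closed[OF assms(2)] ring_hom_add[OF assms(2)] ring_hom_mult[OF assms(2)]
          ring_hom_one[OF assms(2)] M.ract_closed M.ract_add_left M.ract_add_right M.ract_mult M.ract_one)
qed

lemma rmodule_isomorphic_sym:
  assumes M: "right_module A M" and iso: "rmodule_isomorphic A M N"
  shows "rmodule_isomorphic A N M"
proof -
  interpret M: right_module A M by fact
  obtain f where f: "bij_betw f (carrier M) (carrier N)"
    and add: "\<And>v w. v \<in> carrier M \<Longrightarrow> w \<in> carrier M \<Longrightarrow> f (v \<oplus>\<^bsub>M\<^esub> w) = f v \<oplus>\<^bsub>N\<^esub> f w"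
    and act: "\<And>v r. v \<in> carrier M \<Longrightarrow> r \<in> carrier A \<Longrightarrow> f (v \<cdot>\<^bsub>M\<^esub> r) = f v \<cdot>\<^bsub>N\<^esub> r"
    using iso by (auto simp: rmodule_isomorphic_def rmodule_iso_def)
  define g where "g = inv_into (carrier M) f"
  have g: "g y \<in> carrier M" "f (g y) = y" if "y \<in> carrier N" for y
    using that f by (auto simp: g_def bij_betw_def inv_into_into f_inv_into_f)
  have gf: "g (f v) = v" if "v \<in> carrier M" for v
    using that f by (simp add: g_def bij_betw_def inv_into_f_f)
  have "g \<in> rmodule_iso A N M"
    unfolding rmodule_iso_def
  proof (intro CollectI conjI ballI)
    show "bij_betw g (carrier N) (carrier M)" unfolding g_def by (rule bij_betw_inv_into[OF f])
    fix v assume v: "v \<in> carrier N"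
    show "g (v \<oplus>\<^bsub>N\<^esub> w) = g v \<oplus>\<^bsub>M\<^esub> g w" if "w \<in> carrier N" for w
      using gf[of "g v \<oplus>\<^bsub>M\<^esub> g w"] add[of "g v" "g w"] g v that by simp
    show "g (v \<cdot>\<^bsub>N\<^esub> r) = g v \<cdot>\<^bsub>M\<^esub> r" if "r \<in> carrier A" for r
      using gf[of "g v \<cdot>\<^bsub>M\<^esub> r"] act[of "g v" r] g v that M.ract_closed by simp
  qed
  then show ?thesis by (auto simp: rmodule_isomorphic_def)
qed

lemma rmodule_isomorphic_trans:
  assumes "rmodule_isomorphic A M N" "rmodule_isomorphic A N P"
  shows "rmodule_isomorphic A M P"
proof -
  obtain f g where f: "f \<in> rmodule_iso A M N" and g: "g \<in> rmodule_iso A N P"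
    using assms by (auto simp: rmodule_isomorphic_def)
  have "f v \<in> carrier N" if "v \<in> carrier M" for v
    using f that by (auto simp: rmodule_iso_def bij_betw_def)
  note fN = this
  have "bij_betw (g \<circ> f) (carrier M) (carrier P)"
    using f g by (intro bij_betw_trans[of f _ "carrier N"]) (simp_all add: rmodule_iso_def)
  then have "g \<circ> f \<in> rmodule_iso A M P"
    using f g fN by (simp add: rmodule_iso_def)
  then show ?thesis by (auto simp: rmodule_isomorphic_def)
qed

lemma rmodule_isomorphic_refl: "rmodule_isomorphic A M M"
proof -
  have "id \<in> rmodule_iso A M M" by (simp add: rmodule_iso_def)
  then show ?thesis by (auto simp: rmodule_isomorphic_def)
qed

lemma simple_iso_rel_equiv: "equiv {N. nontrivial_simple n Q N} (simple_iso_rel n Q)"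
proof (rule equivI)
  show "sym (simple_iso_rel n Q)"
  proof (rule symI)
    fix N N' assume "(N, N') \<in> simple_iso_rel n Q"
    then have *: "nontrivial_simple n Q N" "nontrivial_simple n Q N'" "rmodule_isomorphic (Oq n Q) N N'"
      by (simp_all add: simple_iso_rel_def)
    then have "right_module (Oq n Q) N" by (simp add: nontrivial_simple_def simple_right_module_def)
    then show "(N', N) \<in> simple_iso_rel n Q"
      using * rmodule_isomorphic_sym by (simp add: simple_iso_rel_def)
  qed
  show "trans (simple_iso_rel n Q)"
  proof (rule transI)
    fix N N' N'' assume "(N, N') \<in> simple_iso_rel n Q" "(N', N'') \<in> simple_iso_rel n Q"
    then show "(N, N'') \<in> simple_iso_rel n Q"
      using rmodule_isomorphic_trans[of "Oq n Q" N N' N''] by (simp add: simple_iso_rel_def)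
  qed
qed (auto simp: refl_on_def simple_iso_rel_def rmodule_isomorphic_refl)

section \<open>The theorem\<close>

theorem theoremB:
  fixes n s m :: nat
    and Q :: "nat \<Rightarrow> nat \<Rightarrow> 'k::alg_closed_field"
    and q :: 'k
    and h :: "nat \<Rightarrow> nat"
    and A :: "'a ring"
    and \<iota> :: "(nat list \<Rightarrow> 'k) set \<Rightarrow> 'a"
    and \<psi> :: "'a \<Rightarrow> (torus_letter list \<Rightarrow> 'k) set"
  assumes "mult_antisym n Q"
    and "\<forall>g\<in>param_group n Q. \<exists>d>0. g ^ d = 1"
    and "m = card (param_group n Q)"
    and "q \<noteq> 0" and "generate Kmult {q} = param_group n Q"
    and "is_quantum_torus n Q A \<iota>"
    and "nf_exponents n s m h"
    and "nf_isomorphism n Q A \<iota> s h q \<psi>"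
  shows "(\<forall>N :: ((nat list \<Rightarrow> 'k) set, 'v) rmodule. nontrivial_simple n Q N \<longrightarrow>
            (\<exists>\<alpha>\<in>Kstar n. rmodule_isomorphic (Oq n Q) N
                (restrict_along (\<psi> \<circ> \<iota>) (M_mod s m h q \<alpha>))))
       \<and> (\<exists>\<Phi> :: (nat \<Rightarrow> 'k) \<Rightarrow> ((nat list \<Rightarrow> 'k) set, (nat \<Rightarrow> nat) \<Rightarrow> 'k) rmodule set.
            (\<forall>\<alpha>\<in>Kstar n. restrict_along (\<psi> \<circ> \<iota>) (M_mod s m h q \<alpha>) \<in> \<Phi> \<alpha>)
          \<and> \<Phi> ` Kstar n = simple_iso_classes n Q)"
proof -
  let ?T = "nf_torus n s h q"
  \<comment> \<open>The torsion assumption is applied to the generator; this makes the group finite,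
    \<open>m\<close> positive and \<open>q\<close> of order exactly \<open>m\<close>.\<close>
  have q_in: "q \<in> param_group n Q"
    unfolding assms(5)[symmetric] by (rule generate.incl) simp
  then obtain d where d: "d > 0" "q ^ d = 1"
    using assms(2) by blast
  have m_pos: "m > 0" and q_order: "q ^ i = 1 \<longleftrightarrow> m dvd i" for i
    using power_eq_1_iff_card_generate[OF assms(4) d] by (simp_all add: assms(3,5))
  have Q_root: "Q i j ^ m = 1" if "i \<in> {1..n}" "j \<in> {1..n}" for i j
  proof (rule generate_power_eq_1[OF assms(4)])
    show "q ^ m = 1" using q_order by simp
    show "Q i j \<in> generate Kmult {q}"
      unfolding assms(5) param_group_def by (rule generate.incl) (use that in blast)
  qed
  interpret tor: torus n s m h q
    by unfold_locales (use assms(7,4) m_pos q_order in auto)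
  interpret qs: quantum_space n m Q
    by unfold_locales (use assms(1) m_pos Q_root in auto)
  define j where "j = \<psi> \<circ> \<iota>"
  have loc: "is_localization (Oq n Q) qs.S ?T j"
    unfolding j_def
    by (rule localization_iso[OF assms(6)[unfolded is_quantum_torus_def]])
       (use assms(8) qs.S_carrier in \<open>simp_all add: nf_isomorphism_def tor.T.ring_axioms qs.Oa.ring_axioms\<close>)
  interpret L: central_localization "Oq n Q" ?T qs.S j
  proof (intro central_localization.intro central_localization_axioms.intro
      qs.Oa.ring_axioms tor.T.ring_axioms loc qs.S_carrier mult_closure.one qs.S_mult)
    show "\<exists>u\<in>carrier (Oq n Q). t \<otimes>\<^bsub>Oq n Q\<^esub> u \<in> qs.S \<and>
        (\<forall>x\<in>carrier (Oq n Q). (t \<otimes>\<^bsub>Oq n Q\<^esub> u) \<otimes>\<^bsub>Oq n Q\<^esub> x = x \<otimes>\<^bsub>Oq n Q\<^esub> (t \<otimes>\<^bsub>Oq n Q\<^esub> u))"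
      if "t \<in> qs.S" for t
      using qs.S_central_multiple[OF that] unfolding qs.Oa.central_def by blast
  qed
  have j_scalar: "j (Oq_scalar n Q c) = nf_scalar n s h q c" for c
    using assms(8) by (simp add: j_def nf_isomorphism_def)
  have restrict_simple: "nontrivial_simple n Q (restrict_along j (M_mod s m h q \<alpha>))" if \<alpha>: "\<alpha> \<in> Kstar n" for \<alpha>
  proof -
    interpret tM: torus_M n s m h q \<alpha> by unfold_locales (rule \<alpha>)
    let ?R = "restrict_along j tM.M"
    have R: "carrier ?R = carrier tM.M" "\<zero>\<^bsub>?R\<^esub> = \<zero>\<^bsub>tM.M\<^esub>" "\<And>v r. v \<cdot>\<^bsub>?R\<^esub> r = v \<cdot>\<^bsub>tM.M\<^esub> j r"
      by (simp_all add: restrict_along_def)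
    \<comment> \<open>The inverse of a central denominator is central in the torus, hence acts on
      \<open>M(\<alpha>)\<close> by a scalar, and scalars already come from
      \<open>Oq\<close>.\<close>
    have inv: "\<exists>r\<in>carrier (Oq n Q). \<forall>v\<in>carrier tM.M. v \<cdot>\<^bsub>tM.M\<^esub> inv\<^bsub>?T\<^esub> (j z) = v \<cdot>\<^bsub>tM.M\<^esub> j r" if z: "z \<in> L.Z" for z
    proof -
      have u: "j z \<in> Units ?T" by (rule L.Z_unit[OF z])
      have "tor.T.central (inv\<^bsub>?T\<^esub> (j z))"
        unfolding tor.T.central_def
      proof (intro conjI ballI)
        fix x assume x: "x \<in> carrier ?T"
        have "x \<otimes>\<^bsub>?T\<^esub> inv\<^bsub>?T\<^esub> (j z) = inv\<^bsub>?T\<^esub> (j z) \<otimes>\<^bsub>?T\<^esub> x"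
          by (rule tor.T.commute_inverse[OF x tor.T.Units_closed[OF u] tor.T.Units_inv_closed[OF u]
                tor.T.Units_r_inv[OF u] tor.T.Units_l_inv[OF u] L.j_Z_comm[OF z x, symmetric]])
        then show "inv\<^bsub>?T\<^esub> (j z) \<otimes>\<^bsub>?T\<^esub> x = x \<otimes>\<^bsub>?T\<^esub> inv\<^bsub>?T\<^esub> (j z)" by simp
      qed (use u in simp)
      then obtain c where "\<forall>v\<in>carrier tM.M. v \<cdot>\<^bsub>tM.M\<^esub> inv\<^bsub>?T\<^esub> (j z) = v \<cdot>\<^bsub>tM.M\<^esub> nf_scalar n s h q c"
        using tM.Mm.central_scalar by blast
      then show ?thesis
        by (intro bexI[of _ "Oq_scalar n Q c"]) (simp_all add: j_scalar)
    qed
    have "simple_right_module (Oq n Q) ?R"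
      unfolding simple_right_module_def
    proof (intro conjI allI impI)
      show "right_module (Oq n Q) ?R"
        by (rule restrict_along_right_module[OF tM.M_right_module L.j_hom qs.Oa.ring_axioms])
      show "carrier ?R \<noteq> {\<zero>\<^bsub>?R\<^esub>}"
        unfolding R using tM.M_simple by (simp add: simple_right_module_def)
      fix U assume "right_submodule U (Oq n Q) ?R"
      then have "right_submodule U ?T tM.M"
        by (rule L.restrict_submodule[OF tM.M_right_module _ inv])
      then show "U = {\<zero>\<^bsub>?R\<^esub>} \<or> U = carrier ?R"
        unfolding R by (rule tM.Mm.N.submodule_cases)
    qed
    \<comment> \<open>The variables become units of the torus, and units kill no nonzero
      vector.\<close>
    moreover have "\<exists>v\<in>carrier ?R. v \<cdot>\<^bsub>?R\<^esub> Oq_var n Q i \<noteq> \<zero>\<^bsub>?R\<^esub>" if i: "i \<in> {1..n}" for i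
    proof -
      obtain v where v: "v \<in> carrier tM.M" "v \<noteq> \<zero>\<^bsub>tM.M\<^esub>" using tM.Mm.N.nonzero_exists by blast
      have "Oq_var n Q i \<in> qs.S" using qs.S_x_pow[OF i, of 1] i by simp
      then have u: "j (Oq_var n Q i) \<in> Units ?T" by (rule L.j_unit)
      have "v \<cdot>\<^bsub>tM.M\<^esub> j (Oq_var n Q i) \<noteq> \<zero>\<^bsub>tM.M\<^esub>"
        by (rule tM.Mm.unit_acts_nonzero[OF v tor.T.Units_closed[OF u] tor.T.Units_inv_closed[OF u] tor.T.Units_r_inv[OF u]])
      then show ?thesis unfolding R using v by blast
    qed
    ultimately show ?thesis by (simp add: nontrivial_simple_def)
  qed
  \<comment> \<open>Stated for an arbitrary carrier type \<open>'w\<close>, as it serves both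
    conjuncts: modules on any carrier in the first, and modules on the carrier type of
    \<open>M(\<alpha>)\<close> in the second.\<close>
  have iso: "\<exists>\<alpha>\<in>Kstar n. rmodule_isomorphic (Oq n Q) N (restrict_along j (M_mod s m h q \<alpha>))"
    if N: "nontrivial_simple n Q N" for N :: "((nat list \<Rightarrow> 'k) set, 'w) rmodule"
  proof -
    have simple: "simple_right_module (Oq n Q) N" using N by (simp add: nontrivial_simple_def)
    then have mod: "right_module (Oq n Q) N" by (simp add: simple_right_module_def)
    obtain N' :: "((torus_letter list \<Rightarrow> 'k) set, 'w) rmodule" where N': "right_module ?T N'"
        "carrier N' = carrier N" "add N' = add N" "\<zero>\<^bsub>N'\<^esub> = \<zero>\<^bsub>N\<^esub>"
        "\<And>v r. v \<in> carrier N \<Longrightarrow> r \<in> carrier (Oq n Q) \<Longrightarrow> v \<cdot>\<^bsub>N'\<^esub> j r = v \<cdot>\<^bsub>N\<^esub> r"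
      by (rule L.extend_module[OF mod qs.S_bij[OF N]]) blast+
    \<comment> \<open>A torus submodule of \<open>N'\<close> is in particular stable under
      \<open>Oq\<close>, so simplicity passes to the larger algebra.\<close>
    have simple': "simple_right_module ?T N'"
      unfolding simple_right_module_def
    proof (intro conjI allI impI N'(1))
      show "carrier N' \<noteq> {\<zero>\<^bsub>N'\<^esub>}" using simple by (simp add: N' simple_right_module_def)
      fix U assume U: "right_submodule U ?T N'"
      have sub: "additive_subgroup U N"
        using U additive_subgroup_cong[of N' N U] by (simp add: right_submodule_def N')
      have "v \<cdot>\<^bsub>N\<^esub> r \<in> U" if "v \<in> U" "r \<in> carrier (Oq n Q)" for v r
      proof -
        have "v \<in> carrier N" using additive_subgroup.a_subset[OF sub] that by auto
        then have "v \<cdot>\<^bsub>N\<^esub> r = v \<cdot>\<^bsub>N'\<^esub> j r" using that N'(5) by simp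
        then show ?thesis using U that by (simp add: right_submodule_def)
      qed
      then have "right_submodule U (Oq n Q) N" using sub by (simp add: right_submodule_def)
      then show "U = {\<zero>\<^bsub>N'\<^esub>} \<or> U = carrier N'"
        using simple by (simp add: N' simple_right_module_def)
    qed
    interpret N': torus_module n s m h q N'
      by (intro torus_module.intro tor.torus_axioms simple_module_alg_closed.intro simple_module.intro
          tor.T.scalar_algebra_axioms N'(1) simple_module_axioms.intro simple')
    obtain \<alpha> f where \<alpha>: "\<alpha> \<in> Kstar n" and f: "f \<in> rmodule_iso ?T (M_mod s m h q \<alpha>) N'"
      using N'.iso_M by blast
    let ?R = "restrict_along j (M_mod s m h q \<alpha>)"
    have f_closed: "f v \<in> carrier N" if "v \<in> carrier (M_mod s m h q \<alpha>)" for v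
      using f that N'(2) by (auto simp: rmodule_iso_def bij_betw_def)
    have "f \<in> rmodule_iso (Oq n Q) ?R N"
      using f f_closed by (simp add: rmodule_iso_def restrict_along_def N')
    then have "rmodule_isomorphic (Oq n Q) ?R N" by (auto simp: rmodule_isomorphic_def)
    moreover have "right_module (Oq n Q) ?R"
      using restrict_simple[OF \<alpha>] by (simp add: nontrivial_simple_def simple_right_module_def)
    ultimately show ?thesis using \<alpha> rmodule_isomorphic_sym by blast
  qed
  \<comment> \<open>The isomorphism class of the restricted module; surjectivity is
    \<open>iso\<close> applied to a representative of a class.\<close>
  define \<Phi> where "\<Phi> \<alpha> = simple_iso_rel n Q `` {restrict_along j (M_mod s m h q \<alpha>)}" for \<alpha>
  have "restrict_along j (M_mod s m h q \<alpha>) \<in> \<Phi> \<alpha>" if "\<alpha> \<in> Kstar n" for \<alpha>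
    using restrict_simple[OF that] by (simp add: \<Phi>_def simple_iso_rel_def rmodule_isomorphic_refl)
  moreover have "\<Phi> ` Kstar n = simple_iso_classes n Q"
  proof (intro equalityI subsetI)
    fix C assume "C \<in> \<Phi> ` Kstar n"
    then show "C \<in> simple_iso_classes n Q"
      using restrict_simple by (auto simp: simple_iso_classes_def \<Phi>_def intro: quotientI)
  next
    fix C :: "((nat list \<Rightarrow> 'k) set, (nat \<Rightarrow> nat) \<Rightarrow> 'k) rmodule set"
    assume "C \<in> simple_iso_classes n Q"
    then obtain N where N: "nontrivial_simple n Q N" "C = simple_iso_rel n Q `` {N}"
      by (auto simp: simple_iso_classes_def quotient_def)
    obtain \<alpha> where \<alpha>: "\<alpha> \<in> Kstar n" "rmodule_isomorphic (Oq n Q) N (restrict_along j (M_mod s m h q \<alpha>))"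
      using iso[OF N(1)] by blast
    have "(N, restrict_along j (M_mod s m h q \<alpha>)) \<in> simple_iso_rel n Q"
      using N \<alpha> restrict_simple by (simp add: simple_iso_rel_def)
    then have "C = \<Phi> \<alpha>"
      unfolding N \<Phi>_def by (rule equiv_class_eq[OF simple_iso_rel_equiv])
    then show "C \<in> \<Phi> ` Kstar n" using \<alpha> by blast
  qed
  ultimately show ?thesis
    using iso unfolding j_def by blast
qed

end
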